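(* For $n\ge1$ and $|t|\le1$ there is a transcendental $(n-1)$-cycle $\Sigma_{n-1}$ on the hypersurface $Y^{(n-1)}_t$ such that $$\omega_{n-1}(t)=\oint_{\Sigma_{n-1}}\eta_t^{(n-1)}=(2\pi i)^{n-1}\;{}_nF_{n-1}\!\left(\tfrac1{n+1},\dots,\tfrac n{n+1};\,1,\dots,1\,\Big|\,t\right).$$ Moreover, the fibration of $Y^{(n-1)}_t$ by the hypersurfaces $Y^{(n-2)}_{\tilde t}$ with $\tilde t=-\frac{n^n\,t}{(n+1)^{n+1}x_n(x_n+1)^n}$ induces an iterative relation between periods, namely for $n\ge2$ $$\omega_{n-1}(t)=(2\pi i)\;{}_nF_{n-1}\!\left(\tfrac1{n+1},\dots,\tfrac n{n+1};\,\tfrac1n,\dots,\tfrac{n-1}n\,\Big|\,t\right)\star\omega_{n-2}(t),$$ where the cycle $\Sigma_{n-1}$ is determined (as described in the context) by the torus $T^n(r_n):=\frac{n}{n+1}\cdot\big(T^{n-1}(r_{n-1})\times S^1_{r_{n-1}}\big)$ with $r_n=1-\frac n{n+1}$, the factor $\frac{n}{n+1}\cdot$ denoting rescaling by $\frac n{n+1}$.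
   Context: For $n\ge1$ and family parameter $t\in\mathbb{P}^1\setminus\{0,1,\infty\}$, $Y^{(n-1)}_t$ is the Calabi-Yau hypersurface (mirror of the general degree-$(n+1)$ hypersurface in $\mathbb{P}^n$) given by $$f_n(x_1,\dots,x_n,t)=x_1\cdots x_n\,(x_1+\dots+x_n+1)+\frac{(-1)^{n+1}t}{(n+1)^{n+1}}=0,$$ with holomorphic $(n-1)$-form $\eta^{(n-1)}_t=\frac{dx_2\wedge\dots\wedge dx_n}{\partial_{x_1}f_n(x_1,\dots,x_n,t)}$. For $n\ge2$ it is fibered over $\mathbb{P}^1$ with affine base coordinate $x_n$ by the hypersurfaces $Y^{(n-2)}_{\tilde t}$, via $\tilde x_i=x_i/(x_n+1)$ for $1\le i\le n-1$. $T^n(r)$ denotes the $n$-torus $S^1\times\dots\times S^1$ with all circles $|x_i|=r$, and $S^1_r$ the circle of radius $r$. The cycle $\Sigma_{n-1}$ is defined by requiring that the period of $\eta_t^{(n-1)}$ over it emerges as the residue in $x_1$ of the integral of $\frac{dx_1\wedge\dots\wedge dx_n}{f_n(x_1,\dots,x_n,t)}$ over the torus. ${}_nF_{n-1}(\alpha_1,\dots,\alpha_n;\beta_1,\dots,\beta_{n-1}|t)=\sum_{k\ge0}\frac{\prod(\alpha_i)_k}{\prod(\beta_j)_k}\frac{t^k}{k!}$ with $(\alpha)_k=\Gamma(\alpha+k)/\Gamma(\alpha)$, and $\star$ is the Hadamard product $(\sum f_kt^k)\star(\sum g_kt^k)=\sum f_kg_kt^k$. *)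

theory Defs
  imports
    "HOL-Complex_Analysis.Complex_Analysis"
    "HOL-Homology.Homology"
    "Jordan_Normal_Form.Determinant"
begin

text \<open>Points of complex n-space are functions in \<open>{1..n} \<rightarrow>\<^sub>E UNIV\<close>, so that n is an ordinary variable.\<close>

definition cspace :: "nat \<Rightarrow> (nat \<Rightarrow> complex) topology" where
  "cspace n = product_topology (\<lambda>_. euclidean) {1..n}"

definition f_poly :: "nat \<Rightarrow> (nat \<Rightarrow> complex) \<Rightarrow> complex \<Rightarrow> complex" where
  "f_poly n x t = (\<Prod>i=1..n. x i) * ((\<Sum>i=1..n. x i) + 1)
     + (-1) ^ (n + 1) * t / of_nat (n + 1) ^ (n + 1)"

text \<open>\<open>Y n t\<close> is the affine hypersurface of complex dimension \<open>n - 1\<close> in the coordinates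
  \<open>x 1, \<dots>, x n\<close>.\<close>

definition Y :: "nat \<Rightarrow> complex \<Rightarrow> (nat \<Rightarrow> complex) set" where
  "Y n t = {x \<in> {1..n} \<rightarrow>\<^sub>E UNIV. f_poly n x t = 0}"

text \<open>Coefficient of \<open>dx 2 \<and> \<dots> \<and> dx n\<close> in the holomorphic \<open>(n-1)\<close>-form.\<close>

definition eta_coeff :: "nat \<Rightarrow> complex \<Rightarrow> (nat \<Rightarrow> complex) \<Rightarrow> complex" where
  "eta_coeff n t x = 1 / deriv (\<lambda>z. f_poly n (x(1 := z)) t) (x 1)"

text \<open>The standard p-simplex is parametrised by the barycentric coordinates \<open>s 1, \<dots>, s p\<close>.\<close>

definition simplex_point :: "nat \<Rightarrow> (nat \<Rightarrow> real) \<Rightarrow> nat \<Rightarrow> real" where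
  "simplex_point p s = (\<lambda>i. if i = 0 then 1 - (\<Sum>k=1..p. s k) else if i \<le> p then s i else 0)"

definition open_simplex :: "nat \<Rightarrow> (nat \<Rightarrow> real) set" where
  "open_simplex p = {s \<in> {1..p} \<rightarrow>\<^sub>E {0<..}. (\<Sum>k=1..p. s k) < 1}"

definition C1_fun :: "nat \<Rightarrow> ((nat \<Rightarrow> real) \<Rightarrow> complex) \<Rightarrow> bool" where
  "C1_fun p h \<longleftrightarrow> (\<forall>i\<in>{1..p}. \<exists>D.
      continuous_map (product_topology (\<lambda>_. euclideanreal) {1..p}) euclidean D \<and>
      (\<forall>s\<in>{1..p} \<rightarrow>\<^sub>E UNIV. ((\<lambda>y. h (s(i := y))) has_vector_derivative D s) (at (s i))))"

text \<open>An \<open>(n-1)\<close>-simplex in complex n-space is smooth if its coordinates extend to continuously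
  differentiable functions on the affine hull of the standard simplex.\<close>

definition smooth_simplex :: "nat \<Rightarrow> ((nat \<Rightarrow> real) \<Rightarrow> nat \<Rightarrow> complex) \<Rightarrow> bool" where
  "smooth_simplex n \<sigma> \<longleftrightarrow> (\<forall>j\<in>{1..n}. \<exists>h. C1_fun (n - 1) h \<and>
      (\<forall>s\<in>{1..n - 1} \<rightarrow>\<^sub>E UNIV. simplex_point (n - 1) s \<in> standard_simplex (n - 1) \<longrightarrow>
         \<sigma> (simplex_point (n - 1) s) j = h s))"

text \<open>Entry \<open>(a, b)\<close>, counted from 0, is the derivative of \<open>x (b + 2)\<close> with respect to \<open>s (a + 1)\<close>.\<close>

definition simplex_jacobian ::
    "nat \<Rightarrow> ((nat \<Rightarrow> real) \<Rightarrow> nat \<Rightarrow> complex) \<Rightarrow> (nat \<Rightarrow> real) \<Rightarrow> complex mat" where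
  "simplex_jacobian n \<sigma> s = Matrix.mat (n - 1) (n - 1) (\<lambda>(a, b).
     vector_derivative (\<lambda>y. \<sigma> (simplex_point (n - 1) (s(a + 1 := y))) (b + 2)) (at (s (a + 1))))"

text \<open>The boundary of the simplex is a null set; leaving it out makes all partial derivatives
  two-sided.\<close>

definition simplex_integral ::
    "nat \<Rightarrow> ((nat \<Rightarrow> complex) \<Rightarrow> complex) \<Rightarrow> ((nat \<Rightarrow> real) \<Rightarrow> nat \<Rightarrow> complex) \<Rightarrow> complex" where
  "simplex_integral n g \<sigma> =
     (LINT s : open_simplex (n - 1) | (\<Pi>\<^sub>M i\<in>{1..n - 1}. lborel).
        g (\<sigma> (simplex_point (n - 1) s)) * Determinant.det (simplex_jacobian n \<sigma> s))"

definition chain_integral ::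
    "nat \<Rightarrow> ((nat \<Rightarrow> complex) \<Rightarrow> complex) \<Rightarrow> (nat \<Rightarrow> complex) chain \<Rightarrow> complex" where
  "chain_integral n g c =
     (\<Sum>\<sigma>\<in>Poly_Mapping.keys c. of_int (Poly_Mapping.lookup c \<sigma>) * simplex_integral n g \<sigma>)"

definition period :: "nat \<Rightarrow> complex \<Rightarrow> (nat \<Rightarrow> complex) chain \<Rightarrow> complex" where
  "period n t c = chain_integral n (eta_coeff n t) c"

definition smooth_cycle :: "nat \<Rightarrow> complex \<Rightarrow> (nat \<Rightarrow> complex) chain \<Rightarrow> bool" where
  "smooth_cycle n t c \<longleftrightarrow>
     singular_relcycle (n - 1) (subtopology (cspace n) (Y n t)) {} c \<and>
     (\<forall>\<sigma>\<in>Poly_Mapping.keys c. smooth_simplex n \<sigma>)"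

text \<open>A middle-dimensional cycle is transcendental when the holomorphic top form detects it: for type
  reasons the form integrates to zero over positive-dimensional algebraic cycles (and on K3 surfaces
  the vanishing of the period characterises them, by Lefschetz). This also makes sense when
  \<open>n = 1\<close>, where \<open>Y n t\<close> is finite.\<close>

definition transcendental_cycle :: "nat \<Rightarrow> complex \<Rightarrow> (nat \<Rightarrow> complex) chain \<Rightarrow> bool" where
  "transcendental_cycle n t c \<longleftrightarrow> smooth_cycle n t c \<and> period n t c \<noteq> 0"

definition torus :: "nat set \<Rightarrow> real \<Rightarrow> (nat \<Rightarrow> complex) set" where
  "torus J r = {x \<in> J \<rightarrow>\<^sub>E UNIV. \<forall>j\<in>J. norm (x j) = r}"

text \<open>Integral of \<open>g\<close> times the product of the \<open>dx j\<close>, \<open>j \<in> J\<close> in increasing order, over the torus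
  with every circle positively oriented: \<open>x j = r exp (i \<theta> j)\<close>, \<open>dx j = i x j d(\<theta> j)\<close>.\<close>

definition torus_integral :: "nat set \<Rightarrow> real \<Rightarrow> ((nat \<Rightarrow> complex) \<Rightarrow> complex) \<Rightarrow> complex" where
  "torus_integral J r g =
     (LINT \<theta> : (J \<rightarrow>\<^sub>E {0..2 * pi}) | (\<Pi>\<^sub>M j\<in>J. lborel).
        g (\<lambda>j\<in>J. of_real r * cis (\<theta> j)) * (\<Prod>j\<in>J. \<i> * of_real r * cis (\<theta> j)))"

definition torus_radius :: "nat \<Rightarrow> real" where
  "torus_radius n = 1 - real n / (real n + 1)"

text \<open>Since \<open>x 1\<close> is a simple pole of \<open>1 / f_poly\<close> at every point of such a cycle, the residue there is
  the value of \<open>eta_coeff\<close>; the cycle is the part enclosed by the first circle, over the other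
  circles. The period identities fix its multiplicity and orientation.\<close>

definition determined_by_torus :: "nat \<Rightarrow> real \<Rightarrow> complex \<Rightarrow> (nat \<Rightarrow> complex) chain \<Rightarrow> bool" where
  "determined_by_torus n r t c \<longleftrightarrow>
     (\<forall>x\<in>torus {1..n} r. f_poly n x t \<noteq> 0) \<and>
     (\<forall>\<sigma>\<in>Poly_Mapping.keys c. \<sigma> ` standard_simplex (n - 1) \<subseteq>
        {x \<in> Y n t. norm (x 1) < r \<and> restrict x {2..n} \<in> torus {2..n} r}) \<and>
     period n t c = torus_integral {2..n} r (\<lambda>x.
        \<Sum>a | norm a < r \<and> f_poly n (x(1 := a)) t = 0.
          residue (\<lambda>z. 1 / f_poly n (x(1 := z)) t) a) \<and>
     torus_integral {1..n} r (\<lambda>x. 1 / f_poly n x t) = 2 * of_real pi * \<i> * period n t c"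

definition t_tilde :: "nat \<Rightarrow> complex \<Rightarrow> complex \<Rightarrow> complex" where
  "t_tilde n t u = - (of_nat n ^ n * t / (of_nat (n + 1) ^ (n + 1) * u * (u + 1) ^ n))"

definition fibre :: "nat \<Rightarrow> complex \<Rightarrow> complex \<Rightarrow> (nat \<Rightarrow> complex) set" where
  "fibre n t u = {x \<in> Y n t. x n = u}"

definition fibre_coords :: "nat \<Rightarrow> (nat \<Rightarrow> complex) \<Rightarrow> nat \<Rightarrow> complex" where
  "fibre_coords n x = (\<lambda>i\<in>{1..n - 1}. x i / (x n + 1))"

text \<open>The family parameters with \<open>\<bar>t\<bar> \<le> 1\<close>; the fibres over 0, 1 and infinity are not part of the
  family.\<close>

definition params :: "complex set" where
  "params = {t. norm t \<le> 1} - {0, 1}"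

definition represents :: "complex set \<Rightarrow> complex fps \<Rightarrow> (complex \<Rightarrow> complex) \<Rightarrow> bool" where
  "represents D F f \<longleftrightarrow> (\<forall>t\<in>D. (\<lambda>k. fps_nth F k * t ^ k) sums f t)"

definition hadamard :: "complex fps \<Rightarrow> complex fps \<Rightarrow> complex fps" where
  "hadamard F G = Abs_fps (\<lambda>k. fps_nth F k * fps_nth G k)"

text \<open>The list \<open>1/m, \<dots>, (m-1)/m\<close>.\<close>

definition fractions :: "nat \<Rightarrow> complex list" where
  "fractions m = map (\<lambda>i. of_nat i / of_nat m) [1..<m]"

end

theory Submission
  imports Defs
begin

text \<open>On the torus \<open>\<bar>x i\<bar> = r = 1/(n+1)\<close> write \<open>f = A (1 - w)\<close> with \<open>A\<close> the product of the coordinates times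
  \<open>1 + x 1 + \<dots> + x n\<close>. Then \<open>\<bar>w\<bar> \<le> \<bar>t\<bar> \<le> 1\<close>, and \<open>\<bar>w\<bar> = 1\<close> only at the point with all coordinates \<open>- r\<close>, where
  \<open>w = t \<noteq> 1\<close>. The partial sums of the geometric series are dominated by \<open>2 / \<bar>1 - w\<bar>\<close>, so \<open>1/f\<close> may be integrated term
  by term even for \<open>\<bar>t\<bar> = 1\<close>; each term is computed by Cauchy's formula one variable at a time. The same domination
  gives the contour integral over the base of the fibration, because the coefficients of the series decrease;
  by Enestroem-Kakeya this also makes the period nonzero.

  For \<open>x 2, \<dots>, x n\<close> on the torus the equation is quadratic in \<open>x 1\<close>, with exactly one root in \<open>\<bar>x 1\<bar> < r\<close>. The cycle is the
  graph of this root over the torus in \<open>x 2, \<dots>, x n\<close>, cut into the simplices on which the angles are ordered by a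
  given permutation and weighted by the sign of that permutation.\<close>

section \<open>Coefficients of the hypergeometric series\<close>

text \<open>The radius is forced. On a torus of radius r the modulus of the product times
  \<open>1 + x 1 + ... + x n\<close> is at least r^n (1 - n r). This bound is largest at r =
  1/(n+1), where it equals r^(n+1), the modulus of the constant term of \<open>f_poly\<close> when
  |t| = 1. The closed parameter disc is thus reached with no room to spare. The series, the
  discriminant of the quadratic and \<open>t_tilde\<close> are all controlled by inequalities whose
  equality case has all coordinates involved equal to -r, and the quantity that must not vanish
  there is 1 - t in all three cases.

  The cycle needs a root that is one continuous function on the whole torus, also after full turns
  of the angles. Vieta's relations separate the two roots by modulus and the normalised discriminant
  stays off the cut of \<open>csqrt\<close>, so no monodromy arises; the boundary of the chain then
  vanishes by periodicity alone.

  In the period the sign of a permutation occurs twice, as weight of a simplex and as sign of its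
  Jacobian determinant. Hence all simplices contribute positively and together cover the cube of
  angles once.\<close>

lemma fact_add_prod: "fact (a + m) = (fact a * (\<Prod>i=1..m. of_nat (a + i)) :: 'a::field_char_0)"
  by (induction m) (simp_all add: algebra_simps)

text \<open>Gauss's multiplication formula in Pochhammer form: passing from k to k + 1 multiplies
  both sides by the m consecutive integers mk + 1, ..., mk + m.\<close>

lemma prod_pochhammer_fractions:
  assumes "m > 0"
  shows "(\<Prod>i=1..m. pochhammer (of_nat i / of_nat m :: 'a::field_char_0) k) * of_nat m ^ (m * k) = fact (m * k)"
proof (induction k)
  case 0
  then show ?case by simp
next
  case (Suc k)
  have "of_nat m ^ m * (\<Prod>i=1..m. of_nat i / of_nat m + of_nat k :: 'a)
      = (\<Prod>i=1..m. of_nat m * (of_nat i / of_nat m + of_nat k))"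
    by (simp only: prod.distrib prod_constant) simp
  also have "\<dots> = (\<Prod>i=1..m. of_nat (m * k + i))"
    using assms by (intro prod.cong refl) (simp add: field_simps)
  finally have *: "of_nat m ^ m * (\<Prod>i=1..m. of_nat i / of_nat m + of_nat k :: 'a) = (\<Prod>i=1..m. of_nat (m * k + i))" .
  have "(\<Prod>i=1..m. pochhammer (of_nat i / of_nat m :: 'a) (Suc k)) * of_nat m ^ (m * Suc k)
      = ((\<Prod>i=1..m. pochhammer (of_nat i / of_nat m) k) * of_nat m ^ (m * k))
        * (of_nat m ^ m * (\<Prod>i=1..m. of_nat i / of_nat m + of_nat k))"
    by (simp add: pochhammer_Suc prod.distrib power_add ac_simps)
  also have "\<dots> = fact (m * k) * (\<Prod>i=1..m. of_nat (m * k + i))"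
    unfolding Suc.IH * ..
  also have "\<dots> = fact (m * k + m)"
    by (rule fact_add_prod[symmetric])
  finally show ?case by (simp add: add.commute)
qed

text \<open>A multinomial coefficient divided by (n+1)^((n+1)k). It is kept real because the later
  arguments compare consecutive values.\<close>

definition hcoeff :: "nat \<Rightarrow> nat \<Rightarrow> real" where
  "hcoeff n k = fact ((n + 1) * k) / (fact k ^ (n + 1) * real (n + 1) ^ ((n + 1) * k))"

text \<open>The factor i = m of Gauss's product is the Pochhammer symbol of 1, that is k!; the
  hypergeometric parameters stop before it.\<close>

lemma prod_pochhammer_fractions_less:
  assumes "m > 0"
  shows "(\<Prod>i=1..<m. pochhammer (of_nat i / of_nat m :: 'a::field_char_0) k)
     = fact (m * k) / (fact k * of_nat m ^ (m * k))"
proof -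
  have "{1..m} = insert m {1..<m}" using assms by auto
  then have "(\<Prod>i=1..m. pochhammer (of_nat i / of_nat m :: 'a) k) = fact k * (\<Prod>i=1..<m. pochhammer (of_nat i / of_nat m) k)"
    using assms by (simp add: pochhammer_fact)
  with prod_pochhammer_fractions[OF assms, of k, where 'a = 'a] assms show ?thesis
    by (simp add: field_simps)
qed

lemma foldl_mult_eq_prod_list: "foldl (\<lambda>r a. r * f a) c xs = c * prod_list (map f xs :: 'a::comm_monoid_mult list)"
  by (induction xs arbitrary: c) (simp_all add: ac_simps)

lemma foldl_fractions:
  assumes "m > 0"
  shows "foldl (\<lambda>r a. r * pochhammer a k) 1 (fractions m) = fact (m * k) / (fact k * of_nat m ^ (m * k))"
proof -
  have "foldl (\<lambda>r a. r * pochhammer a k) 1 (fractions m) = (\<Prod>i=1..<m. pochhammer (of_nat i / of_nat m :: complex) k)"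
    unfolding foldl_mult_eq_prod_list fractions_def
    by (simp add: prod.distinct_set_conv_list[symmetric] comp_def del: upt_Suc)
  then show ?thesis using prod_pochhammer_fractions_less[OF assms] by metis
qed

lemma fps_nth_hypergeo_ones:
  assumes "n \<ge> 1"
  shows "fps_nth (fps_hypergeo (fractions (n + 1)) (replicate (n - 1) 1) 1) k = of_real (hcoeff n k)"
proof -
  have "foldl (\<lambda>r a. r * pochhammer a k) 1 (replicate (n - 1) 1) = (fact k ^ (n - 1) :: complex)"
    unfolding foldl_mult_eq_prod_list by (simp add: pochhammer_fact)
  moreover have "fact k ^ n = fact k ^ (n - 1) * (fact k :: complex)"
    using assms by (metis power_eq_if mult.commute not_one_le_zero)
  ultimately show ?thesis
    by (simp only: fps_hypergeo_nth foldl_fractions[of "n + 1", simplified]) (simp add: foldl_fractions hcoeff_def field_simps)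
qed

text \<open>The lower parameters 1/n, ..., (n-1)/n contribute (nk)!, so a binomial coefficient
  remains. It is the one that Cauchy's formula produces on the base circle of the fibration.\<close>

lemma fps_nth_hypergeo_fractions:
  assumes "n \<ge> 1"
  shows "fps_nth (fps_hypergeo (fractions (n + 1)) (fractions n) 1) k =
     of_nat (((n + 1) * k) choose k) * of_nat n ^ (n * k) / of_nat (n + 1) ^ ((n + 1) * k)"
proof -
  have "of_nat (((n + 1) * k) choose k) = (fact ((n + 1) * k) / (fact k * fact (n * k)) :: complex)"
    by (subst binomial_fact) (simp_all add: algebra_simps)
  then show ?thesis
    using assms unfolding fps_hypergeo_nth foldl_fractions[of "n + 1", simplified] 
    by (subst (1 2) foldl_fractions) (simp_all add: field_simps del: of_nat_Suc)
qed

text \<open>The Hadamard relation, coefficient by coefficient: splitting off one block of size k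
  from a multinomial coefficient leaves the multinomial coefficient with one block fewer.\<close>

lemma hcoeff_rec:
  assumes "n \<ge> 1"
  shows "of_nat (((n + 1) * k) choose k) * of_nat n ^ (n * k) / of_nat (n + 1) ^ ((n + 1) * k) * hcoeff (n - 1) k = hcoeff n k"
proof -
  have "of_nat (((n + 1) * k) choose k) = (fact ((n + 1) * k) / (fact k * fact (n * k)) :: real)"
    by (subst binomial_fact) (simp_all add: algebra_simps)
  then show ?thesis
    using assms by (simp add: hcoeff_def field_simps)
qed

lemma hcoeff_0 [simp]: "hcoeff n 0 = 1"
  by (simp add: hcoeff_def)

lemma hcoeff_pos: "hcoeff n k > 0"
  by (simp add: hcoeff_def)

text \<open>As a product of the ratios of the Pochhammer symbols of i/(n+1) to k!, the coefficient
  changes from k to k + 1 by the factors (i/(n+1) + k)/(1 + k), each less than 1.\<close>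

lemma hcoeff_Suc_less:
  assumes "n \<ge> 1"
  shows "hcoeff n (Suc k) < hcoeff n k"
proof -
  have form: "hcoeff n k = (\<Prod>i=1..<n + 1. pochhammer (of_nat i / of_nat (n + 1)) k / fact k)" for k
    unfolding prod_dividef prod_pochhammer_fractions_less[OF zero_less_Suc, of n k, folded Suc_eq_plus1] Suc_eq_plus1[symmetric]
    by (simp add: hcoeff_def del: prod.op_ivl_Suc)
  have "hcoeff n (Suc k) = hcoeff n k * (\<Prod>i=1..<n + 1. (of_nat i / of_nat (n + 1) + of_nat k) / (of_nat k + 1))"
    unfolding form prod.distrib[symmetric]
    by (intro prod.cong refl) (simp add: pochhammer_Suc field_simps)
  also have "\<dots> < hcoeff n k * 1"
  proof (intro mult_strict_left_mono hcoeff_pos)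
    have "(\<Prod>i=1..<n + 1. (of_nat i / of_nat (n + 1) + of_nat k) / (of_nat k + 1)) < (\<Prod>i=1..<n + 1. 1::real)"
      using assms by (intro prod_mono_strict) auto
    then show "(\<Prod>i=1..<n + 1. (real i / real (n + 1) + real k) / (real k + 1)) < 1" by simp
  qed
  finally show ?thesis by simp
qed

section \<open>Power series with decreasing coefficients on the closed unit disc\<close>

text \<open>Abel summation, arranged with 1 - z^j in place of z^j: for decreasing nonnegative c the
  weights are nonnegative with total c 0, and each 1 - z^j has nonnegative real part and modulus at
  most 2 in the closed disc.\<close>

lemma summation_by_parts:
  fixes c :: "nat \<Rightarrow> real" and z :: complex
  shows "(1 - z) * (\<Sum>k<Suc N. of_real (c k) * z ^ k)
       = (\<Sum>k<N. of_real (c k - c (Suc k)) * (1 - z ^ Suc k)) + of_real (c N) * (1 - z ^ Suc N)"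
proof (induction N)
  case (Suc N)
  have "(1 - z) * (\<Sum>k<Suc (Suc N). of_real (c k) * z ^ k)
      = (1 - z) * (\<Sum>k<Suc N. of_real (c k) * z ^ k) + (1 - z) * (of_real (c (Suc N)) * z ^ Suc N)"
    by (simp only: sum.lessThan_Suc[of _ "Suc N"] distrib_left)
  also have "\<dots> = (\<Sum>k<N. of_real (c k - c (Suc k)) * (1 - z ^ Suc k)) + of_real (c N) * (1 - z ^ Suc N)
      + (1 - z) * (of_real (c (Suc N)) * z ^ Suc N)"
    unfolding Suc.IH ..
  also have "\<dots> = (\<Sum>k<Suc N. of_real (c k - c (Suc k)) * (1 - z ^ Suc k)) + of_real (c (Suc N)) * (1 - z ^ Suc (Suc N))"
    by (simp add: algebra_simps)
  finally show ?case .
qed simp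

text \<open>The bound does not depend on N, so it can dominate partial sums even on the circle |z| =
  1, where absolute convergence may fail.\<close>

lemma decreasing_partial_sum_bound:
  fixes c :: "nat \<Rightarrow> real" and z :: complex
  assumes dec: "\<And>k. c (Suc k) \<le> c k" and nn: "\<And>k. c k \<ge> 0" and z: "norm z \<le> 1" "z \<noteq> 1"
  shows "norm (\<Sum>k<N. of_real (c k) * z ^ k) \<le> 2 * c 0 / norm (1 - z)"
proof (cases N)
  case 0
  then show ?thesis using nn[of 0] by simp
next
  case (Suc M)
  have le2: "norm (1 - z ^ k) \<le> 2" for k
    using norm_triangle_ineq4[of 1 "z ^ k"] power_le_one[OF norm_ge_zero z(1), of k] by (simp add: norm_power)
  have "norm ((1 - z) * (\<Sum>k<N. of_real (c k) * z ^ k)) \<le> (\<Sum>k<M. (c k - c (Suc k)) * 2) + c M * 2"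
    unfolding Suc summation_by_parts
    by (intro order.trans[OF norm_triangle_ineq] add_mono order.trans[OF norm_sum] sum_mono)
       (use dec nn le2 in \<open>auto simp: norm_mult simp del: power_Suc of_real_diff left_diff_distrib right_diff_distrib left_diff_distrib_numeral intro!: mult_mono\<close>)
  also have "\<dots> = 2 * c 0"
    unfolding sum_distrib_right[symmetric] sum_lessThan_telescope' by simp
  finally show ?thesis
    using z unfolding norm_mult by (simp add: pos_le_divide_eq mult.commute)
qed

text \<open>Every term of the summation by parts has nonnegative real part. Keeping only the term k
  = 0 bounds the real part of (1 - z) S below by (c 0 - c 1)(1 - Re z), which is positive because Re
  z = 1 in the disc means z = 1.\<close>

lemma decreasing_sum_nonzero:
  fixes c :: "nat \<Rightarrow> real" and z :: complex
  assumes dec: "\<And>k. c (Suc k) \<le> c k" and lt: "c (Suc 0) < c 0" and nn: "\<And>k. c k \<ge> 0"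
    and z: "norm z \<le> 1" "z \<noteq> 1" and s: "(\<lambda>k. of_real (c k) * z ^ k) sums S"
  shows "S \<noteq> 0"
proof -
  have ge0: "Re (z ^ k) \<le> 1" for k
    using complex_Re_le_cmod[of "z ^ k"] power_le_one[OF norm_ge_zero z(1), of k] by (simp add: norm_power)
  have "Re z < 1"
  proof (rule ccontr)
    assume "\<not> Re z < 1"
    with ge0[of 1] have "Re z = 1" by simp
    moreover from this z(1) have "Im z = 0"
      using cmod_power2[of z] power_le_one[OF norm_ge_zero z(1), of 2] by (simp)
    ultimately show False using z(2) by (simp add: complex_eq_iff)
  qed
  have "(c 0 - c (Suc 0)) * (1 - Re z) \<le> Re ((1 - z) * (\<Sum>k<Suc (Suc N). of_real (c k) * z ^ k))" for N
  proof -
    have "(c 0 - c (Suc 0)) * (1 - Re (z ^ Suc 0)) \<le> (\<Sum>k<Suc N. (c k - c (Suc k)) * (1 - Re (z ^ Suc k)))"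
      by (rule member_le_sum[of 0 _ "\<lambda>k. (c k - c (Suc k)) * (1 - Re (z ^ Suc k))"])
         (use dec ge0 in \<open>auto simp del: power_Suc\<close>)
    moreover have "0 \<le> c (Suc N) * (1 - Re (z ^ Suc (Suc N)))"
      using nn ge0 by (simp del: power_Suc)
    ultimately show ?thesis
      unfolding summation_by_parts by (simp del: power_Suc of_real_diff sum.lessThan_Suc)
  qed
  moreover have "(\<lambda>N. Re ((1 - z) * (\<Sum>k<Suc (Suc N). of_real (c k) * z ^ k))) \<longlonglongrightarrow> Re ((1 - z) * S)"
    using LIMSEQ_Suc[OF LIMSEQ_Suc[OF s[unfolded sums_def]]] by (intro tendsto_intros)
  ultimately have "(c 0 - c (Suc 0)) * (1 - Re z) \<le> Re ((1 - z) * S)"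
    by (intro LIMSEQ_le_const) auto
  moreover have "(c 0 - c (Suc 0)) * (1 - Re z) > 0"
    using lt \<open>Re z < 1\<close> by simp
  ultimately show ?thesis by auto
qed

section \<open>Integration over tori\<close>

text \<open>Product topology and product sigma-algebra have the same Borel sets for the full product
  over a countable index type. \<open>F\<close> is carried there by restriction to \<open>J\<close>,
  and points of the partial product are embedded by the value 0 outside \<open>J\<close>.\<close>

lemma borel_measurable_continuous_map_PiM:
  assumes F: "continuous_map (product_topology (\<lambda>_. euclideanreal) J) (euclidean :: 'b :: topological_space topology) F"
  shows "F \<in> borel_measurable (\<Pi>\<^sub>M j\<in>(J :: 'i :: countable set). lborel)"
proof -
  have "continuous_map (product_topology (\<lambda>_. euclideanreal) UNIV) (product_topology (\<lambda>_. euclideanreal) J) (\<lambda>x. restrict x J)"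
    by (auto simp: continuous_map_componentwise intro: continuous_map_product_projection)
  from continuous_map_compose[OF this F]
  have "continuous_on UNIV (\<lambda>x. F (restrict x J))"
    by (simp add: euclidean_product_topology comp_def continuous_map_iff_continuous2)
  then have F': "(\<lambda>x. F (restrict x J)) \<in> borel_measurable (\<Pi>\<^sub>M i\<in>UNIV. borel)"
    unfolding measurable_cong_sets[OF sets_PiM_equal_borel refl] by (rule borel_measurable_continuous_onI)
  have "(\<lambda>x i. if i \<in> J then x i else 0) \<in> measurable (\<Pi>\<^sub>M j\<in>J. lborel) (\<Pi>\<^sub>M i\<in>UNIV. borel :: real measure)"
  proof (rule measurable_PiM_single')
    fix i :: 'i
    show "(\<lambda>\<omega>. if i \<in> J then \<omega> i else 0) \<in> borel_measurable (\<Pi>\<^sub>M j\<in>J. lborel :: real measure)"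
      by (cases "i \<in> J") (simp_all add: measurable_component_singleton[where M = "\<lambda>_. lborel", simplified])
  qed (auto simp: space_PiM)
  from measurable_compose[OF this F']
  have "(\<lambda>x. F (restrict (\<lambda>i. if i \<in> J then x i else 0) J)) \<in> borel_measurable (\<Pi>\<^sub>M j\<in>J. lborel)" .
  then show ?thesis
    by (rule measurable_cong[THEN iffD1, rotated]) (auto simp: space_PiM fun_eq_iff PiE_def extensional_def intro!: arg_cong[where f = F])
qed

lemma continuous_map_bounded_on_box:
  fixes F :: "('i \<Rightarrow> real) \<Rightarrow> complex"
  assumes F: "continuous_map (product_topology (\<lambda>_. euclideanreal) J) euclidean F"
  obtains B where "\<And>\<theta>. \<theta> \<in> J \<rightarrow>\<^sub>E {a..b} \<Longrightarrow> norm (F \<theta>) \<le> B"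
proof -
  have "compactin (product_topology (\<lambda>_. euclideanreal) J) (J \<rightarrow>\<^sub>E {a..b})"
    by (subst compactin_PiE) auto
  from image_compactin[OF this F] have "bounded (F ` (J \<rightarrow>\<^sub>E {a..b}))"
    by (simp add: compact_imp_bounded)
  then show ?thesis using that by (auto simp: bounded_iff)
qed

text \<open>Turns continuity on an abstract topology into limits, for which the arithmetic rules are
  available.\<close>

lemma continuous_map_euclidean_iff:
  "continuous_map X euclidean f \<longleftrightarrow> (\<forall>x\<in>topspace X. (f \<longlongrightarrow> f x) (atin X x))"
  by (simp add: continuous_map_atin)

lemma continuous_map_mult':
  fixes f g :: "'a \<Rightarrow> 'b :: real_normed_algebra"
  shows "continuous_map X euclidean f \<Longrightarrow> continuous_map X euclidean g \<Longrightarrow> continuous_map X euclidean (\<lambda>x. f x * g x)"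
  by (simp add: continuous_map_euclidean_iff tendsto_mult)

lemma continuous_map_add':
  fixes f g :: "'a \<Rightarrow> 'b :: real_normed_vector"
  shows "continuous_map X euclidean f \<Longrightarrow> continuous_map X euclidean g \<Longrightarrow> continuous_map X euclidean (\<lambda>x. f x + g x)"
  by (simp add: continuous_map_euclidean_iff tendsto_add)

lemma continuous_map_prod':
  fixes f :: "'i \<Rightarrow> 'a \<Rightarrow> 'b :: real_normed_field"
  shows "(\<And>i. i \<in> I \<Longrightarrow> continuous_map X euclidean (f i)) \<Longrightarrow> continuous_map X euclidean (\<lambda>x. \<Prod>i\<in>I. f i x)"
  by (simp add: continuous_map_euclidean_iff tendsto_prod)

lemma continuous_map_sum':
  fixes f :: "'i \<Rightarrow> 'a \<Rightarrow> 'b :: real_normed_vector"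
  shows "(\<And>i. i \<in> I \<Longrightarrow> continuous_map X euclidean (f i)) \<Longrightarrow> continuous_map X euclidean (\<lambda>x. \<Sum>i\<in>I. f i x)"
  by (simp add: continuous_map_euclidean_iff tendsto_sum)

lemma continuous_map_inverse':
  fixes f :: "'a \<Rightarrow> 'b :: real_normed_field"
  shows "continuous_map X euclidean f \<Longrightarrow> (\<And>x. x \<in> topspace X \<Longrightarrow> f x \<noteq> 0) \<Longrightarrow> continuous_map X euclidean (\<lambda>x. inverse (f x))"
  by (simp add: continuous_map_euclidean_iff tendsto_inverse)

definition torus_point :: "nat set \<Rightarrow> real \<Rightarrow> (nat \<Rightarrow> real) \<Rightarrow> nat \<Rightarrow> complex" where
  "torus_point J r \<theta> = (\<lambda>j\<in>J. of_real r * cis (\<theta> j))"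

text \<open>Continuity of the pullback to all real angles, the form from which measurability and
  boundedness on the box of angles follow.\<close>

definition torus_cont :: "nat set \<Rightarrow> real \<Rightarrow> ((nat \<Rightarrow> complex) \<Rightarrow> complex) \<Rightarrow> bool" where
  "torus_cont J r g \<longleftrightarrow> continuous_map (product_topology (\<lambda>_. euclideanreal) J) euclidean (\<lambda>\<theta>. g (torus_point J r \<theta>))"

lemma torus_point_in_torus: "r > 0 \<Longrightarrow> torus_point J r \<theta> \<in> torus J r"
  by (auto simp: torus_point_def torus_def norm_mult)

lemma continuous_map_cis_coord:
  "j \<in> J \<Longrightarrow> continuous_map (product_topology (\<lambda>_. euclideanreal) J) euclidean (\<lambda>\<theta>. of_real r * cis (\<theta> j))"
  using continuous_map_compose[OF continuous_map_product_projection[of j J "\<lambda>_. euclideanreal"],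
      of euclidean "\<lambda>y. of_real r * cis y"]
  by (simp add: comp_def continuous_map_iff_continuous2 continuous_intros)

lemma torus_integrable:
  assumes J: "finite J" and g: "torus_cont J r g"
  shows "set_integrable (\<Pi>\<^sub>M j\<in>J. lborel) (J \<rightarrow>\<^sub>E {0..2 * pi})
     (\<lambda>\<theta>. g (\<lambda>j\<in>J. of_real r * cis (\<theta> j)) * (\<Prod>j\<in>J. \<i> * of_real r * cis (\<theta> j)))"
proof -
  interpret product_sigma_finite "\<lambda>_. lborel :: real measure" by standard
  have c: "continuous_map (product_topology (\<lambda>_. euclideanreal) J) euclidean
    (\<lambda>\<theta>. g (\<lambda>j\<in>J. of_real r * cis (\<theta> j)) * (\<Prod>j\<in>J. \<i> * of_real r * cis (\<theta> j)))" (is "continuous_map _ _ ?F")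
    using g J unfolding torus_cont_def torus_point_def mult.assoc
    by (intro continuous_map_mult' continuous_map_prod' continuous_map_cis_coord) auto
  obtain B where B: "\<And>\<theta>. \<theta> \<in> J \<rightarrow>\<^sub>E {0..2 * pi} \<Longrightarrow> norm (?F \<theta>) \<le> B"
    using continuous_map_bounded_on_box[OF c] by blast
  have m: "?F \<in> borel_measurable (\<Pi>\<^sub>M j\<in>J. lborel)"
    by (rule borel_measurable_continuous_map_PiM[OF c])
  have box: "J \<rightarrow>\<^sub>E {0..2 * pi} \<in> sets (\<Pi>\<^sub>M j\<in>J. lborel)"
    using J by (intro sets_PiM_I_finite) auto
  have "emeasure (\<Pi>\<^sub>M j\<in>J. lborel) (J \<rightarrow>\<^sub>E {0..2 * pi}) = (\<Prod>j\<in>J. emeasure lborel {0..2 * pi})"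
    using J by (intro emeasure_PiM) auto
  also have "\<dots> < \<infinity>"
    by (simp add: ennreal_mult_less_top power_less_top_ennreal)
  finally show ?thesis
    unfolding set_integrable_def
    by (intro integrableI_bounded_set[where A = "J \<rightarrow>\<^sub>E {0..2 * pi}" and B = B])
       (use m box B in \<open>auto simp: indicator_def\<close>)
qed

lemma circle_integral:
  assumes "continuous_on {0..2 * pi} (\<lambda>y. g (of_real r * cis y))"
  shows "(LINT y:{0..2 * pi}|lborel. g (of_real r * cis y) * (\<i> * of_real r * cis y)) = contour_integral (circlepath 0 r) g"
proof -
  have "set_integrable lborel {0..2 * pi} (\<lambda>y. g (of_real r * cis y) * (\<i> * of_real r * cis y))"
    by (intro borel_integrable_atLeastAtMost' continuous_intros assms)
  then have "(LINT y:{0..2 * pi}|lborel. g (of_real r * cis y) * (\<i> * of_real r * cis y))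
     = integral {0..2 * pi} (\<lambda>y. g (of_real r * cis y) * (\<i> * of_real r * cis y))"
    by (rule set_borel_integral_eq_integral)
  also have "\<dots> = contour_integral (circlepath 0 r) g"
    unfolding circlepath_def by (subst contour_integral_part_circlepath_eq) (auto simp: ac_simps)
  finally show ?thesis .
qed

lemma torus_cont_fun_upd:
  assumes g: "torus_cont (insert j J) r g" and j: "j \<notin> J" and x: "\<theta> \<in> extensional J"
  shows "continuous_on UNIV (\<lambda>y. g ((torus_point J r \<theta>)(j := of_real r * cis y)))"
proof -
  have "continuous_map euclideanreal (product_topology (\<lambda>_. euclideanreal) (insert j J)) (\<lambda>y. \<theta>(j := y))"
    using x by (auto simp: continuous_map_componentwise extensional_def)
  from continuous_map_compose[OF this g[unfolded torus_cont_def]]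
  have "continuous_on UNIV (\<lambda>y. g (torus_point (insert j J) r (\<theta>(j := y))))"
    by (simp add: comp_def continuous_map_iff_continuous2)
  moreover have "torus_point (insert j J) r (\<theta>(j := y)) = (torus_point J r \<theta>)(j := of_real r * cis y)" for y
    using j by (auto simp: torus_point_def)
  ultimately show ?thesis by simp
qed

text \<open>Fubini in the angle of \<open>x j\<close>: since dx = i x d(angle) on a circle, the
  inner integral is a contour integral. This allows a torus integral to be computed one variable at
  a time.\<close>

lemma torus_integral_insert:
  assumes J: "finite J" "j \<notin> J" and g: "torus_cont (insert j J) r g"
  shows "torus_integral (insert j J) r g =
         torus_integral J r (\<lambda>x. contour_integral (circlepath 0 r) (\<lambda>z. g (x(j := z))))"
proof -
  interpret product_sigma_finite "\<lambda>_. lborel :: real measure" by standard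
  let ?F = "\<lambda>\<theta>. indicat_real (insert j J \<rightarrow>\<^sub>E {0..2 * pi}) \<theta> *\<^sub>R (g (torus_point (insert j J) r \<theta>) * (\<Prod>j\<in>insert j J. \<i> * of_real r * cis (\<theta> j)))"
  have int: "integrable (Pi\<^sub>M (insert j J) (\<lambda>_. lborel)) ?F"
    using torus_integrable[OF _ g] J by (simp add: set_integrable_def torus_point_def)
  have "torus_integral (insert j J) r g = integral\<^sup>L (Pi\<^sub>M (insert j J) (\<lambda>_. lborel)) ?F"
    by (simp add: torus_integral_def set_lebesgue_integral_def torus_point_def)
  also have "\<dots> = (\<integral>x. (\<integral>y. ?F (x(j := y)) \<partial>lborel) \<partial>Pi\<^sub>M J (\<lambda>_. lborel))"
    by (rule product_integral_insert[OF J int])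
  also have "\<dots> = torus_integral J r (\<lambda>x. contour_integral (circlepath 0 r) (\<lambda>z. g (x(j := z))))"
    unfolding torus_integral_def set_lebesgue_integral_def torus_point_def[symmetric]
  proof (intro Bochner_Integration.integral_cong refl)
    fix \<theta> :: "nat \<Rightarrow> real" assume th: "\<theta> \<in> space (Pi\<^sub>M J (\<lambda>_. lborel))"
    then have ext: "\<theta> \<in> extensional J" by (auto simp: space_PiM PiE_def)
    let ?P = "\<Prod>j\<in>J. \<i> * complex_of_real r * cis (\<theta> j)"
    \<comment> \<open>The evaluation point, the product of the dx and the indicator of the box each
      separate into a part in \<theta> and a part in y.\<close>
    have F: "?F (\<theta>(j := y)) = indicat_real (J \<rightarrow>\<^sub>E {0..2 * pi}) \<theta> *\<^sub>R (?P *
        (indicat_real {0..2 * pi} y *\<^sub>R (g ((torus_point J r \<theta>)(j := of_real r * cis y)) * (\<i> * of_real r * cis y))))" for y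
    proof -
      have "torus_point (insert j J) r (\<theta>(j := y)) = (torus_point J r \<theta>)(j := of_real r * cis y)"
        using J by (auto simp: torus_point_def)
      moreover have "(\<Prod>i\<in>insert j J. \<i> * complex_of_real r * cis ((\<theta>(j := y)) i)) = \<i> * of_real r * cis y * ?P"
        using J by (subst prod.insert) (auto intro!: prod.cong)
      moreover have "indicat_real (insert j J \<rightarrow>\<^sub>E {0..2 * pi}) (\<theta>(j := y)) = indicat_real (J \<rightarrow>\<^sub>E {0..2 * pi}) \<theta> * indicat_real {0..2 * pi} y"
        using J ext by (auto simp: indicator_def PiE_def Pi_iff extensional_def split: if_splits)
      ultimately show ?thesis by (simp add: ac_simps)
    qed
    have "(\<integral>y. ?F (\<theta>(j := y)) \<partial>lborel) = indicat_real (J \<rightarrow>\<^sub>E {0..2 * pi}) \<theta> *\<^sub>R (?P *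
        (LINT y:{0..2 * pi}|lborel. g ((torus_point J r \<theta>)(j := of_real r * cis y)) * (\<i> * of_real r * cis y)))"
      unfolding F set_lebesgue_integral_def integral_scaleR_right integral_mult_right_zero ..
    also have "(LINT y:{0..2 * pi}|lborel. g ((torus_point J r \<theta>)(j := of_real r * cis y)) * (\<i> * of_real r * cis y))
       = contour_integral (circlepath 0 r) (\<lambda>z. g ((torus_point J r \<theta>)(j := z)))"
      by (rule circle_integral) (rule continuous_on_subset[OF torus_cont_fun_upd[OF g J(2) ext]], simp)
    finally show "(\<integral>y. ?F (\<theta>(j := y)) \<partial>lborel) = indicat_real (J \<rightarrow>\<^sub>E {0..2 * pi}) \<theta> *\<^sub>R
       (contour_integral (circlepath 0 r) (\<lambda>z. g ((torus_point J r \<theta>)(j := z))) * ?P)"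
      unfolding mult.commute[of _ ?P] .
  qed
  finally show ?thesis .
qed

lemma torus_integral_cong:
  assumes "r > 0" "\<And>x. x \<in> torus J r \<Longrightarrow> g x = h x"
  shows "torus_integral J r g = torus_integral J r h"
  unfolding torus_integral_def torus_point_def[symmetric]
  using torus_point_in_torus[OF assms(1)] assms(2) by simp

lemma torus_integral_empty: "torus_integral {} r g = g (\<lambda>_. undefined)"
proof -
  have "(\<lambda>j\<in>{}. f j) = (\<lambda>_. undefined)" for f :: "nat \<Rightarrow> complex" by auto
  then show ?thesis
    unfolding torus_integral_def set_lebesgue_integral_def PiM_empty
    by (simp add: lebesgue_integral_count_space_finite PiE_empty_domain)
qed

lemma torus_integral_cmult: "torus_integral J r (\<lambda>x. a * g x) = a * torus_integral J r g"
  by (simp add: torus_integral_def mult.assoc)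

lemma torus_integral_sum:
  assumes J: "finite J" and g: "\<And>i. i \<in> I \<Longrightarrow> torus_cont J r (g i)"
  shows "torus_integral J r (\<lambda>x. \<Sum>i\<in>I. g i x) = (\<Sum>i\<in>I. torus_integral J r (g i))"
proof -
  have "torus_integral J r (\<lambda>x. \<Sum>i\<in>I. g i x) = (\<integral>\<theta>. (\<Sum>i\<in>I. indicat_real (J \<rightarrow>\<^sub>E {0..2 * pi}) \<theta> *\<^sub>R
     (g i (\<lambda>j\<in>J. of_real r * cis (\<theta> j)) * (\<Prod>j\<in>J. \<i> * of_real r * cis (\<theta> j)))) \<partial>Pi\<^sub>M J (\<lambda>_. lborel))"
    by (simp add: torus_integral_def set_lebesgue_integral_def sum_distrib_right scaleR_sum_right)
  also have "\<dots> = (\<Sum>i\<in>I. torus_integral J r (g i))"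
    unfolding torus_integral_def set_lebesgue_integral_def
    using torus_integrable[OF J g] by (intro Bochner_Integration.integral_sum) (auto simp: set_integrable_def)
  finally show ?thesis .
qed

text \<open>The slices of a graph in direction \<open>j\<close> are single points, so Fubini makes
  the graph a null set. With constant \<open>h\<close> this removes hyperplanes, with a coordinate
  as \<open>h\<close> it removes diagonals.\<close>

lemma AE_PiM_coord_neq:
  assumes J: "finite J" "j \<notin> J" and h[measurable]: "h \<in> borel_measurable (\<Pi>\<^sub>M i\<in>J. lborel)"
  shows "AE \<theta> in (\<Pi>\<^sub>M i\<in>insert j J. lborel). \<theta> j \<noteq> (h (restrict \<theta> J) :: real)"
proof -
  interpret product_sigma_finite "\<lambda>_. lborel :: real measure" by standard
  let ?M = "\<Pi>\<^sub>M i\<in>insert j J. lborel :: real measure"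
  have r: "(\<lambda>\<theta>. restrict \<theta> J) \<in> measurable ?M (\<Pi>\<^sub>M i\<in>J. lborel)"
    by (rule measurable_restrict_subset) auto
  have hr[measurable]: "(\<lambda>\<theta>. h (restrict \<theta> J)) \<in> borel_measurable ?M"
    by (rule measurable_compose[OF r h])
  have c[measurable]: "(\<lambda>\<theta>. \<theta> j) \<in> borel_measurable ?M"
    using measurable_component_singleton[of j "insert j J" "\<lambda>_. lborel :: real measure"] by simp
  have [measurable]: "{\<theta>\<in>space ?M. \<theta> j = h (restrict \<theta> J)} \<in> sets ?M" by measurable
  have "emeasure ?M {\<theta>\<in>space ?M. \<theta> j = h (restrict \<theta> J)}
    = (\<integral>\<^sup>+ \<theta>. indicator {\<theta>\<in>space ?M. \<theta> j = h (restrict \<theta> J)} \<theta> \<partial>?M)"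
    by simp
  also have "\<dots> = (\<integral>\<^sup>+ x. (\<integral>\<^sup>+ y. indicator {\<theta>\<in>space ?M. \<theta> j = h (restrict \<theta> J)} (x(j := y)) \<partial>lborel) \<partial>Pi\<^sub>M J (\<lambda>_. lborel))"
    using J by (intro product_nn_integral_insert) auto
  also have "\<dots> = (\<integral>\<^sup>+ x. 0 \<partial>Pi\<^sub>M J (\<lambda>_. lborel :: real measure))"
  proof (intro nn_integral_cong)
    fix x :: "'a \<Rightarrow> real" assume x: "x \<in> space (Pi\<^sub>M J (\<lambda>_. lborel))"
    then have "restrict (x(j := y)) J = x" for y
      using J by (auto simp: space_PiM PiE_def extensional_def restrict_def)
    then have "(\<integral>\<^sup>+ y. indicator {\<theta>\<in>space ?M. \<theta> j = h (restrict \<theta> J)} (x(j := y)) \<partial>lborel)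
      \<le> (\<integral>\<^sup>+ y. indicator {h x} y \<partial>lborel)"
      by (intro nn_integral_mono) (auto simp: indicator_def)
    then show "(\<integral>\<^sup>+ y. indicator {\<theta>\<in>space ?M. \<theta> j = h (restrict \<theta> J)} (x(j := y)) \<partial>lborel) = 0"
      by simp
  qed
  finally show ?thesis
    by (intro AE_I[where N = "{\<theta>\<in>space ?M. \<theta> j = h (restrict \<theta> J)}"]) auto
qed

text \<open>The dominating function is a multiple of the limit itself, integrable because
  \<open>g\<close> is continuous. Convergence is asked only almost everywhere: for |t| = 1 the
  geometric series for 1/f diverges at one point of the torus.\<close>

lemma torus_integral_dominated_convergence:
  assumes J: "finite J" and r: "r > 0" and g: "torus_cont J r g" and s: "\<And>N. torus_cont J r (s N)"
    and lim: "AE \<theta> in (\<Pi>\<^sub>M i\<in>J. lborel). \<theta> \<in> J \<rightarrow>\<^sub>E {0..2 * pi} \<longrightarrow>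
        (\<lambda>N. s N (torus_point J r \<theta>)) \<longlonglongrightarrow> g (torus_point J r \<theta>)"
    and bound: "\<And>N x. x \<in> torus J r \<Longrightarrow> norm (s N x) \<le> C * norm (g x)"
  shows "(\<lambda>N. torus_integral J r (s N)) \<longlonglongrightarrow> torus_integral J r g"
proof -
  note int = torus_integrable[OF J, unfolded set_integrable_def torus_point_def[symmetric]]
  show ?thesis
    unfolding torus_integral_def set_lebesgue_integral_def torus_point_def[symmetric]
  proof (rule integral_dominated_convergence[where w = "\<lambda>\<theta>. C * norm (indicat_real (J \<rightarrow>\<^sub>E {0..2 * pi}) \<theta> *\<^sub>R
       (g (torus_point J r \<theta>) * (\<Prod>j\<in>J. \<i> * of_real r * cis (\<theta> j))))"])
    show "integrable (Pi\<^sub>M J (\<lambda>i. lborel)) (\<lambda>\<theta>. C * norm (indicat_real (J \<rightarrow>\<^sub>E {0..2 * pi}) \<theta> *\<^sub>R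
       (g (torus_point J r \<theta>) * (\<Prod>j\<in>J. \<i> * of_real r * cis (\<theta> j)))))"
      by (intro integrable_mult_right integrable_norm int g)
    show "AE \<theta> in Pi\<^sub>M J (\<lambda>i. lborel).
        (\<lambda>N. indicat_real (J \<rightarrow>\<^sub>E {0..2 * pi}) \<theta> *\<^sub>R (s N (torus_point J r \<theta>) * (\<Prod>j\<in>J. \<i> * of_real r * cis (\<theta> j))))
        \<longlonglongrightarrow> indicat_real (J \<rightarrow>\<^sub>E {0..2 * pi}) \<theta> *\<^sub>R (g (torus_point J r \<theta>) * (\<Prod>j\<in>J. \<i> * of_real r * cis (\<theta> j)))"
      using lim by eventually_elim (auto simp: indicator_def intro!: tendsto_intros)
    show "AE \<theta> in Pi\<^sub>M J (\<lambda>i. lborel).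
        norm (indicat_real (J \<rightarrow>\<^sub>E {0..2 * pi}) \<theta> *\<^sub>R (s N (torus_point J r \<theta>) * (\<Prod>j\<in>J. \<i> * of_real r * cis (\<theta> j))))
        \<le> C * norm (indicat_real (J \<rightarrow>\<^sub>E {0..2 * pi}) \<theta> *\<^sub>R (g (torus_point J r \<theta>) * (\<Prod>j\<in>J. \<i> * of_real r * cis (\<theta> j))))" for N
    proof (rule AE_I2)
      fix \<theta> :: "nat \<Rightarrow> real"
      have "norm (s N (torus_point J r \<theta>)) * norm (\<Prod>j\<in>J. \<i> * of_real r * cis (\<theta> j))
        \<le> C * norm (g (torus_point J r \<theta>)) * norm (\<Prod>j\<in>J. \<i> * of_real r * cis (\<theta> j))"
        by (intro mult_right_mono bound torus_point_in_torus r norm_ge_zero)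
      then show "norm (indicat_real (J \<rightarrow>\<^sub>E {0..2 * pi}) \<theta> *\<^sub>R (s N (torus_point J r \<theta>) * (\<Prod>j\<in>J. \<i> * of_real r * cis (\<theta> j))))
        \<le> C * norm (indicat_real (J \<rightarrow>\<^sub>E {0..2 * pi}) \<theta> *\<^sub>R (g (torus_point J r \<theta>) * (\<Prod>j\<in>J. \<i> * of_real r * cis (\<theta> j))))"
        by (cases "\<theta> \<in> J \<rightarrow>\<^sub>E {0..2 * pi}") (simp_all only: norm_scaleR norm_mult indicator_simps not_False_eq_True abs_one abs_zero mult_zero_left mult_1_left mult_zero_right order_refl mult.assoc)
    qed
  qed (use int g s in \<open>blast dest: borel_measurable_integrable\<close>)+
qed

section \<open>Cauchy's formula for monomials on a torus\<close>

lemma higher_deriv_inverse_power: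
  fixes b z :: complex
  assumes "b + z \<noteq> 0"
  shows "(deriv ^^ k) (\<lambda>z. 1 / (b + z) ^ Suc N) z = (-1) ^ k * (fact (N + k) / fact N) / (b + z) ^ Suc (N + k)"
  using assms
proof (induction k arbitrary: z)
  case (Suc k)
  have op: "open {z. b + z \<noteq> 0}"
    by (intro open_Collect_neq continuous_intros)
  have "(deriv ^^ Suc k) (\<lambda>z. 1 / (b + z) ^ Suc N) z = deriv ((deriv ^^ k) (\<lambda>z. 1 / (b + z) ^ Suc N)) z"
    by simp
  also have "\<dots> = deriv (\<lambda>z. (-1) ^ k * (fact (N + k) / fact N) / (b + z) ^ Suc (N + k)) z"
    \<comment> \<open>The formula for the k-th derivative holds only where b + z \<noteq> 0; as this
      set is open, it holds near z and may be differentiated.\<close>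
    using Suc op by (intro deriv_cong_ev eventually_mono[OF eventually_nhds_in_open[OF op]]) auto
  also have "\<dots> = (-1) ^ Suc k * (fact (N + Suc k) / fact N) / (b + z) ^ Suc (N + Suc k)"
  proof (rule DERIV_imp_deriv)
    have "((\<lambda>z. (b + z) ^ Suc (N + k)) has_field_derivative of_nat (Suc (N + k)) * (b + z) ^ (N + k)) (at z)"
    proof -
      have "((\<lambda>z. b + z) has_field_derivative 1) (at z)"
        by (auto intro!: derivative_eq_intros)
      from DERIV_power[OF this, of "Suc (N + k)"] show ?thesis
        by (simp del: power_Suc)
    qed
    from DERIV_cmult[OF DERIV_inverse_fun[OF this], of "(-1) ^ k * (fact (N + k) / fact N)"] Suc.prems
    show "((\<lambda>z. (-1) ^ k * (fact (N + k) / fact N) / (b + z) ^ Suc (N + k)) has_field_derivative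
      (-1) ^ Suc k * (fact (N + Suc k) / fact N) / (b + z) ^ Suc (N + Suc k)) (at z)"
      by (simp add: divide_simps) (simp add: ac_simps)
  qed
  finally show ?case .
qed simp

text \<open>Since |b| > r, the only pole enclosed is the one of order k + 1 at 0, and Cauchy's
  formula for the k-th derivative applies.\<close>

lemma contour_integral_monomial:
  fixes b :: complex
  assumes r: "0 < r" "r < norm b"
  shows "contour_integral (circlepath 0 r) (\<lambda>z. 1 / (z ^ Suc k * (b + z) ^ Suc N))
     = 2 * of_real pi * \<i> * (-1) ^ k * (fact (N + k) / (fact N * fact k)) / b ^ Suc (N + k)"
proof -
  have nz: "b + z \<noteq> 0" if "norm z \<le> r" for z
    using that r by (metis add_eq_0_iff norm_minus_cancel not_le)
  have b: "b \<noteq> 0" using r by auto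
  have "contour_integral (circlepath 0 r) (\<lambda>u. (1 / (b + u) ^ Suc N) / (u - 0) ^ Suc k)
      = (2 * of_real pi * \<i>) * (deriv ^^ k) (\<lambda>u. 1 / (b + u) ^ Suc N) 0 / fact k"
  proof (subst Cauchy_contour_integral_circlepath)
    show "continuous_on (cball 0 r) (\<lambda>u. 1 / (b + u) ^ Suc N)"
      using nz by (intro continuous_intros) (auto simp: dist_norm)
    show "(\<lambda>u. 1 / (b + u) ^ Suc N) holomorphic_on ball 0 r"
      using nz by (intro holomorphic_intros) (auto simp: dist_norm)
  qed (use r in \<open>auto simp del: funpow.simps\<close>)
  also have "(deriv ^^ k) (\<lambda>u. 1 / (b + u) ^ Suc N) 0 = (-1) ^ k * (fact (N + k) / fact N) / b ^ Suc (N + k)"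
    using higher_deriv_inverse_power[of b 0] b by simp
  finally show ?thesis
    by (simp add: mult.commute mult.left_commute del: power_Suc)
qed

lemma torus_norm_ge:
  fixes r :: real
  assumes J: "finite J" and x: "x \<in> torus J r"
  shows "norm (b + (\<Sum>i\<in>J. x i)) \<ge> norm b - card J * r"
proof -
  have "norm (\<Sum>i\<in>J. x i) \<le> (\<Sum>i\<in>J. norm (x i))" by (rule norm_sum)
  also have "\<dots> = card J * r" using x by (simp add: torus_def)
  finally show ?thesis
    using norm_triangle_ineq4[of "b + (\<Sum>i\<in>J. x i)" "\<Sum>i\<in>J. x i"] by simp
qed

lemma torus_prod_norm:
  assumes "x \<in> torus J r"
  shows "norm (\<Prod>i\<in>J. x i) = r ^ card J"
  using assms by (simp add: torus_def prod_norm[symmetric])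

lemma torus_contI:
  assumes "r > 0"
  shows torus_cont_const: "torus_cont J r (\<lambda>_. a)"
    and torus_cont_coord: "j \<in> J \<Longrightarrow> torus_cont J r (\<lambda>x. x j)"
    and torus_cont_mult: "torus_cont J r f \<Longrightarrow> torus_cont J r g \<Longrightarrow> torus_cont J r (\<lambda>x. f x * g x)"
    and torus_cont_add: "torus_cont J r f \<Longrightarrow> torus_cont J r g \<Longrightarrow> torus_cont J r (\<lambda>x. f x + g x)"
    and torus_cont_prod: "(\<And>i. i \<in> I \<Longrightarrow> torus_cont J r (F i)) \<Longrightarrow> torus_cont J r (\<lambda>x. \<Prod>i\<in>I. F i x)"
    and torus_cont_sum: "(\<And>i. i \<in> I \<Longrightarrow> torus_cont J r (F i)) \<Longrightarrow> torus_cont J r (\<lambda>x. \<Sum>i\<in>I. F i x)"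
    and torus_cont_divide: "torus_cont J r f \<Longrightarrow> torus_cont J r g \<Longrightarrow> (\<And>x. x \<in> torus J r \<Longrightarrow> g x \<noteq> 0) \<Longrightarrow> torus_cont J r (\<lambda>x. f x / g x)"
    and torus_cont_power: "torus_cont J r f \<Longrightarrow> torus_cont J r (\<lambda>x. f x ^ k)"
proof -
  show "torus_cont J r (\<lambda>_. a)" by (simp add: torus_cont_def)
  show "j \<in> J \<Longrightarrow> torus_cont J r (\<lambda>x. x j)"
    using continuous_map_cis_coord[of j J r] by (simp add: torus_cont_def torus_point_def)
  show mult: "torus_cont J r f \<Longrightarrow> torus_cont J r g \<Longrightarrow> torus_cont J r (\<lambda>x. f x * g x)" for f g
    unfolding torus_cont_def by (rule continuous_map_mult')
  show "torus_cont J r f \<Longrightarrow> torus_cont J r g \<Longrightarrow> torus_cont J r (\<lambda>x. f x + g x)"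
    unfolding torus_cont_def by (rule continuous_map_add')
  show "(\<And>i. i \<in> I \<Longrightarrow> torus_cont J r (F i)) \<Longrightarrow> torus_cont J r (\<lambda>x. \<Prod>i\<in>I. F i x)"
    unfolding torus_cont_def by (rule continuous_map_prod')
  show "(\<And>i. i \<in> I \<Longrightarrow> torus_cont J r (F i)) \<Longrightarrow> torus_cont J r (\<lambda>x. \<Sum>i\<in>I. F i x)"
    unfolding torus_cont_def by (rule continuous_map_sum')
  show "torus_cont J r f \<Longrightarrow> torus_cont J r g \<Longrightarrow> (\<And>x. x \<in> torus J r \<Longrightarrow> g x \<noteq> 0) \<Longrightarrow> torus_cont J r (\<lambda>x. f x / g x)"
    unfolding torus_cont_def divide_inverse
    by (intro continuous_map_mult' continuous_map_inverse') (auto intro: torus_point_in_torus assms)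
  show "torus_cont J r f \<Longrightarrow> torus_cont J r (\<lambda>x. f x ^ k)"
    using mult[of f "\<lambda>x. f x ^ k" for k] by (induction k) (simp_all add: torus_cont_def)
qed

lemma torus_cont_monomial:
  fixes r :: real
  assumes J: "finite J" and r: "0 < r" "card J * r < norm b"
  shows "torus_cont J r (\<lambda>x. 1 / ((\<Prod>i\<in>J. x i) ^ k * (b + (\<Sum>i\<in>J. x i)) ^ l))"
proof (intro torus_contI r(1))
  fix x assume x: "x \<in> torus J r"
  have "norm (\<Prod>i\<in>J. x i) > 0" using r by (simp add: torus_prod_norm[OF x])
  moreover have "norm (b + (\<Sum>i\<in>J. x i)) > 0"
    using torus_norm_ge[OF J x, of b] r by linarith
  ultimately show "(\<Prod>i\<in>J. x i) ^ k * (b + (\<Sum>i\<in>J. x i)) ^ l \<noteq> 0" by simp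
qed auto

text \<open>Integrating out one variable lowers \<open>card J\<close> by one and raises the exponent
  N + 1 of the linear factor to N + k + 1; hence the induction is over all N, and the quotients of
  factorials telescope. The condition on b keeps the zero of the linear factor outside every
  circle.\<close>

lemma torus_integral_monomial:
  fixes r :: real
  assumes "finite J" and r: "0 < r" and "card J * r < norm b"
  shows "torus_integral J r (\<lambda>x. 1 / ((\<Prod>i\<in>J. x i) ^ Suc k * (b + (\<Sum>i\<in>J. x i)) ^ Suc N))
    = (2 * of_real pi * \<i> * (-1) ^ k / fact k) ^ card J * (fact (N + card J * k) / fact N) / b ^ Suc (N + card J * k)"
  using assms(1,3)
proof (induction J arbitrary: N rule: finite_induct)
  case empty
  then show ?case by (simp add: torus_integral_empty)
next
  case (insert j J)
  have J: "card J * r < norm b" using insert r by (simp add: algebra_simps)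
  define a where "a = 2 * of_real pi * \<i> * (-1) ^ k * (fact (N + k) / (fact N * fact k) :: complex)"
  have "torus_integral (insert j J) r (\<lambda>x. 1 / ((\<Prod>i\<in>insert j J. x i) ^ Suc k * (b + (\<Sum>i\<in>insert j J. x i)) ^ Suc N))
    = torus_integral J r (\<lambda>x. contour_integral (circlepath 0 r) (\<lambda>z.
        1 / ((\<Prod>i\<in>insert j J. (x(j := z)) i) ^ Suc k * (b + (\<Sum>i\<in>insert j J. (x(j := z)) i)) ^ Suc N)))"
    using insert r by (intro torus_integral_insert torus_cont_monomial) auto
  also have "\<dots> = torus_integral J r (\<lambda>x. a * (1 / ((\<Prod>i\<in>J. x i) ^ Suc k * (b + (\<Sum>i\<in>J. x i)) ^ Suc (N + k))))"
  proof (rule torus_integral_cong[OF r])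
    fix x assume x: "x \<in> torus J r"
    \<comment> \<open>The other coordinates lower the modulus of b by at most
      \<open>card J * r\<close>, which leaves more than one further r.\<close>
    have *: "r < norm (b + (\<Sum>i\<in>J. x i))"
      using torus_norm_ge[OF insert(1) x, of b] insert r by (simp add: algebra_simps)
    have eq: "1 / ((\<Prod>i\<in>insert j J. (x(j := z)) i) ^ Suc k * (b + (\<Sum>i\<in>insert j J. (x(j := z)) i)) ^ Suc N)
        = (1 / (\<Prod>i\<in>J. x i) ^ Suc k) * (1 / (z ^ Suc k * ((b + (\<Sum>i\<in>J. x i)) + z) ^ Suc N))" for z
    proof -
      have "(\<Prod>i\<in>J. (x(j := z)) i) = (\<Prod>i\<in>J. x i)" "(\<Sum>i\<in>J. (x(j := z)) i) = (\<Sum>i\<in>J. x i)"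
        using insert(2) by (auto intro!: prod.cong sum.cong)
      then show ?thesis
        using insert(1,2) by (simp add: power_mult_distrib ac_simps)
    qed
    have "contour_integral (circlepath 0 r) (\<lambda>z.
        1 / ((\<Prod>i\<in>insert j J. (x(j := z)) i) ^ Suc k * (b + (\<Sum>i\<in>insert j J. (x(j := z)) i)) ^ Suc N))
      = (1 / (\<Prod>i\<in>J. x i) ^ Suc k) * contour_integral (circlepath 0 r) (\<lambda>z. 1 / (z ^ Suc k * ((b + (\<Sum>i\<in>J. x i)) + z) ^ Suc N))"
      unfolding eq
    proof (rule contour_integral_lmul)
      have "z ^ Suc k * ((b + (\<Sum>i\<in>J. x i)) + z) ^ Suc N \<noteq> 0" if "norm z = r" for z
      proof -
        have "b + (\<Sum>i\<in>J. x i) + z \<noteq> 0"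
          using that * by (metis add_eq_0_iff norm_minus_cancel less_irrefl)
        then show ?thesis using that r by auto
      qed
      then show "(\<lambda>z. 1 / (z ^ Suc k * ((b + (\<Sum>i\<in>J. x i)) + z) ^ Suc N)) contour_integrable_on circlepath 0 r"
        using r by (intro contour_integrable_continuous_circlepath continuous_intros) (auto simp: dist_norm)
    qed
    also have "\<dots> = a * (1 / ((\<Prod>i\<in>J. x i) ^ Suc k * (b + (\<Sum>i\<in>J. x i)) ^ Suc (N + k)))"
      unfolding contour_integral_monomial[OF r *] a_def by simp
    finally show "contour_integral (circlepath 0 r) (\<lambda>z.
        1 / ((\<Prod>i\<in>insert j J. (x(j := z)) i) ^ Suc k * (b + (\<Sum>i\<in>insert j J. (x(j := z)) i)) ^ Suc N)) = 
        a * (1 / ((\<Prod>i\<in>J. x i) ^ Suc k * (b + (\<Sum>i\<in>J. x i)) ^ Suc (N + k)))" .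
  qed
  also have "\<dots> = a * ((2 * of_real pi * \<i> * (-1) ^ k / fact k) ^ card J * (fact (N + k + card J * k) / fact (N + k)) / b ^ Suc (N + k + card J * k))"
    unfolding torus_integral_cmult insert.IH[OF J] ..
  also have "\<dots> = (2 * of_real pi * \<i> * (-1) ^ k / fact k) ^ card (insert j J) * (fact (N + card (insert j J) * k) / fact N) / b ^ Suc (N + card (insert j J) * k)"
    using insert(1,2) by (simp add: a_def field_simps)
  finally show ?case .
qed

section \<open>The period integral and the fibration\<close>

lemma torus_radius_eq: "torus_radius n = 1 / real (n + 1)"
  by (simp add: torus_radius_def field_simps)

text \<open>In the equality case the real parts sum to at most their minimal total, so each is -r;
  the modulus r then leaves no imaginary part.\<close>

lemma torus_norm_eq:
  fixes r :: real
  assumes J: "finite J" and x: "x \<in> torus J r" and eq: "norm (1 + (\<Sum>i\<in>J. x i)) = 1 - card J * r"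
    and i: "i \<in> J"
  shows "x i = - of_real r"
proof -
  have n: "norm (x i) = r" if "i \<in> J" for i using x that by (simp add: torus_def)
  have ge: "Re (x i) + r \<ge> 0" if "i \<in> J" for i
    using abs_Re_le_cmod[of "x i"] n[OF that] by simp
  have "1 + (\<Sum>i\<in>J. Re (x i)) \<le> norm (1 + (\<Sum>i\<in>J. x i))"
    using complex_Re_le_cmod[of "1 + (\<Sum>i\<in>J. x i)"] by simp
  then have "(\<Sum>i\<in>J. Re (x i) + r) \<le> 0"
    using eq by (simp add: sum.distrib)
  moreover have "(\<Sum>i\<in>J. Re (x i) + r) \<ge> 0" using ge by (rule sum_nonneg)
  ultimately have "(\<Sum>i\<in>J. Re (x i) + r) = 0" by simp
  then have Re: "Re (x i) = - r"
    using sum_nonneg_eq_0_iff[of J "\<lambda>i. Re (x i) + r"] J ge i by auto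
  moreover have "Im (x i) = 0"
    using cmod_power2[of "x i"] n[OF i] Re by simp
  ultimately show ?thesis by (simp add: complex_eq_iff)
qed

text \<open>Here \<open>e\<close> is the constant term of \<open>f_poly\<close> and - e / A is the
  ratio of the geometric series. At the critical point A = (-1)^n r^(n+1) and - e = (-1)^n t
  r^(n+1), so the sign convention in \<open>f_poly\<close> makes the ratio exactly t there.\<close>

lemma f_poly_on_torus:
  fixes n :: nat and t :: complex
  defines "e \<equiv> (-1) ^ (n + 1) * t / of_nat (n + 1) ^ (n + 1)"
  assumes n: "n \<ge> 1" and t: "t \<in> params" and x: "x \<in> torus {1..n} (torus_radius n)"
  defines "A \<equiv> (\<Prod>i=1..n. x i) * (1 + (\<Sum>i=1..n. x i))"
  shows "A \<noteq> 0" and "norm (- e / A) \<le> 1" and "f_poly n x t = A * (1 - (- e / A))"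
    and "f_poly n x t \<noteq> 0" and "- e / A \<noteq> 1"
    and "norm (- e / A) = 1 \<Longrightarrow> i \<in> {1..n} \<Longrightarrow> x i = - of_real (torus_radius n)"
proof -
  define r where "r = torus_radius n"
  have r: "r = 1 / real (n + 1)" "r > 0" by (simp_all add: r_def torus_radius_eq)
  \<comment> \<open>For r = 1/(n+1) the lower bound of the linear factor is again r.\<close>
  have nr: "1 - card {1..n} * r = r" unfolding r by (simp add: field_simps)
  have x: "x \<in> torus {1..n} r" using x by (simp add: r_def)
  have P: "norm (\<Prod>i=1..n. x i) = r ^ n" using torus_prod_norm[OF x] by simp
  have S: "norm (1 + (\<Sum>i=1..n. x i)) \<ge> r" using torus_norm_ge[OF _ x, of 1] nr by simp
  have nA: "norm A \<ge> r ^ (n + 1)"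
    unfolding A_def norm_mult P power_add power_one_right using S r(2) by (intro mult_left_mono) auto
  with zero_less_power[OF r(2), of "n + 1"] have "norm A > 0" by linarith
  then show A0: "A \<noteq> 0" by simp
  have e: "e = (-1) ^ (n + 1) * t * of_real r ^ (n + 1)" by (simp add: e_def r power_divide)
  have ne: "norm e = norm t * r ^ (n + 1)" unfolding e using r(2) by (simp add: norm_mult norm_power)
  have nt: "norm t \<le> 1" "t \<noteq> 1" using t by (auto simp: params_def)
  have "norm e \<le> 1 * r ^ (n + 1)" unfolding ne using nt r by (intro mult_right_mono) auto
  then have le: "norm e \<le> norm A" using nA by linarith
  then show "norm (- e / A) \<le> 1" using A0 by (simp add: norm_divide)
  show eq: "f_poly n x t = A * (1 - (- e / A))"
  proof -
    have "A * (1 - (- e / A)) = A + e" using A0 by (simp add: distrib_left)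
    then show ?thesis by (simp add: f_poly_def A_def e_def add.commute)
  qed
  have crit: "x i = - of_real r" if "norm (- e / A) = 1" "i \<in> {1..n}" for i
  proof (rule torus_norm_eq[OF _ x _ that(2)])
    have "norm A = norm e" using that(1) A0 by (simp add: norm_divide)
    then have "norm A \<le> r ^ (n + 1)" using \<open>norm e \<le> 1 * r ^ (n + 1)\<close> by simp
    then have "r ^ n * norm (1 + (\<Sum>i=1..n. x i)) \<le> r ^ n * r"
      unfolding A_def norm_mult P by (simp add: mult.commute)
    then have "norm (1 + (\<Sum>i=1..n. x i)) \<le> r"
      using zero_less_power[OF r(2), of n] by (simp only: mult_le_cancel_left_pos)
    with S show "norm (1 + (\<Sum>i=1..n. x i)) = 1 - card {1..n} * r" unfolding nr by simp
  qed simp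
  then show "norm (- e / A) = 1 \<Longrightarrow> i \<in> {1..n} \<Longrightarrow> x i = - of_real (torus_radius n)"
    by (simp add: r_def)
  show ne1: "- e / A \<noteq> 1"
  proof
    assume 1: "- e / A = 1"
    then have x': "x i = - of_real r" if "i \<in> {1..n}" for i using crit[OF _ that] by simp
    have "A = (\<Prod>i=1..n. - of_real r) * (1 + (\<Sum>i=1..n. - of_real r))"
      unfolding A_def using x' by simp
    also have "\<dots> = (- of_real r) ^ n * of_real (1 - card {1..n} * r)"
      by simp
    also have "\<dots> = (-1) ^ n * of_real r ^ (n + 1)" unfolding nr by (simp add: power_minus[of "of_real r"])
    finally have A: "A = (-1) ^ n * of_real r ^ (n + 1)" .
    have "- e = A" using 1 A0 by (simp add: field_simps)
    then have "(-1) ^ n * of_real r ^ (n + 1) * (t - 1) = 0"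
      unfolding e A by (simp add: algebra_simps)
    then show False using r(2) nt by simp
  qed
  then show "f_poly n x t \<noteq> 0" unfolding eq mult_eq_0_iff using A0 by (metis right_minus_eq)
qed

lemma AE_PiM_coord_neq_const:
  assumes "finite J" "j \<in> J"
  shows "AE \<theta> in (\<Pi>\<^sub>M i\<in>J. lborel). \<theta> j \<noteq> (c :: real)"
proof -
  have "insert j (J - {j}) = J" using assms by auto
  then show ?thesis
    using AE_PiM_coord_neq[of "J - {j}" j "\<lambda>_. c", OF _ _ borel_measurable_const] assms(1) by (simp only: finite_Diff) auto
qed

text \<open>Term k of the geometric series is (-e)^k times the monomial with exponent k + 1 on both
  the product and the linear factor, so its integral is the monomial formula with b = 1 and N =
  k.\<close>

lemma torus_series:
  assumes n: "n \<ge> 1" and t: "t \<in> params"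
  shows "(\<lambda>k. of_real (hcoeff n k) * t ^ k) sums
     (torus_integral {1..n} (torus_radius n) (\<lambda>x. 1 / f_poly n x t) / (2 * of_real pi * \<i>) ^ n)"
proof -
  define r where "r = torus_radius n"
  have r: "r = 1 / real (n + 1)" "r > 0" by (simp_all add: r_def torus_radius_eq)
  have nr: "card {1..n} * r < norm (1 :: complex)" unfolding r by (simp add: field_simps)
  define e where "e = (-1) ^ (n + 1) * t / of_nat (n + 1) ^ (n + 1)"
  define A where "A = (\<lambda>x :: nat \<Rightarrow> complex. (\<Prod>i=1..n. x i) * (1 + (\<Sum>i=1..n. x i)))"
  have F: "A x \<noteq> 0" "norm (- e / A x) \<le> 1" "f_poly n x t = A x * (1 - (- e / A x))"
    "f_poly n x t \<noteq> 0" "- e / A x \<noteq> 1" if "x \<in> torus {1..n} r" for x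
    unfolding A_def e_def by (fact f_poly_on_torus[OF n t that[unfolded r_def]])+
  have F6: "x 1 = - of_real r" if "x \<in> torus {1..n} r" "norm (- e / A x) = 1" for x
    unfolding r_def by (rule f_poly_on_torus(6)[OF n t that(1)[unfolded r_def] that(2)[unfolded A_def e_def]]) (use n in auto)
  define m where "m = (\<lambda>k x. 1 / ((\<Prod>i=1..n. x i) ^ Suc k * (1 + (\<Sum>i=1..n. x i)) ^ Suc k) :: complex)"
  have m: "(-e) ^ k * m k x = (- e / A x) ^ k / A x" for k x
    unfolding m_def A_def power_mult_distrib[symmetric] power_divide by simp
  have mc: "torus_cont {1..n} r (\<lambda>x. (-e) ^ k * m k x)" for k
    unfolding m_def using nr r by (intro torus_contI(1,3) torus_cont_monomial) auto
  have trm: "torus_integral {1..n} r (\<lambda>x. (-e) ^ k * m k x) = (2 * of_real pi * \<i>) ^ n * (of_real (hcoeff n k) * t ^ k)" for k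
  proof -
    have ek: "(-e) ^ k = ((-1) ^ k) ^ n * t ^ k / of_nat (n + 1) ^ ((n + 1) * k)"
    proof -
      have "- e = (-1) ^ n * t / of_nat (n + 1) ^ (n + 1)" by (simp add: e_def)
      then show ?thesis
        by (simp only: power_divide power_mult_distrib power_mult[symmetric] mult.commute)
    qed
    \<comment> \<open>One sign comes from (-e)^k, the other from the n applications of Cauchy's
      formula.\<close>
    have sq: "((-1) ^ k) ^ n * ((-1) ^ k) ^ n = (1 :: complex)"
      by (simp flip: power_mult_distrib)
    have "torus_integral {1..n} r (\<lambda>x. (-e) ^ k * m k x) = (-e) ^ k * ((2 * of_real pi * \<i> * (-1) ^ k / fact k) ^ n * (fact (k + n * k) / fact k))"
      unfolding torus_integral_cmult m_def using torus_integral_monomial[of "{1..n}" r 1 k k] nr r by simp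
    also have "\<dots> = (((-1) ^ k) ^ n * ((-1) ^ k) ^ n) * ((2 * of_real pi * \<i>) ^ n * (of_real (hcoeff n k) * t ^ k))"
      unfolding ek by (simp add: hcoeff_def power_mult_distrib power_divide mult_ac del: of_nat_Suc)
    finally show ?thesis unfolding sq mult_1_left .
  qed
  have "(\<lambda>N. torus_integral {1..n} r (\<lambda>x. \<Sum>k<N. (-e) ^ k * m k x)) \<longlonglongrightarrow> torus_integral {1..n} r (\<lambda>x. 1 / f_poly n x t)"
  proof (rule torus_integral_dominated_convergence[where C = 2])
    show "torus_cont {1..n} r (\<lambda>x. 1 / f_poly n x t)"
      unfolding f_poly_def divide_inverse[of _ "of_nat (n + 1) ^ (n + 1)"]
      by (intro torus_contI r) (use F(4) in \<open>auto simp: f_poly_def divide_inverse\<close>)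
    show "torus_cont {1..n} r (\<lambda>x. \<Sum>k<N. (-e) ^ k * m k x)" for N
      by (intro torus_cont_sum r mc)
    show "AE \<theta> in Pi\<^sub>M {1..n} (\<lambda>i. lborel). \<theta> \<in> {1..n} \<rightarrow>\<^sub>E {0..2 * pi} \<longrightarrow>
      (\<lambda>N. \<Sum>k<N. (-e) ^ k * m k (torus_point {1..n} r \<theta>)) \<longlonglongrightarrow> 1 / f_poly n (torus_point {1..n} r \<theta>) t"
    proof -
      \<comment> \<open>Divergence requires x 1 = -r, and in [0, 2 pi] this means the angle pi;
        discarding this null hyperplane discards the exceptional point.\<close>
      have "AE \<theta> in Pi\<^sub>M {1..n} (\<lambda>i. lborel). \<theta> 1 \<noteq> pi" using n by (intro AE_PiM_coord_neq_const) auto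
      then show ?thesis
      proof eventually_elim
        case (elim \<theta>)
        show ?case
        proof
          assume th: "\<theta> \<in> {1..n} \<rightarrow>\<^sub>E {0..2 * pi}"
          let ?x = "torus_point {1..n} r \<theta>"
          have x: "?x \<in> torus {1..n} r" using r by (intro torus_point_in_torus)
          have "norm (- e / A ?x) \<noteq> 1"
          proof
            assume "norm (- e / A ?x) = 1"
            from F6[OF x this] have "of_real r * (cis (\<theta> 1) + 1) = 0"
              using n by (simp add: torus_point_def distrib_left)
            then have "cis (\<theta> 1) = - 1"
              using r(2) by (simp add: eq_neg_iff_add_eq_0)
            then have "cos (\<theta> 1) = -1" by (simp add: complex_eq_iff)
            then have "cos (\<theta> 1 - pi) = 1" by simp
            then obtain k :: int where k: "\<theta> 1 - pi = real_of_int k * (2 * pi)"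
              unfolding cos_one_2pi_int by (auto simp: mult.assoc)
            have "0 \<le> \<theta> 1" "\<theta> 1 \<le> 2 * pi" using th n by (auto simp: PiE_iff)
            then have "\<bar>real_of_int k * (2 * pi)\<bar> \<le> pi" using k by auto
            then have "\<bar>real_of_int k\<bar> * 2 \<le> 1" by (simp add: abs_mult)
            then have "k = 0" by linarith
            then show False using k elim by simp
          qed
          with F(2)[OF x] have "norm (- e / A ?x) < 1" by simp
          from sums_divide[OF geometric_sums[OF this], of "A ?x"]
          show "(\<lambda>N. \<Sum>k<N. (-e) ^ k * m k ?x) \<longlonglongrightarrow> 1 / f_poly n ?x t"
            unfolding m F(3)[OF x] sums_def using F(1)[OF x] by (simp add: mult.commute)
        qed
      qed
    qed
    show "norm (\<Sum>k<N. (-e) ^ k * m k x) \<le> 2 * norm (1 / f_poly n x t)" if x: "x \<in> torus {1..n} r" for N x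
    proof -
      \<comment> \<open>The geometric series is the case of constant coefficients 1.\<close>
      have "norm (\<Sum>k<N. of_real 1 * (- e / A x) ^ k) \<le> 2 * 1 / norm (1 - - e / A x)"
        by (rule decreasing_partial_sum_bound[of "\<lambda>_. 1"]) (use F(2,5)[OF x] in auto)
      then have "norm (\<Sum>k<N. (- e / A x) ^ k) / norm (A x) \<le> 2 / norm (1 - - e / A x) / norm (A x)"
        by (intro divide_right_mono) auto
      then show ?thesis
        unfolding m F(3)[OF x] sum_divide_distrib[symmetric] by (simp add: norm_divide norm_mult mult.commute)
    qed
  qed (use r in auto)
  moreover have "torus_integral {1..n} r (\<lambda>x. \<Sum>k<N. (-e) ^ k * m k x) = (2 * of_real pi * \<i>) ^ n * (\<Sum>k<N. of_real (hcoeff n k) * t ^ k)" for N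
    unfolding torus_integral_sum[OF finite_atLeastAtMost mc] trm sum_distrib_left ..
  ultimately have "(\<lambda>N. (2 * of_real pi * \<i>) ^ n * (\<Sum>k<N. of_real (hcoeff n k) * t ^ k) / (2 * of_real pi * \<i>) ^ n)
     \<longlonglongrightarrow> torus_integral {1..n} r (\<lambda>x. 1 / f_poly n x t) / (2 * of_real pi * \<i>) ^ n"
    by (intro tendsto_divide) auto
  then show ?thesis by (simp add: sums_def r_def)
qed

lemma sums_eval_fps:
  assumes "\<And>k. fps_nth F k = a k" "(\<lambda>k. a k * t ^ k) sums (s :: complex)"
  shows "eval_fps F t = s"
  using assms sums_unique[OF assms(2)] by (simp add: eval_fps_def)

text \<open>Convergence on |t| = 1 is a by-product of the torus integral. The coefficients decay
  only like k^(-n/2), so for n \<le> 2 it is not absolute there.\<close>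

lemma hypergeo_sums:
  assumes n: "n \<ge> 1" and t: "t \<in> params"
  shows "(\<lambda>k. of_real (hcoeff n k) * t ^ k) sums eval_fps (fps_hypergeo (fractions (n + 1)) (replicate (n - 1) 1) 1) t"
    and "eval_fps (fps_hypergeo (fractions (n + 1)) (replicate (n - 1) 1) 1) t \<noteq> 0"
    and "torus_integral {1..n} (torus_radius n) (\<lambda>x. 1 / f_poly n x t)
      = (2 * of_real pi * \<i>) ^ n * eval_fps (fps_hypergeo (fractions (n + 1)) (replicate (n - 1) 1) 1) t"
proof -
  have eq: "eval_fps (fps_hypergeo (fractions (n + 1)) (replicate (n - 1) 1) 1) t
     = torus_integral {1..n} (torus_radius n) (\<lambda>x. 1 / f_poly n x t) / (2 * of_real pi * \<i>) ^ n"
    by (rule sums_eval_fps[OF fps_nth_hypergeo_ones[OF n] torus_series[OF n t]])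
  then show "torus_integral {1..n} (torus_radius n) (\<lambda>x. 1 / f_poly n x t)
      = (2 * of_real pi * \<i>) ^ n * eval_fps (fps_hypergeo (fractions (n + 1)) (replicate (n - 1) 1) 1) t"
    by simp
  show sums: "(\<lambda>k. of_real (hcoeff n k) * t ^ k) sums eval_fps (fps_hypergeo (fractions (n + 1)) (replicate (n - 1) 1) 1) t"
    using torus_series[OF n t] unfolding eq .
  show "eval_fps (fps_hypergeo (fractions (n + 1)) (replicate (n - 1) 1) 1) t \<noteq> 0"
    by (rule decreasing_sum_nonzero[OF _ _ _ _ _ sums])
       (use t n in \<open>auto simp: params_def less_imp_le[OF hcoeff_pos] less_imp_le[OF hcoeff_Suc_less] hcoeff_Suc_less[of n 0, simplified]\<close>)
qed

section \<open>The integral over the base of the fibration\<close>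

text \<open>With q = 1 - r = n/(n+1) one has \<open>t_tilde\<close> = - (r t / u) (q / (u + 1))^n,
  where |u| = r and |u + 1| \<ge> q, so the modulus does not exceed |t|. The value 1 would force |u
  + 1| = q, hence u = -r, and there \<open>t_tilde\<close> equals t.\<close>

lemma t_tilde_params:
  assumes n: "n \<ge> 2" and t: "t \<in> params" and u: "norm u = torus_radius n"
  shows "t_tilde n t u \<in> params" and "u \<noteq> 0" and "u + 1 \<noteq> 0"
proof -
  define r where "r = torus_radius n"
  define q where "q = real n / real (n + 1)"
  have r: "r = 1 / real (n + 1)" "r > 0" by (simp_all add: r_def torus_radius_eq)
  have q: "q > 0" "1 - r = q" using n by (simp_all add: q_def r field_simps)
  have u: "norm u = r" using u by (simp add: r_def)
  show u0: "u \<noteq> 0" using u r by auto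
  have ge: "norm (u + 1) \<ge> q"
    using norm_diff_ineq[of 1 u] u q by (simp add: add.commute)
  then show u1: "u + 1 \<noteq> 0" using q by auto
  have "t_tilde n t u = - (of_real q ^ n * (of_real r * t / (u * (u + 1) ^ n)))"
    by (simp add: t_tilde_def q_def r power_divide)
  then have tt: "t_tilde n t u = - (of_real r * t / u) * (of_real q / (u + 1)) ^ n"
    by (simp add: power_divide)
  have norm_tt: "norm (t_tilde n t u) = norm t * (q / norm (u + 1)) ^ n"
    using r(2) u q(1) by (simp add: tt norm_mult norm_divide norm_power)
  have b: "q / norm (u + 1) \<le> 1" "q / norm (u + 1) > 0" using ge q u1 by (auto simp: divide_simps)
  have nt: "norm t \<le> 1" "t \<noteq> 0" "t \<noteq> 1" using t by (auto simp: params_def)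
  have "norm (t_tilde n t u) \<le> 1"
    unfolding norm_tt using nt b by (intro mult_le_one power_le_one) auto
  moreover have "t_tilde n t u \<noteq> 0" using nt u0 u1 q(1) r(2) by (simp add: tt)
  moreover have "t_tilde n t u \<noteq> 1"
  proof
    assume 1: "t_tilde n t u = 1"
    then have "norm t * (q / norm (u + 1)) ^ n = 1" using norm_tt by simp
    moreover have "norm t * (q / norm (u + 1)) ^ n \<le> 1 * (q / norm (u + 1)) ^ n"
      using nt b by (intro mult_right_mono) auto
    moreover have "(q / norm (u + 1)) ^ n \<le> q / norm (u + 1)"
      using n b power_decreasing[of 1 n "q / norm (u + 1)"] by simp
    ultimately have "q / norm (u + 1) = 1" using b by linarith
    then have "norm (1 + u) = 1 - r" using q u1 by (simp add: field_simps add.commute)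
    \<comment> \<open>A torus with the single index 1, so that the equality case of the triangle
      inequality applies to u.\<close>
    moreover define x where "x = (\<lambda>i\<in>{1::nat}. u)"
    ultimately have "x 1 = - of_real r"
      using torus_norm_eq[of "{1}" x r 1] u by (simp add: torus_def)
    then have "u = - of_real r" by (simp add: x_def)
    moreover from this have "u + 1 = of_real q" unfolding q(2)[symmetric] by simp
    ultimately have "of_real r * t / u = - t" "of_real q / (u + 1) = 1" using r(2) q(1) by simp_all
    then have "t_tilde n t u = t" unfolding tt by simp
    with 1 nt show False by simp
  qed
  ultimately show "t_tilde n t u \<in> params" by (simp add: params_def)
qed

text \<open>The weight 1/(u (u + 1)) is (u + 1)^(n-1), from dx i = (u + 1) times the differential of
  the fibre coordinate, divided by u (u + 1)^n, the factor between the two defining polynomials. The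
  identity is obtained term by term in t, which avoids deforming the tori in the fibres.\<close>

lemma fibration_contour_integral:
  assumes n: "n \<ge> 2" and t: "t \<in> params"
  shows "2 * of_real pi * \<i> * eval_fps (fps_hypergeo (fractions (n + 1)) (replicate (n - 1) 1) 1) t
    = contour_integral (circlepath 0 (torus_radius n))
       (\<lambda>u. eval_fps (fps_hypergeo (fractions n) (replicate (n - 2) 1) 1) (t_tilde n t u) / (u * (u + 1)))"
    (is "_ = contour_integral _ (\<lambda>u. ?F (t_tilde n t u) / _)")
proof -
  define r where "r = torus_radius n"
  have r: "r = 1 / real (n + 1)" "r > 0" "r < 1" using n by (simp_all add: r_def torus_radius_eq)
  note P = t_tilde_params[OF n t, folded r_def]
  have F: "(\<lambda>k. of_real (hcoeff (n - 1) k) * z ^ k) sums ?F z" if "z \<in> params" for z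
    using hypergeo_sums(1)[of "n - 1" z] n that by (simp add: numeral_2_eq_2)
  \<comment> \<open>Collects all that is free of u; what remains is the one-variable monomial with b
    = 1 and N = n k.\<close>
  define C where "C = (\<lambda>k. of_real (hcoeff (n - 1) k) * ((-1) ^ k * (of_nat n ^ (n * k) * t ^ k / of_nat (n + 1) ^ ((n + 1) * k))))"
  have tk: "of_real (hcoeff (n - 1) k) * t_tilde n t u ^ k / (u * (u + 1)) = C k * (1 / (u ^ Suc k * (1 + u) ^ Suc (n * k)))" for k u
  proof -
    have "t_tilde n t u ^ k = (-1) ^ k * (of_nat n ^ (n * k) * t ^ k / (of_nat (n + 1) ^ ((n + 1) * k) * u ^ k * (u + 1) ^ (n * k)))"
      unfolding t_tilde_def power_minus[of "_ / _"] power_divide power_mult_distrib power_mult by simp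
    then show ?thesis by (simp add: C_def add.commute)
  qed
  have hk: "((\<lambda>u. C k * (1 / (u ^ Suc k * (1 + u) ^ Suc (n * k)))) has_contour_integral
     2 * of_real pi * \<i> * (of_real (hcoeff n k) * t ^ k)) (circlepath 0 r)" for k
  proof -
    have nz: "u ^ Suc k * (1 + u) ^ Suc (n * k) \<noteq> 0" if "norm u = r" for u :: complex
      using P(2,3)[OF that] by (metis add.commute mult_eq_0_iff power_not_zero)
    have "(\<lambda>u. 1 / (u ^ Suc k * (1 + u) ^ Suc (n * k))) contour_integrable_on circlepath 0 r"
      using nz r by (intro contour_integrable_continuous_circlepath continuous_intros) (auto simp: dist_norm)
    note int = has_contour_integral_integral[OF this]
    have "contour_integral (circlepath 0 r) (\<lambda>u. 1 / (u ^ Suc k * (1 + u) ^ Suc (n * k))) =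
       2 * of_real pi * \<i> * (-1) ^ k * (fact (n * k + k) / (fact (n * k) * fact k))"
      using contour_integral_monomial[of r 1 k "n * k"] r(2,3) by (simp del: power_Suc)
    from int[unfolded this] have "((\<lambda>u. 1 / (u ^ Suc k * (1 + u) ^ Suc (n * k))) has_contour_integral
       2 * of_real pi * \<i> * (-1) ^ k * (fact (n * k + k) / (fact (n * k) * fact k))) (circlepath 0 r)"
      .
    from has_contour_integral_lmul[OF this, of "C k"]
    have "((\<lambda>u. C k * (1 / (u ^ Suc k * (1 + u) ^ Suc (n * k)))) has_contour_integral
       C k * (2 * of_real pi * \<i> * (-1) ^ k * (fact (n * k + k) / (fact (n * k) * fact k)))) (circlepath 0 r)" .
    moreover have "of_nat (((n + 1) * k) choose k) = (fact (n * k + k) / (fact (n * k) * fact k) :: complex)"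
      by (subst binomial_fact) (simp_all add: algebra_simps)
    moreover have "of_real (hcoeff n k) = (of_nat (((n + 1) * k) choose k) * of_nat n ^ (n * k) / of_nat (n + 1) ^ ((n + 1) * k) * of_real (hcoeff (n - 1) k) :: complex)"
      using arg_cong[OF hcoeff_rec[of n k], of complex_of_real] n
      by (simp only: of_real_mult of_real_divide of_real_power of_real_of_nat_eq)
    moreover have "C k * (2 * of_real pi * \<i> * (-1) ^ k * B) = ((-1) ^ k * (-1) ^ k) *
        (2 * of_real pi * \<i> * ((B * of_nat n ^ (n * k) / of_nat (n + 1) ^ ((n + 1) * k) * of_real (hcoeff (n - 1) k)) * t ^ k))" for B
      by (simp add: C_def mult_ac)
    moreover have "(-1) ^ k * (-1) ^ k = (1 :: complex)" by (simp flip: power_mult_distrib)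
    ultimately show ?thesis by (simp only: mult_1_left)
  qed
  define s where "s = (\<lambda>N u. (\<Sum>k<N. of_real (hcoeff (n - 1) k) * t_tilde n t u ^ k) / (u * (u + 1)))"
  have s: "s N = (\<lambda>u. \<Sum>k<N. C k * (1 / (u ^ Suc k * (1 + u) ^ Suc (n * k))))" for N
    unfolding s_def sum_divide_distrib tk ..
  define p where "p = (\<lambda>\<theta>. of_real r * cis \<theta>)"
  have p: "norm (p \<theta>) = r" for \<theta> using r(2) by (simp add: p_def norm_mult)
  have "((\<lambda>\<theta>. ?F (t_tilde n t (p \<theta>)) / (p \<theta> * (p \<theta> + 1)) * of_real r * \<i> * cis \<theta>) has_integral
     2 * of_real pi * \<i> * eval_fps (fps_hypergeo (fractions (n + 1)) (replicate (n - 1) 1) 1) t) {0..2 * pi}"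
  proof (rule has_integral_dominated_convergence)
    show "((\<lambda>\<theta>. s N (p \<theta>) * of_real r * \<i> * cis \<theta>) has_integral
       (\<Sum>k<N. 2 * of_real pi * \<i> * (of_real (hcoeff n k) * t ^ k))) {0..2 * pi}" for N
    proof -
      have "(s N has_contour_integral (\<Sum>k<N. 2 * of_real pi * \<i> * (of_real (hcoeff n k) * t ^ k))) (circlepath 0 r)"
        unfolding s by (intro has_contour_integral_sum hk) auto
      then show ?thesis unfolding circlepath_def p_def
        by (subst (asm) has_contour_integral_part_circlepath_iff) auto
    qed
    \<comment> \<open>The factor r from du cancels |u| = r in the weight. The bound is continuous
      because \<open>t_tilde\<close> avoids 1 on the circle.\<close>
    show "(\<lambda>\<theta>. (2 / norm (1 - t_tilde n t (p \<theta>))) / norm (p \<theta> + 1)) integrable_on {0..2 * pi}"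
      unfolding t_tilde_def
    proof (intro integrable_continuous_interval continuous_intros)
      show "continuous_on {0..2 * pi} p" unfolding p_def by (intro continuous_intros)
      show "\<forall>x\<in>{0..2 * pi}. of_nat (n + 1) ^ (n + 1) * p x * (p x + 1) ^ n \<noteq> 0"
        using P(2,3)[OF p] by (simp del: of_nat_Suc of_nat_add)
      show "\<forall>x\<in>{0..2 * pi}. norm (1 - - (of_nat n ^ n * t / (of_nat (n + 1) ^ (n + 1) * p x * (p x + 1) ^ n))) \<noteq> 0"
        using P(1)[OF p] unfolding t_tilde_def[symmetric] params_def by auto
      show "\<forall>x\<in>{0..2 * pi}. norm (p x + 1) \<noteq> 0"
        using P(3)[OF p] by simp
    qed (auto simp: p_def intro!: continuous_intros)
    show "\<forall>\<theta>\<in>{0..2 * pi}. norm (s N (p \<theta>) * of_real r * \<i> * cis \<theta>) \<le> (2 / norm (1 - t_tilde n t (p \<theta>))) / norm (p \<theta> + 1)" for N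
    proof
      fix \<theta>
      let ?z = "t_tilde n t (p \<theta>)"
      have "norm (\<Sum>k<N. of_real (hcoeff (n - 1) k) * ?z ^ k) \<le> 2 * hcoeff (n - 1) 0 / norm (1 - ?z)"
        by (rule decreasing_partial_sum_bound)
           (use P(1)[OF p] n in \<open>auto simp: params_def intro: less_imp_le[OF hcoeff_pos] less_imp_le[OF hcoeff_Suc_less]\<close>)
      then have "norm (\<Sum>k<N. of_real (hcoeff (n - 1) k) * ?z ^ k) / norm (p \<theta> + 1) \<le> (2 / norm (1 - ?z)) / norm (p \<theta> + 1)"
        by (intro divide_right_mono) auto
      then show "norm (s N (p \<theta>) * of_real r * \<i> * cis \<theta>) \<le> (2 / norm (1 - ?z)) / norm (p \<theta> + 1)"
        using r(2) by (simp add: s_def norm_mult norm_divide p)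
    qed
    show "\<forall>\<theta>\<in>{0..2 * pi}. (\<lambda>N. s N (p \<theta>) * of_real r * \<i> * cis \<theta>) \<longlonglongrightarrow>
       ?F (t_tilde n t (p \<theta>)) / (p \<theta> * (p \<theta> + 1)) * of_real r * \<i> * cis \<theta>"
    proof
      fix \<theta>
      have "(\<lambda>N. \<Sum>k<N. of_real (hcoeff (n - 1) k) * t_tilde n t (p \<theta>) ^ k) \<longlonglongrightarrow> ?F (t_tilde n t (p \<theta>))"
        using F[OF P(1)[OF p]] by (simp add: sums_def)
      then show "(\<lambda>N. s N (p \<theta>) * of_real r * \<i> * cis \<theta>) \<longlonglongrightarrow>
         ?F (t_tilde n t (p \<theta>)) / (p \<theta> * (p \<theta> + 1)) * of_real r * \<i> * cis \<theta>"
        unfolding s_def by (intro tendsto_mult tendsto_divide tendsto_const) (use P(2,3)[OF p] in auto)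
    qed
    show "(\<lambda>N. \<Sum>k<N. 2 * of_real pi * \<i> * (of_real (hcoeff n k) * t ^ k)) \<longlonglongrightarrow>
      2 * of_real pi * \<i> * eval_fps (fps_hypergeo (fractions (n + 1)) (replicate (n - 1) 1) 1) t"
      using hypergeo_sums(1)[of n t] n t unfolding sum_distrib_left[symmetric] sums_def
      by (intro tendsto_mult tendsto_const) auto
  qed
  then have "((\<lambda>u. ?F (t_tilde n t u) / (u * (u + 1))) has_contour_integral
     2 * of_real pi * \<i> * eval_fps (fps_hypergeo (fractions (n + 1)) (replicate (n - 1) 1) 1) t) (circlepath 0 r)"
    unfolding circlepath_def p_def by (subst has_contour_integral_part_circlepath_iff) auto
  from contour_integral_unique[OF this] show ?thesis by (simp add: r_def)
qed

section \<open>Fibres and tori under rescaling\<close>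

text \<open>Division by u + 1 turns the linear factor 1 + x 1 + ... + x n into the one in the fibre
  coordinates; \<open>t_tilde\<close> is the parameter for which the constant term is divided by u
  (u + 1)^n as well.\<close>

lemma f_poly_fibre_coords:
  assumes n: "n \<ge> 2" and u: "u \<noteq> 0" "u + 1 \<noteq> 0" and x: "x n = u"
  shows "f_poly (n - 1) (fibre_coords n x) (t_tilde n t u) = f_poly n x t / (u * (u + 1) ^ n)"
proof -
  obtain m where m: "n = Suc m" using n by (cases n) auto
  have P: "(\<Prod>i=1..m. fibre_coords n x i) = (\<Prod>i=1..m. x i) / (u + 1) ^ m"
    using m x by (simp add: fibre_coords_def prod_dividef)
  have "(\<Sum>i=1..m. fibre_coords n x i) = (\<Sum>i=1..m. x i) / (u + 1)"
    using m x by (simp add: fibre_coords_def sum_divide_distrib)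
  then have S: "(\<Sum>i=1..m. fibre_coords n x i) + 1 = ((\<Sum>i=1..n. x i) + 1) / (u + 1)"
    using m x u by (simp add: field_simps)
  have tt: "(-1) ^ (m + 1) * t_tilde n t u / of_nat (m + 1) ^ (m + 1)
      = ((-1) ^ (n + 1) * t / of_nat (n + 1) ^ (n + 1)) / (u * (u + 1) ^ n)"
  proof -
    have "(-1) ^ (m + 1) * - (a * t / (D * u * v)) / a = ((-1) ^ (m + 1 + 1) * t / D) / (u * v)" if "a \<noteq> 0" for a D v :: complex
      using that by simp
    from this[of "of_nat (m + 1) ^ (m + 1)"] show ?thesis
      by (simp add: t_tilde_def m del: of_nat_Suc power_Suc)
  qed
  have Pn: "(\<Prod>i=1..n. x i) = (\<Prod>i=1..m. x i) * u" using m x by simp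
  have alg: "p / v ^ m * (s / v) + X / (u * v ^ n) = (p * u * s + X) / (u * v ^ n)" if "v \<noteq> 0" for p s v X
    using that u by (simp add: m field_simps)
  have "f_poly (n - 1) (fibre_coords n x) (t_tilde n t u)
     = (\<Prod>i=1..m. fibre_coords n x i) * ((\<Sum>i=1..m. fibre_coords n x i) + 1) + (-1) ^ (m + 1) * t_tilde n t u / of_nat (m + 1) ^ (m + 1)"
    by (simp only: f_poly_def m diff_Suc_1)
  also have "\<dots> = f_poly n x t / (u * (u + 1) ^ n)"
    unfolding P S tt alg[OF u(2)] f_poly_def Pn ..
  finally show ?thesis .
qed

text \<open>The defining polynomials differ by a nonzero factor on the fibre, so the rescaling and
  its inverse \<open>g\<close>, which also restores the coordinate u, exchange the zero
  sets.\<close>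

lemma fibre_coords_homeomorphic:
  assumes n: "n \<ge> 2" and u: "u \<notin> {0, -1}"
  shows "homeomorphic_map (subtopology (cspace n) (fibre n t u))
            (subtopology (cspace (n - 1)) (Y (n - 1) (t_tilde n t u))) (fibre_coords n)"
proof -
  have u: "u \<noteq> 0" "u + 1 \<noteq> 0" using u by (auto simp: eq_neg_iff_add_eq_0)
  define g where "g = (\<lambda>y::nat \<Rightarrow> complex. \<lambda>i\<in>{1..n}. if i = n then u else y i * (u + 1))"
  have g_in: "g y \<in> {1..n} \<rightarrow>\<^sub>E UNIV" "g y n = u" for y using n by (auto simp: g_def)
  have f_in: "fibre_coords n x \<in> {1..n - 1} \<rightarrow>\<^sub>E UNIV" for x by (auto simp: fibre_coords_def)
  have fg: "fibre_coords n (g y) = y" if "y \<in> {1..n - 1} \<rightarrow>\<^sub>E UNIV" for y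
    using that n u by (auto simp: fibre_coords_def g_def fun_eq_iff PiE_def extensional_def)
  have gf: "g (fibre_coords n x) = x" if "x \<in> {1..n} \<rightarrow>\<^sub>E UNIV" "x n = u" for x
    using that n u by (auto simp: fibre_coords_def g_def fun_eq_iff PiE_def extensional_def)
  have Yf: "fibre_coords n x \<in> Y (n - 1) (t_tilde n t u)" if "x \<in> fibre n t u" for x
    using that f_poly_fibre_coords[OF n u, of x t] f_in by (auto simp: Y_def fibre_def)
  have Yg: "g y \<in> fibre n t u" if "y \<in> Y (n - 1) (t_tilde n t u)" for y
    using that f_poly_fibre_coords[OF n u, of "g y" t, OF g_in(2)] g_in[of y] fg[of y] u by (auto simp: Y_def fibre_def)
  have "homeomorphic_maps (subtopology (cspace n) (fibre n t u))
            (subtopology (cspace (n - 1)) (Y (n - 1) (t_tilde n t u))) (fibre_coords n) g"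
    unfolding homeomorphic_maps_def
  proof (intro conjI ballI)
    have proj: "continuous_map (subtopology (product_topology (\<lambda>_. euclidean) I) S) euclidean (\<lambda>x. x i :: complex)" if "i \<in> I" for I S and i :: nat
      using that by (intro continuous_map_from_subtopology continuous_map_product_projection)
    have "continuous_map (subtopology (cspace n) (fibre n t u)) (cspace (n - 1)) (fibre_coords n)"
      unfolding cspace_def continuous_map_componentwise
    proof (intro conjI ballI)
      show "fibre_coords n ` topspace (subtopology (product_topology (\<lambda>_. euclidean) {1..n}) (fibre n t u)) \<subseteq> extensional {1..n - 1}"
        using f_in by (auto simp: PiE_def)
      fix k assume k: "k \<in> {1..n - 1}"
      have "continuous_map (subtopology (product_topology (\<lambda>_. euclidean) {1..n}) (fibre n t u)) euclidean (\<lambda>x. x k * (1 / (u + 1)))"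
        using k n by (intro continuous_map_mult' proj) auto
      then show "continuous_map (subtopology (product_topology (\<lambda>_. euclidean) {1..n}) (fibre n t u)) euclidean (\<lambda>x. fibre_coords n x k)"
        by (rule continuous_map_eq) (use k in \<open>auto simp: fibre_coords_def fibre_def\<close>)
    qed
    then show "continuous_map (subtopology (cspace n) (fibre n t u)) (subtopology (cspace (n - 1)) (Y (n - 1) (t_tilde n t u))) (fibre_coords n)"
      using Yf by (auto simp: continuous_map_in_subtopology)
    have "continuous_map (subtopology (cspace (n - 1)) (Y (n - 1) (t_tilde n t u))) (cspace n) g"
      unfolding cspace_def continuous_map_componentwise
    proof (intro conjI ballI)
      show "g ` topspace (subtopology (product_topology (\<lambda>_. euclidean) {1..n - 1}) (Y (n - 1) (t_tilde n t u))) \<subseteq> extensional {1..n}"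
        using g_in by (auto simp: PiE_def)
      fix k assume k: "k \<in> {1..n}"
      show "continuous_map (subtopology (product_topology (\<lambda>_. euclidean) {1..n - 1}) (Y (n - 1) (t_tilde n t u))) euclidean (\<lambda>x. g x k)"
      proof (cases "k = n")
        case True
        then show ?thesis using k by (simp add: g_def)
      next
        case False
        then have "continuous_map (subtopology (product_topology (\<lambda>_. euclidean) {1..n - 1}) (Y (n - 1) (t_tilde n t u))) euclidean (\<lambda>x. x k * (u + 1))"
          using k by (intro continuous_map_mult' proj) auto
        then show ?thesis using False k by (simp add: g_def)
      qed
    qed
    then show "continuous_map (subtopology (cspace (n - 1)) (Y (n - 1) (t_tilde n t u))) (subtopology (cspace n) (fibre n t u)) g"
      using Yg by (auto simp: continuous_map_in_subtopology)
  qed (auto simp: cspace_def fibre_def Y_def intro!: gf fg)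
  then show ?thesis by (rule homeomorphic_maps_imp_map)
qed

lemma torus_rescaling:
  assumes n: "n \<ge> 2"
  shows "torus {1..n} (torus_radius n) =
         (\<lambda>x. \<lambda>i\<in>{1..n}. of_nat n / of_nat (n + 1) * x i) `
           {x \<in> {1..n} \<rightarrow>\<^sub>E UNIV. restrict x {1..n - 1} \<in> torus {1..n - 1} (torus_radius (n - 1)) \<and>
                                norm (x n) = torus_radius (n - 1)}" (is "_ = ?s ` ?A")
proof -
  have A: "?A = torus {1..n} (torus_radius (n - 1))"
  proof -
    have "{1..n} = insert n {1..n - 1}" using n by auto
    then show ?thesis by (auto simp: torus_def PiE_def extensional_def)
  qed
  have r: "of_nat n / of_nat (n + 1) * torus_radius (n - 1) = torus_radius n"
    using n by (simp add: torus_radius_eq field_simps)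
  show ?thesis unfolding A
  proof (intro equalityI subsetI)
    fix y assume y: "y \<in> torus {1..n} (torus_radius n)"
    let ?x = "\<lambda>i\<in>{1..n}. of_nat (n + 1) / of_nat n * y i"
    have "?x \<in> torus {1..n} (torus_radius (n - 1))"
      using y n by (auto simp: torus_def norm_mult norm_divide torus_radius_eq simp del: of_nat_Suc)
    moreover have "y = ?s ?x"
      using y n by (auto simp: torus_def fun_eq_iff PiE_def extensional_def simp del: of_nat_Suc of_nat_add)
    ultimately show "y \<in> ?s ` torus {1..n} (torus_radius (n - 1))" by blast
  next
    fix y assume "y \<in> ?s ` torus {1..n} (torus_radius (n - 1))"
    then show "y \<in> torus {1..n} (torus_radius n)"
      unfolding r[symmetric] by (auto simp: torus_def norm_mult norm_divide simp del: of_nat_Suc of_nat_add)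
  qed
qed

section \<open>The root enclosed by the first circle\<close>

text \<open>With S and P for \<open>base_sum\<close> and \<open>base_prod\<close>, and a = (-1)^n t
  / (n+1)^(n+1), the polynomial \<open>f_poly\<close> becomes P z (z + S) - a when x 1 = z.\<close>

definition base_sum :: "nat \<Rightarrow> (nat \<Rightarrow> complex) \<Rightarrow> complex" where
  "base_sum n x = 1 + (\<Sum>i=2..n. x i)"

definition base_prod :: "nat \<Rightarrow> (nat \<Rightarrow> complex) \<Rightarrow> complex" where
  "base_prod n x = (\<Prod>i=2..n. x i)"

text \<open>Normalised so that \<open>csqrt\<close> is only needed off the negative axis: at a point of the torus the discriminant itself may
  have any argument.\<close>

definition root_disc :: "nat \<Rightarrow> complex \<Rightarrow> (nat \<Rightarrow> complex) \<Rightarrow> complex" where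
  "root_disc n t x = 1 + 4 * ((-1) ^ n * t / of_nat (n + 1) ^ (n + 1)) / (base_prod n x * base_sum n x ^ 2)"

definition inner_root :: "nat \<Rightarrow> complex \<Rightarrow> (nat \<Rightarrow> complex) \<Rightarrow> complex" where
  "inner_root n t x = base_sum n x * (csqrt (root_disc n t x) - 1) / 2"

definition outer_root :: "nat \<Rightarrow> complex \<Rightarrow> (nat \<Rightarrow> complex) \<Rightarrow> complex" where
  "outer_root n t x = - base_sum n x * (csqrt (root_disc n t x) + 1) / 2"

text \<open>With n - 1 coordinates the triangle inequality leaves 1 - (n-1) r = 2 r. This 2 r is
  what later places one root on each side of the circle.\<close>

lemma base_bounds:
  assumes n: "n \<ge> 1" and x: "x \<in> torus {2..n} (torus_radius n)"
  shows "norm (base_sum n x) \<ge> 2 * torus_radius n"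
    and "norm (base_prod n x) = torus_radius n ^ (n - 1)"
    and "base_sum n x \<noteq> 0" and "base_prod n x \<noteq> 0"
proof -
  have r: "torus_radius n > 0" by (simp add: torus_radius_eq)
  have "norm (1 :: complex) - card {2..n} * torus_radius n = 2 * torus_radius n"
    using n by (simp add: torus_radius_eq of_nat_diff field_simps)
  then show S: "norm (base_sum n x) \<ge> 2 * torus_radius n"
    using torus_norm_ge[OF _ x, of 1] by (simp add: base_sum_def)
  then show "base_sum n x \<noteq> 0" using r by auto
  show P: "norm (base_prod n x) = torus_radius n ^ (n - 1)"
    using torus_prod_norm[OF x] by (simp add: base_prod_def)
  with zero_less_power[OF r, of "n - 1"] have "norm (base_prod n x) > 0" by simp
  then show "base_prod n x \<noteq> 0" by simp
qed

text \<open>For c = a / P one has |c| \<le> r^2 and |S| \<ge> 2 r, so 4 c / S^2 lies in the closed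
  unit disc and the discriminant can be nonpositive only if it equals -1. That is the equality case,
  where all coordinates are -r and the quotient is - t; it would give t = 1.\<close>

lemma root_disc_not_nonpos:
  assumes n: "n \<ge> 1" and t: "t \<in> params" and x: "x \<in> torus {2..n} (torus_radius n)"
  shows "root_disc n t x \<notin> \<real>\<^sub>\<le>\<^sub>0"
    and "norm ((-1) ^ n * t / of_nat (n + 1) ^ (n + 1) / base_prod n x) \<le> torus_radius n ^ 2"
proof -
  define r where "r = torus_radius n"
  define c where "c = (-1) ^ n * t / of_nat (n + 1) ^ (n + 1) / base_prod n x"
  have r: "r = 1 / real (n + 1)" "r > 0" by (simp_all add: r_def torus_radius_eq)
  note B = base_bounds[OF n x, folded r_def]
  have nt: "norm t \<le> 1" "t \<noteq> 1" using t by (auto simp: params_def)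
  have ce: "c = (-1) ^ n * t * of_real r ^ (n + 1) / base_prod n x"
    by (simp add: c_def r power_divide)
  have rn: "r ^ (n + 1) = r ^ (n - 1) * r ^ 2" using n by (simp flip: power_add)
  have nc: "norm c = norm t * r ^ 2"
    unfolding ce norm_divide norm_mult B(2) norm_power norm_of_real using r(2)
    by (simp add: rn[simplified])
  have "norm c \<le> 1 * r ^ 2" unfolding nc using nt by (intro mult_right_mono) auto
  then show "norm ((-1) ^ n * t / of_nat (n + 1) ^ (n + 1) / base_prod n x) \<le> torus_radius n ^ 2"
    by (simp add: c_def r_def)
  have d: "root_disc n t x = 1 + 4 * c / base_sum n x ^ 2"
    by (simp add: root_disc_def c_def)
  have S2: "norm (base_sum n x) ^ 2 \<ge> (2 * r) ^ 2"
    using B(1) r(2) by (intro power_mono) auto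
  show "root_disc n t x \<notin> \<real>\<^sub>\<le>\<^sub>0"
  proof
    assume "root_disc n t x \<in> \<real>\<^sub>\<le>\<^sub>0"
    then have w: "Re (4 * c / base_sum n x ^ 2) \<le> -1" "Im (4 * c / base_sum n x ^ 2) = 0"
      by (auto simp: d complex_nonpos_Reals_iff)
    have nw: "norm (4 * c / base_sum n x ^ 2) = 4 * norm c / norm (base_sum n x) ^ 2"
      by (simp add: norm_divide norm_mult norm_power)
    have "1 \<le> norm (4 * c / base_sum n x ^ 2)"
      using abs_Re_le_cmod[of "4 * c / base_sum n x ^ 2"] w by linarith
    then have "norm (base_sum n x) ^ 2 \<le> 4 * norm c"
      unfolding nw using B(3) by (simp add: pos_le_divide_eq)
    then have "norm (base_sum n x) ^ 2 \<le> (2 * r) ^ 2" "norm c = r ^ 2"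
      using \<open>norm c \<le> 1 * r ^ 2\<close> S2 by (simp_all add: power_mult_distrib)
    then have "norm (base_sum n x) \<le> 2 * r" using r(2) by (auto intro: power2_le_imp_le)
    with B(1) have "norm (base_sum n x) = 2 * r" by simp
    also have "2 * r = 1 - card {2..n} * r"
      using n by (simp add: r of_nat_diff field_simps)
    finally have xi: "x i = - of_real r" if "i \<in> {2..n}" for i
      using torus_norm_eq[OF _ x[folded r_def] _ that] by (simp add: base_sum_def)
    have S: "base_sum n x = 2 * of_real r"
    proof -
      have "base_sum n x = of_real (1 - card {2..n} * r)" using xi by (simp add: base_sum_def)
      also have "1 - card {2..n} * r = 2 * r" using n by (simp add: r of_nat_diff field_simps)
      finally show ?thesis by simp
    qed
    have P: "base_prod n x = (- of_real r) ^ (n - 1)" using xi by (simp add: base_prod_def)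
    have "c = - t * of_real r ^ 2"
    proof -
      obtain m where m: "n = Suc m" using n by (cases n) auto
      have "of_real r \<noteq> (0::complex)" using r(2) by simp
      then show ?thesis unfolding ce P unfolding m
        by (simp add: power_minus[of "of_real r"] power2_eq_square)
    qed
    then have "4 * c / base_sum n x ^ 2 = - t"
      unfolding S using r(2) by (simp add: power_mult_distrib)
    with w have "Re t \<ge> 1" "Im t = 0" by simp_all
    with nt(1) complex_Re_le_cmod[of t] have "Re t = 1" by linarith
    with \<open>Im t = 0\<close> nt show False by (simp add: complex_eq_iff)
  qed
qed

text \<open>The roots have product - a / P, of modulus at most r^2, and sum - S, of modulus at least
  2 r. A square root q with positive real part gives |q - 1| < |q + 1|, so the inner root is
  strictly smaller in modulus than the outer one; the product bounds it by r and the sum pushes the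
  other beyond r.\<close>

lemma roots:
  assumes n: "n \<ge> 1" and t: "t \<in> params" and x: "x \<in> torus {2..n} (torus_radius n)"
  shows "f_poly n (x(1 := z)) t = base_prod n x * ((z - inner_root n t x) * (z - outer_root n t x))"
    and "norm (inner_root n t x) < torus_radius n"
    and "norm (outer_root n t x) > torus_radius n"
proof -
  define r where "r = torus_radius n"
  define S where "S = base_sum n x"
  define P where "P = base_prod n x"
  define a where "a = (-1) ^ n * t / of_nat (n + 1) ^ (n + 1)"
  define q where "q = csqrt (root_disc n t x)"
  define g where "g = inner_root n t x"
  define h where "h = outer_root n t x"
  have r: "r > 0" by (simp add: r_def torus_radius_eq)
  note B = base_bounds[OF n x, folded r_def S_def P_def]
  note D = root_disc_not_nonpos[OF n t x, folded r_def P_def, folded a_def]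
  have q2: "q ^ 2 = 1 + 4 * a / (P * S ^ 2)"
    by (simp add: q_def root_disc_def a_def P_def S_def)
  have gh: "g = S * (q - 1) / 2" "h = - S * (q + 1) / 2"
    by (simp_all add: g_def h_def inner_root_def outer_root_def q_def S_def)
  have "4 * (g * h) = - (S ^ 2) * (q ^ 2 - 1)"
    unfolding gh by (simp add: field_simps power2_eq_square)
  also have "\<dots> = 4 * (- a / P)" unfolding q2 using B by simp
  finally have "4 * (g * h) = 4 * (- a / P)" .
  then have prd: "g * h = - a / P" unfolding mult_cancel_left by simp
  have sm: "g + h = - S" unfolding gh by (simp add: field_simps)
  have "(z - g) * (z - h) = z * z - (g + h) * z + g * h" by (simp add: algebra_simps)
  also have "\<dots> = z * (z + S) - a / P" unfolding prd sm by (simp add: algebra_simps)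
  finally have fac: "P * ((z - g) * (z - h)) = P * (z * (z + S)) - a" using B by (simp add: right_diff_distrib)
  have ins: "{1..n} = insert 1 {2..n}" using n by auto
  have "(\<Prod>i=2..n. (x(1 := z)) i) = P" unfolding P_def base_prod_def by (intro prod.cong) auto
  then have p1: "(\<Prod>i=1..n. (x(1 := z)) i) = z * P" unfolding ins by (subst prod.insert) auto
  have "(\<Sum>i=2..n. (x(1 := z)) i) = S - 1" unfolding S_def base_sum_def by (auto intro: sum.cong)
  then have s1: "(\<Sum>i=1..n. (x(1 := z)) i) = z + (S - 1)" unfolding ins by (subst sum.insert) auto
  have "f_poly n (x(1 := z)) t = P * (z * (z + S)) - a"
    unfolding f_poly_def p1 s1 by (simp add: a_def mult_ac)
  then show "f_poly n (x(1 := z)) t = base_prod n x * ((z - inner_root n t x) * (z - outer_root n t x))"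
    using fac by (simp add: g_def h_def P_def)
  \<comment> \<open>The principal root has Re q \<ge> 0, and Re q = 0 would make its square a
    nonpositive real.\<close>
  have "Re q > 0"
  proof (rule ccontr)
    assume "\<not> Re q > 0"
    then have "Re q = 0" using csqrt_principal[of "root_disc n t x"] by (auto simp: q_def)
    then have "root_disc n t x = of_real (- (Im q ^ 2))"
      using power2_csqrt[of "root_disc n t x"] by (simp add: q_def[symmetric] complex_eq_iff power2_eq_square)
    with D(1) show False by (simp only: nonpos_Reals_of_real_iff) simp
  qed
  then have "norm (q - 1) ^ 2 < norm (q + 1) ^ 2"
    unfolding cmod_power2 by (simp add: power2_eq_square algebra_simps)
  then have "norm (q - 1) < norm (q + 1)" by (rule power2_less_imp_less) simp
  then have lt: "norm g < norm h" using B by (simp add: gh norm_mult norm_divide norm_minus_cancel)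
  have prdn: "norm g * norm h \<le> r * r"
    using D(2) by (simp add: prd norm_mult[symmetric] power2_eq_square)
  have "norm g < r"
  proof (rule ccontr)
    assume "\<not> norm g < r"
    then have "r * r < norm g * norm h" using lt r by (intro mult_le_less_imp_less) auto
    with prdn show False by simp
  qed
  then show "norm (inner_root n t x) < torus_radius n" by (simp add: g_def r_def)
  have "norm S \<le> norm g + norm h"
    using norm_triangle_ineq[of g h] by (simp add: sm)
  with B(1) \<open>norm g < r\<close> show "norm (outer_root n t x) > torus_radius n"
    by (simp add: h_def r_def)
qed

definition lift :: "nat \<Rightarrow> complex \<Rightarrow> (nat \<Rightarrow> complex) \<Rightarrow> nat \<Rightarrow> complex" where
  "lift n t x = x(1 := inner_root n t x)"

lemma lift_eta_coeff:
  assumes n: "n \<ge> 1" and t: "t \<in> params" and x: "x \<in> torus {2..n} (torus_radius n)"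
  shows "eta_coeff n t (lift n t x) = 1 / (base_prod n x * (inner_root n t x - outer_root n t x))"
proof -
  have "((\<lambda>z. base_prod n x * ((z - inner_root n t x) * (z - outer_root n t x))) has_field_derivative
      base_prod n x * (inner_root n t x - outer_root n t x)) (at (inner_root n t x))"
    by (auto intro!: derivative_eq_intros)
  from DERIV_imp_deriv[OF this] show ?thesis
    unfolding eta_coeff_def lift_def fun_upd_upd fun_upd_same roots(1)[OF n t x] by simp
qed

lemma lift_in_Y:
  assumes n: "n \<ge> 1" and t: "t \<in> params" and x: "x \<in> torus {2..n} (torus_radius n)"
  shows "lift n t x \<in> {x \<in> Y n t. norm (x 1) < torus_radius n \<and> restrict x {2..n} \<in> torus {2..n} (torus_radius n)}"
proof -
  have "lift n t x \<in> {1..n} \<rightarrow>\<^sub>E UNIV"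
    using x n by (auto simp: lift_def torus_def PiE_def extensional_def)
  moreover have "restrict (lift n t x) {2..n} = x"
    using x by (auto simp: lift_def torus_def PiE_def extensional_def fun_eq_iff)
  moreover have "f_poly n (lift n t x) t = 0"
    unfolding lift_def by (subst roots[OF n t x]) simp
  ultimately show ?thesis
    using roots(2)[OF n t x] x by (simp add: Y_def lift_def)
qed

text \<open>With the outer root beyond the circle, 1/f has the form k(z)/(z - g) with k holomorphic
  inside and g the inner root. Residue and contour integral both read off k(g), which is
  \<open>eta_coeff\<close> there.\<close>

lemma inner_circle:
  assumes n: "n \<ge> 1" and t: "t \<in> params" and x: "x \<in> torus {2..n} (torus_radius n)"
  shows "(\<Sum>a | norm a < torus_radius n \<and> f_poly n (x(1 := a)) t = 0. residue (\<lambda>z. 1 / f_poly n (x(1 := z)) t) a)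
       = eta_coeff n t (lift n t x)"
    and "contour_integral (circlepath 0 (torus_radius n)) (\<lambda>z. 1 / f_poly n (x(1 := z)) t)
       = 2 * of_real pi * \<i> * eta_coeff n t (lift n t x)"
proof -
  note R = roots[OF n t x]
  note B = base_bounds[OF n x]
  let ?g = "inner_root n t x" and ?h = "outer_root n t x"
  let ?k = "\<lambda>z. 1 / (base_prod n x * (z - ?h))"
  have eq: "(\<lambda>z. 1 / f_poly n (x(1 := z)) t) = (\<lambda>z. ?k z / (z - ?g))"
    unfolding R(1) by (simp add: fun_eq_iff mult_ac)
  have set: "{a. norm a < torus_radius n \<and> f_poly n (x(1 := a)) t = 0} = {?g}"
    unfolding R(1) using R(2,3) B(4) by auto
  have nz: "z \<noteq> ?h" if "norm z \<le> torus_radius n" for z using that R(3) by auto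
  have hol: "?k holomorphic_on ball 0 (torus_radius n)"
    using B(4) nz by (intro holomorphic_intros) auto
  show "(\<Sum>a | norm a < torus_radius n \<and> f_poly n (x(1 := a)) t = 0. residue (\<lambda>z. 1 / f_poly n (x(1 := z)) t) a)
       = eta_coeff n t (lift n t x)"
    unfolding set eq using residue_simple[OF open_ball _ hol, of ?g] R(2)
    by (simp add: lift_eta_coeff[OF n t x])
  have "((\<lambda>u. ?k u / (u - ?g)) has_contour_integral (2 * of_real pi * \<i> * ?k ?g)) (circlepath 0 (torus_radius n))"
    using hol R(2) B(4) nz by (intro Cauchy_integral_circlepath continuous_intros) auto
  then show "contour_integral (circlepath 0 (torus_radius n)) (\<lambda>z. 1 / f_poly n (x(1 := z)) t)
       = 2 * of_real pi * \<i> * eta_coeff n t (lift n t x)"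
    unfolding eq lift_eta_coeff[OF n t x] by (rule contour_integral_unique)
qed

lemma torus_cont_inverse_f_poly:
  assumes n: "n \<ge> 1" and t: "t \<in> params"
  shows "torus_cont {1..n} (torus_radius n) (\<lambda>x. 1 / f_poly n x t)"
  unfolding f_poly_def divide_inverse[of _ "of_nat (n + 1) ^ (n + 1)"]
  by (intro torus_contI) (use f_poly_on_torus(4)[OF n t] in \<open>auto simp: f_poly_def divide_inverse torus_radius_eq\<close>)

text \<open>Integrating out x 1 replaces 1/f by its residue; this links the series computed on the
  n-torus to the period over the graph of the inner root.\<close>

lemma torus_integral_fibre:
  assumes n: "n \<ge> 1" and t: "t \<in> params"
  shows "torus_integral {1..n} (torus_radius n) (\<lambda>x. 1 / f_poly n x t)
       = 2 * of_real pi * \<i> * torus_integral {2..n} (torus_radius n) (\<lambda>x. eta_coeff n t (lift n t x))"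
proof -
  have ins: "{1..n} = insert 1 {2..n}" using n by auto
  have r: "torus_radius n > 0" by (simp add: torus_radius_eq)
  have "torus_integral {1..n} (torus_radius n) (\<lambda>x. 1 / f_poly n x t)
     = torus_integral {2..n} (torus_radius n) (\<lambda>x. contour_integral (circlepath 0 (torus_radius n)) (\<lambda>z. 1 / f_poly n (x(1 := z)) t))"
    unfolding ins by (rule torus_integral_insert) (use torus_cont_inverse_f_poly[OF n t] ins in auto)
  also have "\<dots> = torus_integral {2..n} (torus_radius n) (\<lambda>x. 2 * of_real pi * \<i> * eta_coeff n t (lift n t x))"
    by (intro torus_integral_cong r inner_circle(2) n t)
  finally show ?thesis by (simp only: torus_integral_cmult)
qed

section \<open>Continuously differentiable dependence on the simplex coordinates\<close>

text \<open>Continuity of the function is carried along, because it enters the derivatives of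
  products and compositions.\<close>

definition C1_map :: "nat \<Rightarrow> ((nat \<Rightarrow> real) \<Rightarrow> complex) \<Rightarrow> bool" where
  "C1_map p h \<longleftrightarrow> continuous_map (product_topology (\<lambda>_. euclideanreal) {1..p}) euclidean h \<and> C1_fun p h"

lemma C1_map_const: "C1_map p (\<lambda>_. a)"
  unfolding C1_map_def C1_fun_def by (intro conjI ballI exI[of _ "\<lambda>_. 0"]) auto

lemma C1_map_add:
  assumes "C1_map p f" "C1_map p g"
  shows "C1_map p (\<lambda>s. f s + g s)"
  unfolding C1_map_def C1_fun_def
proof (intro conjI ballI)
  show "continuous_map (product_topology (\<lambda>_. euclideanreal) {1..p}) euclidean (\<lambda>s. f s + g s)"
    using assms by (auto simp: C1_map_def intro: continuous_map_add')
  fix i assume i: "i \<in> {1..p}"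
  from assms i obtain D E where
    "continuous_map (product_topology (\<lambda>_. euclideanreal) {1..p}) euclidean D"
    "\<forall>s\<in>{1..p} \<rightarrow>\<^sub>E UNIV. ((\<lambda>y. f (s(i := y))) has_vector_derivative D s) (at (s i))"
    "continuous_map (product_topology (\<lambda>_. euclideanreal) {1..p}) euclidean E"
    "\<forall>s\<in>{1..p} \<rightarrow>\<^sub>E UNIV. ((\<lambda>y. g (s(i := y))) has_vector_derivative E s) (at (s i))"
    unfolding C1_map_def C1_fun_def by blast
  then show "\<exists>D. continuous_map (product_topology (\<lambda>_. euclideanreal) {1..p}) euclidean D \<and>
      (\<forall>s\<in>{1..p} \<rightarrow>\<^sub>E UNIV. ((\<lambda>y. f (s(i := y)) + g (s(i := y))) has_vector_derivative D s) (at (s i)))"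
    by (intro exI[of _ "\<lambda>s. D s + E s"]) (auto intro: continuous_map_add' has_vector_derivative_add)
qed

lemma C1_map_mult:
  assumes "C1_map p f" "C1_map p g"
  shows "C1_map p (\<lambda>s. f s * g s)"
  unfolding C1_map_def C1_fun_def
proof (intro conjI ballI)
  have c: "continuous_map (product_topology (\<lambda>_. euclideanreal) {1..p}) euclidean f"
     "continuous_map (product_topology (\<lambda>_. euclideanreal) {1..p}) euclidean g"
    using assms by (auto simp: C1_map_def)
  then show "continuous_map (product_topology (\<lambda>_. euclideanreal) {1..p}) euclidean (\<lambda>s. f s * g s)"
    by (rule continuous_map_mult')
  fix i assume i: "i \<in> {1..p}"
  from assms i obtain D E where D:
    "continuous_map (product_topology (\<lambda>_. euclideanreal) {1..p}) euclidean D"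
    "\<forall>s\<in>{1..p} \<rightarrow>\<^sub>E UNIV. ((\<lambda>y. f (s(i := y))) has_vector_derivative D s) (at (s i))"
    "continuous_map (product_topology (\<lambda>_. euclideanreal) {1..p}) euclidean E"
    "\<forall>s\<in>{1..p} \<rightarrow>\<^sub>E UNIV. ((\<lambda>y. g (s(i := y))) has_vector_derivative E s) (at (s i))"
    unfolding C1_map_def C1_fun_def by blast
  show "\<exists>D. continuous_map (product_topology (\<lambda>_. euclideanreal) {1..p}) euclidean D \<and>
      (\<forall>s\<in>{1..p} \<rightarrow>\<^sub>E UNIV. ((\<lambda>y. f (s(i := y)) * g (s(i := y))) has_vector_derivative D s) (at (s i)))"
  proof (intro exI[of _ "\<lambda>s. f s * E s + D s * g s"] conjI ballI)
    show "continuous_map (product_topology (\<lambda>_. euclideanreal) {1..p}) euclidean (\<lambda>s. f s * E s + D s * g s)"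
      by (intro continuous_map_add' continuous_map_mult' c D)
    fix s :: "nat \<Rightarrow> real" assume "s \<in> {1..p} \<rightarrow>\<^sub>E UNIV"
    from has_vector_derivative_mult[OF D(2)[rule_format, OF this] D(4)[rule_format, OF this]]
    show "((\<lambda>y. f (s(i := y)) * g (s(i := y))) has_vector_derivative f s * E s + D s * g s) (at (s i))"
      unfolding fun_upd_triv .
  qed
qed

text \<open>The chain rule for the two operations in the inner root that are not polynomial:
  inversion away from 0 and \<open>csqrt\<close> off its cut.\<close>

lemma C1_map_compose:
  assumes f: "C1_map p f" and U: "open U" "F holomorphic_on U" and fU: "\<And>s. s \<in> {1..p} \<rightarrow>\<^sub>E UNIV \<Longrightarrow> f s \<in> U"
  shows "C1_map p (\<lambda>s. F (f s))"
  unfolding C1_map_def C1_fun_def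
proof (intro conjI ballI)
  let ?T = "product_topology (\<lambda>_. euclideanreal) {1..p}"
  have c: "continuous_map ?T euclidean f"
    using f by (auto simp: C1_map_def)
  have comp: "continuous_map ?T euclidean (\<lambda>s. G (f s))" if "continuous_on U G" for G
  proof -
    have "continuous_map ?T (top_of_set U) f" using c fU by (auto simp: continuous_map_in_subtopology)
    from continuous_map_compose[OF this, of euclidean G] that show ?thesis by (simp add: comp_def)
  qed
  show "continuous_map ?T euclidean (\<lambda>s. F (f s))"
    by (intro comp holomorphic_on_imp_continuous_on U)
  fix i assume i: "i \<in> {1..p}"
  from f i obtain D where D: "continuous_map ?T euclidean D"
    "\<forall>s\<in>{1..p} \<rightarrow>\<^sub>E UNIV. ((\<lambda>y. f (s(i := y))) has_vector_derivative D s) (at (s i))"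
    unfolding C1_map_def C1_fun_def by blast
  show "\<exists>D. continuous_map ?T euclidean D \<and>
      (\<forall>s\<in>{1..p} \<rightarrow>\<^sub>E UNIV. ((\<lambda>y. F (f (s(i := y)))) has_vector_derivative D s) (at (s i)))"
  proof (intro exI[of _ "\<lambda>s. D s * deriv F (f s)"] conjI ballI)
    show "continuous_map ?T euclidean (\<lambda>s. D s * deriv F (f s))"
      by (intro continuous_map_mult' D comp holomorphic_on_imp_continuous_on holomorphic_deriv U)
    fix s :: "nat \<Rightarrow> real" assume s: "s \<in> {1..p} \<rightarrow>\<^sub>E UNIV"
    have "(F has_field_derivative deriv F (f (s(i := s i)))) (at (f (s(i := s i))))"
      using fU[OF s] by (simp add: holomorphic_derivI[OF U(2,1)])
    from field_vector_diff_chain_at[OF D(2)[rule_format, OF s] this]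
    show "((\<lambda>y. F (f (s(i := y)))) has_vector_derivative D s * deriv F (f s)) (at (s i))"
      unfolding comp_def fun_upd_triv .
  qed
qed

text \<open>An angle is a multiple of a sum of coordinates, so moving one coordinate rotates the
  point or leaves it fixed. This 0-1 pattern is what makes the Jacobian triangular up to a
  permutation of columns.\<close>

lemma has_vector_derivative_cis_sum:
  assumes A: "finite A"
  shows "((\<lambda>y. of_real r * cis (c * (\<Sum>k\<in>A. (s(i := y)) k))) has_vector_derivative
     (if i \<in> A then of_real c * \<i> else 0) * (of_real r * cis (c * (\<Sum>k\<in>A. s k)))) (at (s i))"
proof -
  define K where "K = (\<Sum>k\<in>A - {i}. s k)"
  have sum: "(\<Sum>k\<in>A. (s(i := y)) k) = K + (if i \<in> A then y else 0)" for y
    unfolding K_def using A by (cases "i \<in> A") (auto simp: sum.remove intro!: sum.cong)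
  have "((\<lambda>y. of_real r * exp (\<i> * (of_real c * (of_real K + (if i \<in> A then y else 0))))) has_field_derivative
     (if i \<in> A then of_real c * \<i> else 0) * (of_real r * exp (\<i> * (of_real c * (of_real K + (if i \<in> A then of_real (s i) else 0)))))) (at (of_real (s i)))"
    by (cases "i \<in> A") (auto intro!: derivative_eq_intros)
  note has_vector_derivative_real_field[OF this]
  moreover have "(\<Sum>k\<in>A. s k) = K + (if i \<in> A then s i else 0)"
    using sum[of "s i"] unfolding fun_upd_triv .
  ultimately show ?thesis
    unfolding sum by (cases "i \<in> A") (simp_all add: cis_conv_exp)
qed

lemma C1_map_cis_sum:
  assumes A: "A \<subseteq> {1..p}"
  shows "C1_map p (\<lambda>s. of_real r * cis (c * (\<Sum>k\<in>A. s k)))"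
proof -
  let ?T = "product_topology (\<lambda>_. euclideanreal) {1..p}"
  have fin: "finite A" using A finite_subset by blast
  have "continuous_map ?T euclideanreal (\<lambda>s. c * (\<Sum>k\<in>A. s k))"
    using A by (intro continuous_map_mult' continuous_map_sum' continuous_map_product_projection) auto
  from continuous_map_compose[OF this, of euclidean "\<lambda>y. of_real r * cis y"]
  have c: "continuous_map ?T euclidean (\<lambda>s. of_real r * cis (c * (\<Sum>k\<in>A. s k)))"
    by (simp add: comp_def continuous_map_iff_continuous2 continuous_intros)
  show ?thesis
    unfolding C1_map_def C1_fun_def
  proof (intro conjI ballI c)
    fix i
    show "\<exists>D. continuous_map ?T euclidean D \<and> (\<forall>s\<in>{1..p} \<rightarrow>\<^sub>E UNIV.
       ((\<lambda>y. of_real r * cis (c * (\<Sum>k\<in>A. (s(i := y)) k))) has_vector_derivative D s) (at (s i)))"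
      by (intro exI[of _ "\<lambda>s. (if i \<in> A then of_real c * \<i> else 0) * (of_real r * cis (c * (\<Sum>k\<in>A. s k)))"]
          conjI ballI continuous_map_mult' c has_vector_derivative_cis_sum[OF fin]) simp
  qed
qed

lemma C1_map_sum: "(\<And>i. i \<in> I \<Longrightarrow> C1_map p (f i)) \<Longrightarrow> C1_map p (\<lambda>s. \<Sum>i\<in>I. f i s)"
  by (induction I rule: infinite_finite_induct) (auto intro: C1_map_add C1_map_const)

lemma C1_map_prod: "(\<And>i. i \<in> I \<Longrightarrow> C1_map p (f i)) \<Longrightarrow> C1_map p (\<lambda>s. \<Prod>i\<in>I. f i s)"
  by (induction I rule: infinite_finite_induct) (auto intro: C1_map_mult C1_map_const)

lemma C1_map_inner_root:
  assumes n: "n \<ge> 1" and t: "t \<in> params"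
    and x: "\<And>s. s \<in> {1..p} \<rightarrow>\<^sub>E UNIV \<Longrightarrow> x s \<in> torus {2..n} (torus_radius n)"
    and C1: "\<And>j. j \<in> {2..n} \<Longrightarrow> C1_map p (\<lambda>s. x s j)"
  shows "C1_map p (\<lambda>s. inner_root n t (x s))"
proof -
  have S: "C1_map p (\<lambda>s. base_sum n (x s))"
    unfolding base_sum_def by (intro C1_map_add C1_map_const C1_map_sum C1)
  have P: "C1_map p (\<lambda>s. base_prod n (x s))"
    unfolding base_prod_def by (intro C1_map_prod C1)
  have "C1_map p (\<lambda>s. inverse (base_prod n (x s) * (base_sum n (x s) * base_sum n (x s))))"
    by (rule C1_map_compose[of _ _ "- {0}"])
       (use base_bounds[OF n x] in \<open>auto intro!: C1_map_mult S P holomorphic_intros\<close>)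
  then have "C1_map p (\<lambda>s. root_disc n t (x s))"
    unfolding root_disc_def power2_eq_square divide_inverse[of "4 * _"]
    by (intro C1_map_add C1_map_mult C1_map_const)
  then have "C1_map p (\<lambda>s. csqrt (root_disc n t (x s)))"
    by (rule C1_map_compose[of _ _ "- \<real>\<^sub>\<le>\<^sub>0"])
       (use root_disc_not_nonpos(1)[OF n t x] in \<open>auto intro!: holomorphic_on_csqrt simp: open_Compl closed_nonpos_Reals_complex\<close>)
  then have "C1_map p (\<lambda>s. base_sum n (x s) * (csqrt (root_disc n t (x s)) + (-1)) * (1 / 2))"
    by (intro C1_map_mult C1_map_add C1_map_const S)
  then show ?thesis by (simp add: inner_root_def)
qed

lemma torus_cont_compose:
  assumes r: "r > 0" and f: "torus_cont J r f" and U: "continuous_on U F"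
    and fU: "\<And>x. x \<in> torus J r \<Longrightarrow> f x \<in> U"
  shows "torus_cont J r (\<lambda>x. F (f x))"
proof -
  have "continuous_map (product_topology (\<lambda>_. euclideanreal) J) (top_of_set U) (\<lambda>\<theta>. f (torus_point J r \<theta>))"
    using f fU torus_point_in_torus[OF r] by (auto simp: torus_cont_def continuous_map_in_subtopology)
  from continuous_map_compose[OF this, of euclidean F] U show ?thesis
    by (simp add: comp_def torus_cont_def)
qed

text \<open>The difference of the roots is \<open>base_sum\<close> times the square root of the
  discriminant, so it vanishes nowhere on the torus.\<close>

lemma torus_cont_eta:
  assumes n: "n \<ge> 1" and t: "t \<in> params"
  shows "torus_cont {2..n} (torus_radius n) (\<lambda>x. 1 / (base_prod n x * (inner_root n t x - outer_root n t x)))"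
proof -
  have r: "torus_radius n > 0" by (simp add: torus_radius_eq)
  have S: "torus_cont {2..n} (torus_radius n) (base_sum n)"
    unfolding base_sum_def by (intro torus_contI r)
  have P: "torus_cont {2..n} (torus_radius n) (base_prod n)"
    unfolding base_prod_def by (intro torus_contI r)
  have D: "torus_cont {2..n} (torus_radius n) (root_disc n t)"
    unfolding root_disc_def by (intro torus_contI r S P) (use base_bounds[OF n] in auto)
  have nz: "root_disc n t x \<noteq> 0" if "x \<in> torus {2..n} (torus_radius n)" for x
    using root_disc_not_nonpos(1)[OF n t that] by auto
  have "torus_cont {2..n} (torus_radius n) (\<lambda>x. csqrt (root_disc n t x))"
    using root_disc_not_nonpos(1)[OF n t]
    by (intro torus_cont_compose[OF r D, of "- \<real>\<^sub>\<le>\<^sub>0"] continuous_on_csqrt) auto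
  then have "torus_cont {2..n} (torus_radius n) (\<lambda>x. 1 / (base_prod n x * (base_sum n x * csqrt (root_disc n t x))))"
    using nz base_bounds[OF n] by (intro torus_contI r P S) auto
  moreover have "inner_root n t x - outer_root n t x = base_sum n x * csqrt (root_disc n t x)" for x
    by (simp add: inner_root_def outer_root_def field_simps)
  ultimately show ?thesis by simp
qed

section \<open>The fundamental chain of a torus\<close>

text \<open>Tail sums of barycentric coordinates decrease, so \<open>q b\<close> is the rank, from 0, of the angle \<open>b\<close> in decreasing order.\<close>

definition tail_angle :: "nat \<Rightarrow> (nat \<Rightarrow> nat) \<Rightarrow> (nat \<Rightarrow> real) \<Rightarrow> nat \<Rightarrow> real" where
  "tail_angle m q y b = 2 * pi * (\<Sum>k\<in>{q b + 1..m}. y k)"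

text \<open>Singular simplices are extensional on the standard simplex, hence the restriction.
  \<Psi> maps angles numbered from 0 to points of the space.\<close>

definition torus_simplex :: "nat \<Rightarrow> ((nat \<Rightarrow> real) \<Rightarrow> 'a) \<Rightarrow> (nat \<Rightarrow> nat) \<Rightarrow> (nat \<Rightarrow> real) \<Rightarrow> 'a" where
  "torus_simplex m \<Psi> q = restrict (\<lambda>y. \<Psi> (tail_angle m q y)) (standard_simplex m)"

definition torus_chain :: "nat \<Rightarrow> ((nat \<Rightarrow> real) \<Rightarrow> 'a) \<Rightarrow> 'a chain" where
  "torus_chain m \<Psi> = (\<Sum>q | q permutes {0..<m}. frag_cmul (sign q) (frag_of (torus_simplex m \<Psi> q)))"

text \<open>The cyclic shift of ranks: an angle that reaches 0, the last rank, reappears as a full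
  turn, rank 0.\<close>

definition rot :: "nat \<Rightarrow> nat \<Rightarrow> nat" where
  "rot m i = (if i < m then (if Suc i = m then 0 else Suc i) else i)"

lemma rot_Suc: "rot (Suc (Suc m)) = Transposition.transpose 0 (Suc m) \<circ> rot (Suc m)"
  by (auto simp: rot_def fun_eq_iff Transposition.transpose_def)

text \<open>Lengthening the cycle by one element multiplies it by one transposition.\<close>

lemma rot_permutes_sign: "rot (Suc m) permutes {0..<Suc m} \<and> sign (rot (Suc m)) = (-1) ^ m"
proof (induction m)
  case 0
  have "rot (Suc 0) = id" by (auto simp: rot_def fun_eq_iff)
  then show ?case by (simp only: permutes_id sign_id) simp
next
  case (Suc m)
  have "rot (Suc m) permutes {0..<Suc (Suc m)}"
    using Suc by (auto intro: permutes_subset)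
  moreover have t: "Transposition.transpose 0 (Suc m) permutes {0..<Suc (Suc m)}"
    by (rule permutes_swap_id) auto
  ultimately have "rot (Suc (Suc m)) permutes {0..<Suc (Suc m)}"
    unfolding rot_Suc by (rule permutes_compose)
  moreover have "sign (rot (Suc (Suc m))) = sign (Transposition.transpose 0 (Suc m)) * sign (rot (Suc m))"
    unfolding rot_Suc using Suc by (intro sign_compose) (auto intro: permutation_permutes[THEN iffD2] permutation_swap_id)
  ultimately show ?case using Suc by (simp add: sign_swap_id)
qed

text \<open>The face map inserts a 0 at position k and shifts the later coordinates. A tail that
  contains k loses only this 0, so it keeps its starting index; a tail that begins beyond k starts
  one index earlier after undoing the shift.\<close>

lemma tail_angle_face:
  assumes "q b < m" "k \<le> m"
  shows "tail_angle m q (simplical_face k y) b = 2 * pi * (\<Sum>i\<in>{(if q b < k then Suc (q b) else q b)..<m}. y i)"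
proof -
  have "(\<Sum>i\<in>{q b + 1..m}. simplical_face k y i) = (\<Sum>i\<in>{(if q b < k then Suc (q b) else q b)..<m}. y i)"
  proof (cases "q b < k")
    case False
    have "(\<Sum>i\<in>{q b + 1..m}. simplical_face k y i) = (\<Sum>i\<in>{Suc (q b)..<Suc m}. y (i - 1))"
      using False by (intro sum.cong) (auto simp: simplical_face_def)
    also have "\<dots> = (\<Sum>i\<in>{q b..<m}. y i)"
      by (subst sum.shift_bounds_Suc_ivl) simp
    finally show ?thesis using False by simp
  next
    case True
    \<comment> \<open>The tail is cut at the inserted zero: unshifted coordinates before it, shifted
      ones after it.\<close>
    have "{q b + 1..m} = {Suc (q b)..<k} \<union> ({k} \<union> {Suc k..<Suc m})" using True assms by auto
    then have "(\<Sum>i\<in>{q b + 1..m}. simplical_face k y i)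
      = (\<Sum>i\<in>{Suc (q b)..<k} \<union> ({k} \<union> {Suc k..<Suc m}). simplical_face k y i)" by simp
    also have "\<dots> = (\<Sum>i\<in>{Suc (q b)..<k}. simplical_face k y i) + (simplical_face k y k + (\<Sum>i\<in>{Suc k..<Suc m}. simplical_face k y i))"
      by (subst sum.union_disjoint, simp, simp, force, subst sum.union_disjoint) auto
    also have "(\<Sum>i\<in>{Suc (q b)..<k}. simplical_face k y i) = (\<Sum>i\<in>{Suc (q b)..<k}. y i)"
      by (intro sum.cong) (auto simp: simplical_face_def)
    also have "(\<Sum>i\<in>{Suc k..<Suc m}. simplical_face k y i) = (\<Sum>i\<in>{Suc k..<Suc m}. y (i - 1))"
      by (intro sum.cong) (auto simp: simplical_face_def)
    also have "\<dots> = (\<Sum>i\<in>{k..<m}. y i)"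
      by (subst sum.shift_bounds_Suc_ivl) simp
    also have "simplical_face k y k = 0" by (simp add: simplical_face_def)
    also have "(\<Sum>i\<in>{Suc (q b)..<k}. y i) + (0 + (\<Sum>i\<in>{k..<m}. y i)) = (\<Sum>i\<in>{Suc (q b)..<m}. y i)"
      using True assms by (simp add: sum.atLeastLessThan_concat)
    finally show ?thesis using True by simp
  qed
  then show ?thesis by (simp add: tail_angle_def)
qed

text \<open>Both faces are restricted to the smaller standard simplex, so it suffices to compare
  angles modulo full turns on it.\<close>

lemma torus_simplex_face_cong:
  assumes per: "\<And>\<theta> \<theta>'. (\<And>b. b < m \<Longrightarrow> \<exists>k::int. \<theta> b = \<theta>' b + 2 * pi * k) \<Longrightarrow> \<Psi> \<theta> = \<Psi> \<theta>'"
    and m: "1 \<le> m" "k \<le> m" "k' \<le> m"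
    and eq: "\<And>y b. y \<in> standard_simplex (m - 1) \<Longrightarrow> b < m \<Longrightarrow>
       \<exists>j::int. tail_angle m q (simplical_face k y) b = tail_angle m q' (simplical_face k' y) b + 2 * pi * j"
  shows "singular_face m k (torus_simplex m \<Psi> q) = singular_face m k' (torus_simplex m \<Psi> q')"
proof
  fix y
  show "singular_face m k (torus_simplex m \<Psi> q) y = singular_face m k' (torus_simplex m \<Psi> q') y"
  proof (cases "y \<in> standard_simplex (m - 1)")
    case True
    then have "simplical_face k y \<in> standard_simplex m" "simplical_face k' y \<in> standard_simplex m"
      using m by (auto intro: simplical_face_in_standard_simplex)
    then show ?thesis
      using True per[OF eq[OF True]] by (simp add: singular_face_def torus_simplex_def)
  qed (simp add: singular_face_def)
qed

text \<open>On the face opposite to the vertex \<open>k\<close> the angles of ranks \<open>k - 1\<close> and \<open>k\<close> agree, so exchanging the two ranks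
  changes only the sign.\<close>

lemma inner_face_cancel:
  assumes per: "\<And>\<theta> \<theta>'. (\<And>b. b < m \<Longrightarrow> \<exists>k::int. \<theta> b = \<theta>' b + 2 * pi * k) \<Longrightarrow> \<Psi> \<theta> = \<Psi> \<theta>'"
    and k: "0 < k" "k < m"
  shows "(\<Sum>q | q permutes {0..<m}. frag_cmul (sign q) (frag_of (singular_face m k (torus_simplex m \<Psi> q)))) = 0" (is "?S = 0")
proof -
  let ?t = "Transposition.transpose (k - 1) k"
  have t: "?t permutes {0..<m}" using k by (intro permutes_swap_id) auto
  have face: "singular_face m k (torus_simplex m \<Psi> (?t \<circ> q)) = singular_face m k (torus_simplex m \<Psi> q)" if q: "q permutes {0..<m}" for q
  proof (rule torus_simplex_face_cong[OF per])
    fix y :: "nat \<Rightarrow> real" and b assume b: "b < m"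
    have qb: "q b < m" using permutes_in_image[OF q, of b] b by simp
    have tb: "(?t \<circ> q) b < m" using permutes_in_image[OF permutes_compose[OF q t], of b] b by simp
    \<comment> \<open>Rank k - 1 is below k and is raised to k, rank k stays: both tails start at k,
      and the other ranks are not moved.\<close>
    have "(if (?t \<circ> q) b < k then Suc ((?t \<circ> q) b) else (?t \<circ> q) b) = (if q b < k then Suc (q b) else q b)"
      using k by (auto simp: Transposition.transpose_def)
    then show "\<exists>j::int. tail_angle m (?t \<circ> q) (simplical_face k y) b = tail_angle m q (simplical_face k y) b + 2 * pi * j"
      unfolding tail_angle_face[of q, OF qb less_imp_le[OF k(2)]] tail_angle_face[of "?t \<circ> q", OF tb less_imp_le[OF k(2)]]
      by (intro exI[of _ 0]) simp
  qed (use k in auto)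
  have "?S = (\<Sum>q | q permutes {0..<m}. frag_cmul (sign (?t \<circ> q)) (frag_of (singular_face m k (torus_simplex m \<Psi> (?t \<circ> q)))))"
    by (rule setum_permutations_compose_left[OF t])
  also have "\<dots> = (\<Sum>q | q permutes {0..<m}. - frag_cmul (sign q) (frag_of (singular_face m k (torus_simplex m \<Psi> q))))"
  proof (intro sum.cong refl)
    fix q assume "q \<in> {q. q permutes {0..<m}}"
    then have q: "q permutes {0..<m}" by simp
    have "sign (?t \<circ> q) = - sign q"
      using k q by (subst sign_compose) (auto simp: sign_swap_id intro: permutation_permutes[THEN iffD2] permutation_swap_id)
    then show "frag_cmul (sign (?t \<circ> q)) (frag_of (singular_face m k (torus_simplex m \<Psi> (?t \<circ> q))))
       = - frag_cmul (sign q) (frag_of (singular_face m k (torus_simplex m \<Psi> q)))"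
      unfolding face[OF q] by simp
  qed
  also have "\<dots> = - ?S" by (rule sum_negf)
  finally have neg: "?S = - ?S" .
  \<comment> \<open>Coefficients are integers, so a chain equal to its negative is zero.\<close>
  show ?thesis
  proof (rule poly_mapping_eqI)
    fix \<sigma>
    show "Poly_Mapping.lookup ?S \<sigma> = Poly_Mapping.lookup 0 \<sigma>"
      using arg_cong[OF neg, of "\<lambda>c. Poly_Mapping.lookup c \<sigma>"]
      unfolding lookup_uminus lookup_zero by linarith
  qed
qed

text \<open>On these two faces one angle is a full turn, respectively 0, and the others agree.\<close>

lemma outer_faces_agree:
  assumes per: "\<And>\<theta> \<theta>'. (\<And>b. b < m \<Longrightarrow> \<exists>k::int. \<theta> b = \<theta>' b + 2 * pi * k) \<Longrightarrow> \<Psi> \<theta> = \<Psi> \<theta>'"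
    and m: "1 \<le> m" and q: "q permutes {0..<m}"
  shows "singular_face m 0 (torus_simplex m \<Psi> (rot m \<circ> q)) = singular_face m m (torus_simplex m \<Psi> q)"
proof (rule torus_simplex_face_cong[OF per])
  fix y :: "nat \<Rightarrow> real" and b assume y: "y \<in> standard_simplex (m - 1)" and b: "b < m"
  have qb: "q b < m" using permutes_in_image[OF q, of b] b by simp
  have rb: "(rot m \<circ> q) b < m" using qb by (auto simp: rot_def)
  have "{..m - 1} = {0..<m}" using m by auto
  then have "(\<Sum>i\<in>{0..<m}. y i) = 1" using y by (simp add: standard_simplex_def)
  \<comment> \<open>If q b is the last rank, its shift is rank 0, whose tail on this face is the sum
    of all barycentric coordinates, a full turn. Otherwise the two tails coincide.\<close>
  then have "(\<Sum>i\<in>{(rot m \<circ> q) b..<m}. y i) = (\<Sum>i\<in>{Suc (q b)..<m}. y i) + (if Suc (q b) = m then 1 else 0)"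
    using qb by (auto simp: rot_def)
  then have "tail_angle m (rot m \<circ> q) (simplical_face 0 y) b = tail_angle m q (simplical_face m y) b + 2 * pi * of_int (if Suc (q b) = m then 1 else 0)"
    unfolding tail_angle_face[of "rot m \<circ> q", OF rb le0] tail_angle_face[of q, OF qb order_refl] using qb
    by (simp add: distrib_left)
  then show "\<exists>j::int. tail_angle m (rot m \<circ> q) (simplical_face 0 y) b = tail_angle m q (simplical_face m y) b + 2 * pi * j"
    by blast
qed (use m in auto)

text \<open>Only the faces 0 and m survive. Reindexing face 0 by the cyclic shift identifies it with
  face m at the cost of (-1)^(m-1), against the sign (-1)^m of face m. For m = 0 the boundary is
  zero by convention.\<close>

lemma chain_boundary_torus_chain:
  assumes per: "\<And>\<theta> \<theta>'. (\<And>b. b < m \<Longrightarrow> \<exists>k::int. \<theta> b = \<theta>' b + 2 * pi * k) \<Longrightarrow> \<Psi> \<theta> = \<Psi> \<theta>'"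
  shows "chain_boundary m (torus_chain m \<Psi>) = 0"
proof (cases m)
  case 0
  then show ?thesis by (simp add: chain_boundary_def)
next
  case (Suc m')
  let ?Q = "{q. q permutes {0..<m}}"
  define F where "F = (\<lambda>k q. frag_of (singular_face m k (torus_simplex m \<Psi> q)))"
  define S where "S = (\<lambda>k. \<Sum>q\<in>?Q. frag_cmul (sign q) (F k q))"
  have rot: "rot m permutes {0..<m}" "sign (rot m) = (-1) ^ m'"
    using rot_permutes_sign[of m'] Suc by simp_all
  have "chain_boundary m (torus_chain m \<Psi>) = (\<Sum>q\<in>?Q. \<Sum>k\<le>m. frag_cmul ((-1) ^ k) (frag_cmul (sign q) (F k q)))"
    unfolding torus_chain_def chain_boundary_sum F_def
    using Suc by (simp add: chain_boundary_cmul chain_boundary_of frag_cmul_sum mult.commute del: sum.atMost_Suc)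
  also have "\<dots> = (\<Sum>k\<le>m. frag_cmul ((-1) ^ k) (S k))"
    unfolding S_def frag_cmul_sum by (rule sum.swap)
  also have "\<dots> = (\<Sum>k\<in>{0, m}. frag_cmul ((-1) ^ k) (S k))"
  proof (intro sum.mono_neutral_right ballI)
    fix k assume "k \<in> {..m} - {0, m}"
    then have "S k = 0" unfolding S_def F_def by (intro inner_face_cancel per) auto
    then show "frag_cmul ((-1) ^ k) (S k) = 0" by simp
  qed auto
  also have "\<dots> = S 0 + frag_cmul ((-1) ^ m) (S m)" using Suc by simp
  also have "S 0 = (\<Sum>q\<in>?Q. frag_cmul (sign (rot m \<circ> q)) (F 0 (rot m \<circ> q)))"
    unfolding S_def by (rule setum_permutations_compose_left[OF rot(1)])
  also have "\<dots> = (\<Sum>q\<in>?Q. frag_cmul ((-1) ^ m') (frag_cmul (sign q) (F m q)))"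
  proof (intro sum.cong refl)
    fix q assume "q \<in> ?Q"
    then have q: "q permutes {0..<m}" by simp
    have "sign (rot m \<circ> q) = sign (rot m) * sign q"
      using q rot by (intro sign_compose) (auto intro: permutation_permutes[THEN iffD2])
    moreover have "F 0 (rot m \<circ> q) = F m q"
      unfolding F_def using outer_faces_agree[OF per _ q] Suc by simp
    ultimately show "frag_cmul (sign (rot m \<circ> q)) (F 0 (rot m \<circ> q)) = frag_cmul ((-1) ^ m') (frag_cmul (sign q) (F m q))"
      by (simp add: rot)
  qed
  also have "\<dots> = frag_cmul ((-1) ^ m') (S m)" by (simp only: S_def frag_cmul_sum)
  also have "frag_cmul ((-1) ^ m') (S m) + frag_cmul ((-1) ^ m) (S m) = 0"
    unfolding frag_cmul_distrib[symmetric] Suc by simp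
  finally show ?thesis .
qed

lemma keys_torus_chain:
  "Poly_Mapping.keys (torus_chain m \<Psi>) \<subseteq> torus_simplex m \<Psi> ` {q. q permutes {0..<m}}"
proof
  fix \<sigma> assume "\<sigma> \<in> Poly_Mapping.keys (torus_chain m \<Psi>)"
  then have "Poly_Mapping.lookup (torus_chain m \<Psi>) \<sigma> \<noteq> 0" by (simp add: in_keys_iff)
  then have "(\<Sum>q | q permutes {0..<m}. sign q * Poly_Mapping.lookup (frag_of (torus_simplex m \<Psi> q)) \<sigma>) \<noteq> 0"
    by (simp add: torus_chain_def lookup_sum)
  then obtain q where "q permutes {0..<m}" "Poly_Mapping.lookup (frag_of (torus_simplex m \<Psi> q)) \<sigma> \<noteq> 0"
    by (metis (mono_tags, lifting) mem_Collect_eq mult_zero_right sum.neutral)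
  then show "\<sigma> \<in> torus_simplex m \<Psi> ` {q. q permutes {0..<m}}"
    by (auto simp: lookup_frag_of when_def split: if_splits)
qed

text \<open>For a general \<Psi> different permutations may give the same simplex, so a coefficient
  of the chain is a sum of signs; exchanging the sums over simplices and permutations undoes the
  collection.\<close>

lemma chain_integral_torus_chain:
  "chain_integral n g (torus_chain m \<Psi>)
     = (\<Sum>q | q permutes {0..<m}. of_int (sign q) * simplex_integral n g (torus_simplex m \<Psi> q))"
proof -
  let ?Q = "{q. q permutes {0..<m}}" and ?K = "torus_simplex m \<Psi> ` {q. q permutes {0..<m}}"
  have fin: "finite ?Q" by (simp add: finite_permutations)
  have lk: "Poly_Mapping.lookup (torus_chain m \<Psi>) \<sigma> = (\<Sum>q\<in>?Q. if torus_simplex m \<Psi> q = \<sigma> then sign q else 0)" for \<sigma>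
    unfolding torus_chain_def lookup_sum
    by (intro sum.cong refl) (simp add: lookup_frag_of when_def)
  have "chain_integral n g (torus_chain m \<Psi>) = (\<Sum>\<sigma>\<in>?K. of_int (Poly_Mapping.lookup (torus_chain m \<Psi>) \<sigma>) * simplex_integral n g \<sigma>)"
    unfolding chain_integral_def using keys_torus_chain fin
    by (intro sum.mono_neutral_left) (auto simp: in_keys_iff)
  also have "\<dots> = (\<Sum>\<sigma>\<in>?K. \<Sum>q\<in>?Q. if torus_simplex m \<Psi> q = \<sigma> then of_int (sign q) * simplex_integral n g \<sigma> else 0)"
    unfolding lk of_int_sum sum_distrib_right by (intro sum.cong refl) simp
  also have "\<dots> = (\<Sum>q\<in>?Q. \<Sum>\<sigma>\<in>?K. if torus_simplex m \<Psi> q = \<sigma> then of_int (sign q) * simplex_integral n g \<sigma> else 0)"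
    by (rule sum.swap)
  also have "\<dots> = (\<Sum>q\<in>?Q. of_int (sign q) * simplex_integral n g (torus_simplex m \<Psi> q))"
    using fin by (intro sum.cong refl) (simp add: sum.delta')
  finally show ?thesis .
qed

section \<open>Change of variables from simplices to the cube\<close>

lemma measurable_PiM_fun_upd:
  assumes g: "g \<in> borel_measurable (\<Pi>\<^sub>M i\<in>insert j J. lborel)" 
  shows "(\<lambda>s. s(j := (g s :: real))) \<in> measurable (\<Pi>\<^sub>M i\<in>insert j J. lborel) (\<Pi>\<^sub>M i\<in>insert j J. lborel)"
proof (rule measurable_PiM_single')
  fix i assume "i \<in> insert j J"
  then show "(\<lambda>s. (s(j := g s)) i) \<in> measurable (\<Pi>\<^sub>M i\<in>insert j J. lborel) (lborel :: real measure)"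
    using g measurable_component_singleton[of i "insert j J" "\<lambda>_. lborel :: real measure"] by (cases "i = j") auto
qed (auto simp: space_PiM PiE_def extensional_def)

text \<open>With the other coordinates fixed the substitution is affine in coordinate
  \<open>j\<close>: the translation leaves Lebesgue measure unchanged and the scaling contributes
  c.\<close>

lemma nn_integral_PiM_shear:
  fixes c :: real
  assumes J: "finite J" "j \<notin> J" and c: "c > 0"
    and h: "h \<in> borel_measurable (\<Pi>\<^sub>M i\<in>J. lborel)"
    and f: "f \<in> borel_measurable (\<Pi>\<^sub>M i\<in>insert j J. lborel)"
  shows "ennreal c * (\<integral>\<^sup>+ s. f (s(j := c * s j + h (restrict s J))) \<partial>(\<Pi>\<^sub>M i\<in>insert j J. lborel))
     = (\<integral>\<^sup>+ s. f s \<partial>(\<Pi>\<^sub>M i\<in>insert j J. lborel))"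
proof -
  interpret product_sigma_finite "\<lambda>_. lborel :: real measure" by standard
  let ?M = "\<Pi>\<^sub>M i\<in>insert j J. lborel :: real measure" and ?N = "\<Pi>\<^sub>M i\<in>J. lborel :: real measure"
  have r: "(\<lambda>\<theta>. restrict \<theta> J) \<in> measurable ?M ?N"
    by (rule measurable_restrict_subset) auto
  have "(\<lambda>s. s j) \<in> borel_measurable ?M"
    using measurable_component_singleton[of j "insert j J" "\<lambda>_. lborel :: real measure"] by simp
  then have "(\<lambda>s. c * s j + h (restrict s J)) \<in> borel_measurable ?M"
    using measurable_compose[OF r h] by measurable
  from measurable_compose[OF measurable_PiM_fun_upd[OF this] f]
  have m: "(\<lambda>s. f (s(j := c * s j + h (restrict s J)))) \<in> borel_measurable ?M" .
  have "(\<integral>\<^sup>+ s. f (s(j := c * s j + h (restrict s J))) \<partial>?M)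
     = (\<integral>\<^sup>+ x. (\<integral>\<^sup>+ y. f (x(j := h x + c * y)) \<partial>lborel) \<partial>?N)"
    unfolding product_nn_integral_insert[OF J m]
  proof (intro nn_integral_cong)
    fix x y assume x: "x \<in> space ?N"
    then have "restrict (x(j := y)) J = x"
      using J by (auto simp: space_PiM PiE_def extensional_def restrict_def)
    then show "f ((x(j := y))(j := c * (x(j := y)) j + h (restrict (x(j := y)) J))) = f (x(j := h x + c * y))"
      by (simp add: add.commute)
  qed
  then have "ennreal c * (\<integral>\<^sup>+ s. f (s(j := c * s j + h (restrict s J))) \<partial>?M)
     = ennreal c * (\<integral>\<^sup>+ x. (\<integral>\<^sup>+ y. f (x(j := h x + c * y)) \<partial>lborel) \<partial>?N)" by simp
  also have "\<dots> = (\<integral>\<^sup>+ x. ennreal c * (\<integral>\<^sup>+ y. f (x(j := h x + c * y)) \<partial>lborel) \<partial>?N)"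
  proof (intro nn_integral_cmult[symmetric])
    have "(\<lambda>(x, y). f (x(j := h x + c * y))) \<in> borel_measurable (?N \<Otimes>\<^sub>M lborel)"
    proof -
      have "(\<lambda>(x, y). x(j := h x + c * y)) \<in> measurable (?N \<Otimes>\<^sub>M lborel) ?M"
        unfolding case_prod_beta
      proof (rule measurable_PiM_single')
        fix i assume i: "i \<in> insert j J"
        show "(\<lambda>p. ((fst p)(j := h (fst p) + c * snd p)) i) \<in> measurable (?N \<Otimes>\<^sub>M lborel) lborel"
        proof (cases "i = j")
          case True
          then show ?thesis using h by simp
        next
          case False
          then show ?thesis
            using i measurable_compose[OF measurable_fst measurable_component_singleton[of i J "\<lambda>_. lborel :: real measure"], of lborel] by simp
        qed
      qed (auto simp: space_PiM space_pair_measure PiE_def extensional_def)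
      from measurable_compose[OF this f] show ?thesis by (simp add: case_prod_beta)
    qed
    from lborel.borel_measurable_nn_integral[OF this]
    show "(\<lambda>x. \<integral>\<^sup>+ y. f (x(j := h x + c * y)) \<partial>lborel) \<in> borel_measurable ?N" .
  qed
  also have "\<dots> = (\<integral>\<^sup>+ x. (\<integral>\<^sup>+ y. f (x(j := y)) \<partial>lborel) \<partial>?N)"
  proof (intro nn_integral_cong)
    fix x assume x: "x \<in> space ?N"
    have "(\<lambda>y. f (x(j := y))) \<in> borel_measurable lborel"
      using measurable_comp[OF measurable_component_update f, OF x J(2)] unfolding comp_def .
    then have "(\<lambda>y. f (x(j := y))) \<in> borel_measurable borel" by simp
    from nn_integral_real_affine[OF this, of c "h x"] c
    show "ennreal c * (\<integral>\<^sup>+ y. f (x(j := h x + c * y)) \<partial>lborel) = (\<integral>\<^sup>+ y. f (x(j := y)) \<partial>lborel)"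
      by simp
  qed
  also have "\<dots> = (\<integral>\<^sup>+ s. f s \<partial>?M)"
    by (rule product_nn_integral_insert[OF J f, symmetric])
  finally show ?thesis .
qed

text \<open>The tail sums are produced from the last one down, by one shear per coordinate.\<close>

lemma nn_integral_PiM_tail_sums:
  fixes c :: real
  assumes c: "c > 0" and d: "d \<le> m" and f: "f \<in> borel_measurable (\<Pi>\<^sub>M i\<in>{1..m}. lborel)"
  shows "ennreal c ^ d * (\<integral>\<^sup>+ s. f (\<lambda>i\<in>{1..m}. if m - d < i then c * (\<Sum>k=i..m. s k) else s i) \<partial>(\<Pi>\<^sub>M i\<in>{1..m}. lborel))
     = (\<integral>\<^sup>+ s. f s \<partial>(\<Pi>\<^sub>M i\<in>{1..m}. lborel))"
  using d f
proof (induction d arbitrary: f)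
  case 0
  show ?case unfolding power_0 mult_1_left
    by (intro nn_integral_cong arg_cong[where f = f]) (auto simp: space_PiM PiE_def extensional_def fun_eq_iff)
next
  case (Suc d)
  define j where "j = m - d"
  define J where "J = {1..m} - {j}"
  have j: "j \<in> {1..m}" "j \<notin> J" "insert j J = {1..m}" and J: "finite J"
    using Suc.prems by (auto simp: j_def J_def)
  \<comment> \<open>The tail sum starting one index later, already scaled by c; there is none for
    the last coordinate.\<close>
  define h where "h = (\<lambda>u :: nat \<Rightarrow> real. if j = m then 0 else u (Suc j))"
  have h: "h \<in> borel_measurable (\<Pi>\<^sub>M i\<in>J. lborel)"
  proof (cases "j = m")
    case False
    then have "Suc j \<in> J" using j by (auto simp: J_def)
    from measurable_component_singleton[OF this, of "\<lambda>_. lborel :: real measure"] False show ?thesis by (simp add: h_def)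
  qed (simp add: h_def)
  \<comment> \<open>The newest shear is absorbed into the integrand, so the induction hypothesis is
    used for another function.\<close>
  define f' where "f' = (\<lambda>u. f (u(j := c * u j + h (restrict u J))))"
  have "(\<lambda>s. s j) \<in> borel_measurable (\<Pi>\<^sub>M i\<in>insert j J. lborel)"
    using measurable_component_singleton[of j "insert j J" "\<lambda>_. lborel :: real measure"] by simp
  then have "(\<lambda>s. c * s j + h (restrict s J)) \<in> borel_measurable (\<Pi>\<^sub>M i\<in>insert j J. lborel)"
    using measurable_compose[OF measurable_restrict_subset h, of "insert j J"] by (intro borel_measurable_add borel_measurable_times) auto
  from measurable_compose[OF measurable_PiM_fun_upd[OF this] Suc.prems(2)[folded j(3)]]
  have f': "f' \<in> borel_measurable (\<Pi>\<^sub>M i\<in>{1..m}. lborel)" unfolding f'_def j(3) .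
  have eq: "f (\<lambda>i\<in>{1..m}. if m - Suc d < i then c * (\<Sum>k=i..m. s k) else s i)
     = f' (\<lambda>i\<in>{1..m}. if m - d < i then c * (\<Sum>k=i..m. s k) else s i)" for s
  proof -
    let ?u = "\<lambda>i\<in>{1..m}. if m - d < i then c * (\<Sum>k=i..m. s k) else s i"
    have "c * ?u j + h (restrict ?u J) = c * (\<Sum>k=j..m. s k)"
    proof (cases "j = m")
      case True
      then show ?thesis using j by (simp add: h_def j_def)
    next
      case False
      then have "Suc j \<in> J" "Suc j \<in> {1..m}" "m - d < Suc j" using j by (auto simp: J_def j_def)
      then have "h (restrict ?u J) = c * (\<Sum>k=Suc j..m. s k)" using False by (simp add: h_def)
      moreover have "?u j = s j" using j by (simp add: j_def)
      moreover have "(\<Sum>k=j..m. s k) = s j + (\<Sum>k=Suc j..m. s k)" using j by (simp add: sum.atLeast_Suc_atMost)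
      ultimately show ?thesis by (simp only: distrib_left)
    qed
    moreover have "(\<lambda>i\<in>{1..m}. if m - Suc d < i then c * (\<Sum>k=i..m. s k) else s i) = ?u(j := c * (\<Sum>k=j..m. s k))"
      using j Suc.prems(1) by (auto simp: fun_eq_iff j_def)
    ultimately show ?thesis unfolding f'_def by simp
  qed
  have "ennreal c ^ Suc d * (\<integral>\<^sup>+ s. f (\<lambda>i\<in>{1..m}. if m - Suc d < i then c * (\<Sum>k=i..m. s k) else s i) \<partial>(\<Pi>\<^sub>M i\<in>{1..m}. lborel))
    = ennreal c * (ennreal c ^ d * (\<integral>\<^sup>+ s. f' (\<lambda>i\<in>{1..m}. if m - d < i then c * (\<Sum>k=i..m. s k) else s i) \<partial>(\<Pi>\<^sub>M i\<in>{1..m}. lborel)))"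
    unfolding eq by (simp only: power_Suc mult.assoc)
  also have "\<dots> = ennreal c * (\<integral>\<^sup>+ s. f' s \<partial>(\<Pi>\<^sub>M i\<in>{1..m}. lborel))"
    using Suc.prems f' by (subst Suc.IH) auto
  also have "\<dots> = (\<integral>\<^sup>+ s. f s \<partial>(\<Pi>\<^sub>M i\<in>{1..m}. lborel))"
    using nn_integral_PiM_shear[OF J j(2) c h, of f] Suc.prems(2) unfolding f'_def j(3) by simp
  finally show ?case .
qed

text \<open>A product measure is determined by its values on boxes, and a relabelled box is a box
  with the same sides.\<close>

lemma distr_PiM_bij:
  assumes I: "finite I" and p: "bij_betw p J I"
  shows "distr (\<Pi>\<^sub>M i\<in>I. lborel) (\<Pi>\<^sub>M j\<in>J. lborel) (\<lambda>u. \<lambda>j\<in>J. u (p j)) = (\<Pi>\<^sub>M j\<in>J. lborel :: real measure)"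
proof -
  interpret product_sigma_finite "\<lambda>_. lborel :: real measure" by standard
  have J: "finite J" using bij_betw_finite[OF p] I by simp
  have m: "(\<lambda>u. \<lambda>j\<in>J. u (p j)) \<in> measurable (\<Pi>\<^sub>M i\<in>I. lborel) (\<Pi>\<^sub>M j\<in>J. lborel :: real measure)"
    using p by (intro measurable_restrict measurable_component_singleton) (auto simp: bij_betw_def)
  show ?thesis
  proof (rule PiM_eqI[OF J])
    fix A :: "'b \<Rightarrow> real set" assume A: "\<And>i. i \<in> J \<Longrightarrow> A i \<in> sets lborel"
    let ?B = "\<lambda>i. A (the_inv_into J p i)"
    have B: "?B (p j) = A j" if "j \<in> J" for j
      using p that by (simp add: the_inv_into_f_f bij_betw_def)
    have "(\<lambda>u. \<lambda>j\<in>J. u (p j)) -` (Pi\<^sub>E J A) \<inter> space (\<Pi>\<^sub>M i\<in>I. lborel) = Pi\<^sub>E I ?B"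
      using p B by (auto simp: space_PiM bij_betw_def PiE_iff)
    then have "emeasure (distr (\<Pi>\<^sub>M i\<in>I. lborel) (\<Pi>\<^sub>M j\<in>J. lborel) (\<lambda>u. \<lambda>j\<in>J. u (p j))) (Pi\<^sub>E J A) = emeasure (\<Pi>\<^sub>M i\<in>I. lborel) (Pi\<^sub>E I ?B)"
      using A J by (subst emeasure_distr[OF m]) (auto intro: sets_PiM_I_finite)
    also have "\<dots> = (\<Prod>i\<in>I. emeasure lborel (?B i))"
      using I A p by (intro emeasure_PiM) (auto simp: bij_betw_def the_inv_into_f_f)
    also have "\<dots> = (\<Prod>j\<in>J. emeasure lborel (?B (p j)))"
      by (rule prod.reindex_bij_betw[OF p, symmetric])
    also have "\<dots> = (\<Prod>j\<in>J. emeasure lborel (A j))" using B by simp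
    finally show "emeasure (distr (\<Pi>\<^sub>M i\<in>I. lborel) (\<Pi>\<^sub>M j\<in>J. lborel) (\<lambda>u. \<lambda>j\<in>J. u (p j))) (Pi\<^sub>E J A) = (\<Prod>j\<in>J. emeasure lborel (A j))" .
  qed simp
qed

text \<open>The angles belong to x 2, ..., x n while permutations act on 0, ..., m - 1; hence the
  shift by 2.\<close>

definition simplex_angles :: "nat \<Rightarrow> (nat \<Rightarrow> nat) \<Rightarrow> (nat \<Rightarrow> real) \<Rightarrow> nat \<Rightarrow> real" where
  "simplex_angles m q s = (\<lambda>j\<in>{2..Suc m}. tail_angle m q s (j - 2))"

lemma simplex_angles_bij:
  assumes q: "q permutes {0..<m}"
  shows "bij_betw (\<lambda>j. q (j - 2) + 1) {2..Suc m} {1..m}"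
proof -
  have "bij_betw (\<lambda>j. j - 2) {2..Suc m} {0..<m}"
    by (rule bij_betw_byWitness[where f' = "\<lambda>b. b + 2"]) auto
  moreover have "bij_betw q {0..<m} {0..<m}" using q by (rule permutes_imp_bij)
  moreover have "bij_betw (\<lambda>a. a + 1) {0..<m} {1..m}"
    by (rule bij_betw_byWitness[where f' = "\<lambda>b. b - 1"]) auto
  ultimately have "bij_betw ((\<lambda>a. a + 1) \<circ> (q \<circ> (\<lambda>j. j - 2))) {2..Suc m} {1..m}"
    by (rule bij_betw_trans[OF bij_betw_trans])
  then show ?thesis by (simp add: comp_def)
qed

text \<open>Brings the map into the form of the tail-sum formula with d = m, where every coordinate
  is replaced, followed by a relabelling of coordinates.\<close>

lemma simplex_angles_alt:
  assumes q: "q permutes {0..<m}"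
  shows "simplex_angles m q s = (\<lambda>j\<in>{2..Suc m}. (\<lambda>i\<in>{1..m}. if m - m < i then (2 * pi) * (\<Sum>k=i..m. s k) else s i) (q (j - 2) + 1))"
  using bij_betwE[OF simplex_angles_bij[OF q]] by (auto simp: simplex_angles_def tail_angle_def fun_eq_iff)

lemma measurable_simplex_angles:
  assumes q: "q permutes {0..<m}"
  shows "simplex_angles m q \<in> measurable (\<Pi>\<^sub>M i\<in>{1..m}. lborel) (\<Pi>\<^sub>M j\<in>{2..Suc m}. lborel)"
proof -
  have c: "(\<lambda>s. s k) \<in> borel_measurable (\<Pi>\<^sub>M i\<in>{1..m}. lborel :: real measure)" if "k \<in> {1..m}" for k
    using measurable_component_singleton[OF that, of "\<lambda>_. lborel :: real measure"] by simp
  show ?thesis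
    unfolding simplex_angles_def tail_angle_def
    using c by (intro measurable_restrict) (auto intro!: borel_measurable_times borel_measurable_sum)
qed

text \<open>Change of variables as an identity of measures: scaled tail sums have Jacobian (2 pi)^m
  and relabelling preserves the measure. In this form it passes from nonnegative to complex
  integrands.\<close>

lemma PiM_eq_density_simplex_angles:
  assumes q: "q permutes {0..<m}"
  shows "(\<Pi>\<^sub>M j\<in>{2..Suc m}. lborel) = density (distr (\<Pi>\<^sub>M i\<in>{1..m}. lborel) (\<Pi>\<^sub>M j\<in>{2..Suc m}. lborel) (simplex_angles m q)) (\<lambda>_. ennreal ((2 * pi) ^ m))"
    (is "?J = density (distr ?I ?J ?T) _")
proof (rule measure_eqI)
  fix A assume A: "A \<in> sets ?J"
  let ?p = "\<lambda>u. \<lambda>j\<in>{2..Suc m}. u (q (j - 2) + 1)"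
  note p = simplex_angles_bij[OF q]
  have mp: "?p \<in> measurable ?I ?J"
    using p by (intro measurable_restrict measurable_component_singleton) (auto dest: bij_betwE)
  have f: "(\<lambda>u. indicator A (?p u) :: ennreal) \<in> borel_measurable ?I"
    by (rule measurable_compose[OF mp borel_measurable_indicator[OF A]])
  have "emeasure ?J A = emeasure (distr ?I ?J ?p) A"
    using distr_PiM_bij[OF _ p] by simp
  also have "\<dots> = (\<integral>\<^sup>+ u. indicator A (?p u) \<partial>?I)"
  proof -
    have "emeasure (distr ?I ?J ?p) A = (\<integral>\<^sup>+ x. indicator A x \<partial>distr ?I ?J ?p)" using A by simp
    also have "\<dots> = (\<integral>\<^sup>+ u. indicator A (?p u) \<partial>?I)"
      by (rule nn_integral_distr[OF mp borel_measurable_indicator]) (use A in simp)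
    finally show ?thesis .
  qed
  also have "\<dots> = ennreal (2 * pi) ^ m * (\<integral>\<^sup>+ s. indicator A (?T s) \<partial>?I)"
    unfolding simplex_angles_alt[OF q]
    using nn_integral_PiM_tail_sums[of "2 * pi" m m "\<lambda>u. indicator A (?p u)"] f by simp
  also have "\<dots> = ennreal ((2 * pi) ^ m) * (\<integral>\<^sup>+ s. indicator A (?T s) \<partial>?I)"
    by (subst ennreal_power[symmetric]) simp_all
  also have "(\<integral>\<^sup>+ s. indicator A (?T s) \<partial>?I) = (\<integral>\<^sup>+ x. indicator A x \<partial>distr ?I ?J ?T)"
    by (rule nn_integral_distr[OF measurable_simplex_angles[OF q] borel_measurable_indicator, symmetric]) (use A in simp)
  also have "ennreal ((2 * pi) ^ m) * \<dots> = (\<integral>\<^sup>+ x. ennreal ((2 * pi) ^ m) * indicator A x \<partial>distr ?I ?J ?T)"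
    using A by (intro nn_integral_cmult[symmetric]) simp
  also have "\<dots> = emeasure (density (distr ?I ?J ?T) (\<lambda>_. ennreal ((2 * pi) ^ m))) A"
    using A by (subst emeasure_density) simp_all
  finally show "emeasure ?J A = emeasure (density (distr ?I ?J ?T) (\<lambda>_. ennreal ((2 * pi) ^ m))) A" .
qed simp

lemma integral_simplex_angles:
  fixes F :: "(nat \<Rightarrow> real) \<Rightarrow> complex"
  assumes q: "q permutes {0..<m}" and F: "F \<in> borel_measurable (\<Pi>\<^sub>M j\<in>{2..Suc m}. lborel)"
  shows "(\<integral>\<theta>. F \<theta> \<partial>(\<Pi>\<^sub>M j\<in>{2..Suc m}. lborel)) = (2 * of_real pi) ^ m * (\<integral>s. F (simplex_angles m q s) \<partial>(\<Pi>\<^sub>M i\<in>{1..m}. lborel))"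
  by (subst PiM_eq_density_simplex_angles[OF q])
     (use F measurable_simplex_angles[OF q] in \<open>simp add: integral_density integral_distr scaleR_conv_of_real\<close>)

section \<open>Cutting the cube of angles by their order\<close>

text \<open>The angle vectors in the open cube whose ranks in decreasing order are given by q.
  Strict inequalities leave out ties and endpoints, which form a null set.\<close>

definition cone :: "nat \<Rightarrow> (nat \<Rightarrow> nat) \<Rightarrow> (nat \<Rightarrow> real) set" where
  "cone m q = {\<theta>. (\<forall>b\<in>{0..<m}. 0 < \<theta> (b + 2) \<and> \<theta> (b + 2) < 2 * pi) \<and>
     (\<forall>b\<in>{0..<m}. \<forall>b'\<in>{0..<m}. q b < q b' \<longrightarrow> \<theta> (b' + 2) < \<theta> (b + 2))}"

text \<open>Up to the factor 2 pi the coordinates s are the gaps between angles of consecutive rank,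
  the last one being the smallest angle; 1 minus their sum is the gap below a full turn. Positive
  gaps are the same as the strict order.\<close>

lemma simplex_angles_in_cone_iff:
  assumes q: "q permutes {0..<m}" and s: "s \<in> {1..m} \<rightarrow>\<^sub>E UNIV"
  shows "simplex_angles m q s \<in> cone m q \<longleftrightarrow> s \<in> open_simplex m"
proof -
  have qm: "q b < m" if "b < m" for b using permutes_in_image[OF q, of b] that by simp
  have val: "simplex_angles m q s (b + 2) = 2 * pi * (\<Sum>k=q b + 1..m. s k)" if "b < m" for b
    using that by (simp add: simplex_angles_def tail_angle_def)
  have surj: "\<exists>b<m. q b = a" if "a < m" for a
  proof -
    have "a \<in> q ` {0..<m}" using permutes_image[OF q] that by simp
    then show ?thesis by auto
  qed
  show ?thesis
  proof
    assume s': "s \<in> open_simplex m"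
    then have pos: "s k > 0" if "k \<in> {1..m}" for k using that by (auto simp: open_simplex_def)
    have lt1: "(\<Sum>k=1..m. s k) < 1" using s' by (simp add: open_simplex_def)
    have "0 < (\<Sum>k=q b + 1..m. s k)" "(\<Sum>k=q b + 1..m. s k) < 1" if "b < m" for b
    proof -
      show "0 < (\<Sum>k=q b + 1..m. s k)" using qm[OF that] pos by (intro sum_pos) auto
      have "(\<Sum>k=q b + 1..m. s k) \<le> (\<Sum>k=1..m. s k)" using pos by (intro sum_mono2) (auto intro: less_imp_le)
      with lt1 show "(\<Sum>k=q b + 1..m. s k) < 1" by simp
    qed
    moreover have "(\<Sum>k=q b' + 1..m. s k) < (\<Sum>k=q b + 1..m. s k)" if "b < m" "b' < m" "q b < q b'" for b b'
      using that qm[of b'] pos by (intro sum_strict_mono2[of _ _ "q b'"]) (auto intro: less_imp_le)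
    ultimately show "simplex_angles m q s \<in> cone m q"
      unfolding cone_def using val by simp
  next
    assume c: "simplex_angles m q s \<in> cone m q"
    have c1: "0 < 2 * pi * (\<Sum>k=q b + 1..m. s k)" "2 * pi * (\<Sum>k=q b + 1..m. s k) < 2 * pi" if "b < m" for b
      using c that unfolding cone_def val[OF that, symmetric] by simp_all
    have c2: "2 * pi * (\<Sum>k=q b' + 1..m. s k) < 2 * pi * (\<Sum>k=q b + 1..m. s k)" if "b < m" "b' < m" "q b < q b'" for b b'
      using c that unfolding cone_def val[OF that(1), symmetric] val[OF that(2), symmetric] by simp
    have "s k > 0" if k: "k \<in> {1..m}" for k
    proof -
      have "k - 1 < m" using k by auto
      then obtain b where b: "b < m" "q b = k - 1" using surj by blast
      have qb: "q b + 1 = k" using b k by simp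
      have "0 < 2 * pi * (\<Sum>i=k..m. s i)" using c1(1)[OF b(1)] unfolding qb .
      show ?thesis
      proof (cases "k = m")
        case True
        then show ?thesis using \<open>0 < 2 * pi * (\<Sum>i=k..m. s i)\<close> by (simp add: zero_less_mult_iff)
      next
        case False
        then have "k < m" using k by auto
        then obtain b' where b': "b' < m" "q b' = k" using surj by blast
        \<comment> \<open>The angles of ranks k and k - 1 differ by 2 pi s k.\<close>
        have "2 * pi * (\<Sum>i=Suc k..m. s i) < 2 * pi * (\<Sum>i=k..m. s i)"
          using c2[OF b(1) b'(1)] b(2) b'(2) k unfolding qb by simp
        then have "(\<Sum>i=Suc k..m. s i) < (\<Sum>i=k..m. s i)" by simp
        then show ?thesis using k by (simp add: sum.atLeast_Suc_atMost)
      qed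
    qed
    moreover have "(\<Sum>k=1..m. s k) < 1"
    proof (cases "m = 0")
      case False
      then obtain b where b: "b < m" "q b = 0" using surj[of 0] by auto
      have "2 * pi * (\<Sum>k=1..m. s k) < 2 * pi * 1" using c1(2)[OF b(1)] b(2) by simp
      then show ?thesis by simp
    qed simp
    ultimately show "s \<in> open_simplex m" using s by (auto simp: open_simplex_def PiE_def)
  qed
qed

text \<open>The rank of an angle is the number of larger ones. Any admissible q has this value,
  since exactly q b indices have a rank below q b.\<close>

lemma unique_cone:
  assumes box: "\<And>b. b < m \<Longrightarrow> 0 < \<theta> (b + 2) \<and> \<theta> (b + 2) < 2 * pi"
    and inj: "inj_on (\<lambda>b. \<theta> (b + 2)) {0..<m}"
  shows "\<exists>!q. q permutes {0..<m} \<and> \<theta> \<in> cone m q"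
proof -
  \<comment> \<open>Outside 0, ..., m - 1 it is the identity, as a permutation of that set must
    be.\<close>
  define rank where "rank = (\<lambda>b. if b < m then card {b' \<in> {0..<m}. \<theta> (b + 2) < \<theta> (b' + 2)} else b)"
  have rank_less: "rank b < rank b'" if "b < m" "b' < m" "\<theta> (b' + 2) < \<theta> (b + 2)" for b b'
  proof -
    have "b \<in> {c \<in> {0..<m}. \<theta> (b' + 2) < \<theta> (c + 2)}" "b \<notin> {c \<in> {0..<m}. \<theta> (b + 2) < \<theta> (c + 2)}"
      using that by simp_all
    moreover have "{c \<in> {0..<m}. \<theta> (b + 2) < \<theta> (c + 2)} \<subseteq> {c \<in> {0..<m}. \<theta> (b' + 2) < \<theta> (c + 2)}"
      using that(3) by auto
    ultimately have "{c \<in> {0..<m}. \<theta> (b + 2) < \<theta> (c + 2)} \<subset> {c \<in> {0..<m}. \<theta> (b' + 2) < \<theta> (c + 2)}"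
      by blast
    then show ?thesis using that unfolding rank_def by (simp add: psubset_card_mono)
  qed
  have rank_m: "rank b < m" if "b < m" for b
  proof -
    have "b \<in> {0..<m}" "b \<notin> {c \<in> {0..<m}. \<theta> (b + 2) < \<theta> (c + 2)}" using that by simp_all
    then have "{c \<in> {0..<m}. \<theta> (b + 2) < \<theta> (c + 2)} \<subset> {0..<m}" by blast
    from psubset_card_mono[OF _ this] show ?thesis using that by (simp add: rank_def)
  qed
  have rank_neq: "rank b \<noteq> rank b'" if "b < m" "b' < m" "b \<noteq> b'" for b b'
  proof -
    have "\<theta> (b + 2) \<noteq> \<theta> (b' + 2)" using inj_onD[OF inj, of b b'] that by auto
    then consider "\<theta> (b + 2) < \<theta> (b' + 2)" | "\<theta> (b' + 2) < \<theta> (b + 2)" by linarith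
    then show ?thesis using rank_less[of b b'] rank_less[of b' b] that by cases auto
  qed
  have "inj_on rank {0..<m}"
  proof (rule inj_onI, rule ccontr)
    fix b b' assume "b \<in> {0..<m}" "b' \<in> {0..<m}" "rank b = rank b'" "b \<noteq> b'"
    then show False using rank_neq[of b b'] by simp
  qed
  moreover have "rank ` {0..<m} \<subseteq> {0..<m}" using rank_m by auto
  ultimately have "bij_betw rank {0..<m} {0..<m}"
    by (simp add: bij_betw_def endo_inj_surj)
  then have perm: "rank permutes {0..<m}"
    by (rule bij_imp_permutes) (simp add: rank_def)
  moreover have "\<theta> \<in> cone m rank"
  proof -
    have "\<theta> (b' + 2) < \<theta> (b + 2)" if "b < m" "b' < m" "rank b < rank b'" for b b'
    proof (rule ccontr)
      assume "\<not> \<theta> (b' + 2) < \<theta> (b + 2)"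
      moreover have "\<theta> (b' + 2) \<noteq> \<theta> (b + 2)" using inj_onD[OF inj, of b' b] that by auto
      ultimately show False using rank_less[of b' b] that by auto
    qed
    then show ?thesis unfolding cone_def using box by simp
  qed
  moreover have "q = rank" if q: "q permutes {0..<m}" and c: "\<theta> \<in> cone m q" for q
  proof
    fix b show "q b = rank b"
    proof (cases "b < m")
      case True
      have qm: "q c < m" if "c < m" for c using permutes_in_image[OF q, of c] that by simp
      have "{c \<in> {0..<m}. \<theta> (b + 2) < \<theta> (c + 2)} = {c \<in> {0..<m}. q c < q b}"
      proof (intro Collect_cong conj_cong refl)
        fix c assume c': "c \<in> {0..<m}"
        have "q c < q b \<Longrightarrow> \<theta> (b + 2) < \<theta> (c + 2)" "q b < q c \<Longrightarrow> \<theta> (c + 2) < \<theta> (b + 2)"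
          using c c' True by (auto simp: cone_def)
        moreover have "q b = q c \<Longrightarrow> b = c" using permutes_inj[OF q] by (auto dest: injD)
        ultimately show "\<theta> (b + 2) < \<theta> (c + 2) \<longleftrightarrow> q c < q b"
          by (cases "q b" "q c" rule: linorder_cases) auto
      qed
      then have "rank b = card {c \<in> {0..<m}. q c < q b}" using True by (simp add: rank_def)
      also have "\<dots> = card (q ` {c \<in> {0..<m}. q c < q b})"
        using permutes_inj[OF q] by (intro card_image[symmetric]) (auto intro: inj_on_subset)
      also have "q ` {c \<in> {0..<m}. q c < q b} = {0..<q b}"
      proof -
        have "a \<in> q ` {c \<in> {0..<m}. q c < q b}" if "a < q b" for a
        proof -
          have "a \<in> q ` {0..<m}" using permutes_image[OF q] that qm[OF True] by simp
          with that show ?thesis by auto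
        qed
        then show ?thesis by auto
      qed
      finally show ?thesis by simp
    next
      case False
      then show ?thesis using permutes_not_in[OF q] by (simp add: rank_def)
    qed
  qed
  ultimately show ?thesis by blast
qed

lemma cone_subset_box:
  assumes c: "\<theta> \<in> cone m q" and e: "\<theta> \<in> extensional {2..Suc m}"
  shows "\<theta> \<in> {2..Suc m} \<rightarrow>\<^sub>E {0..2 * pi}"
proof (rule PiE_I)
  fix j assume "j \<in> {2..Suc m}"
  then have j: "j - 2 \<in> {0..<m}" "j - 2 + 2 = j" by auto
  have "\<forall>b\<in>{0..<m}. 0 < \<theta> (b + 2) \<and> \<theta> (b + 2) < 2 * pi" using c by (simp add: cone_def)
  from bspec[OF this j(1)] show "\<theta> j \<in> {0..2 * pi}" unfolding j(2) by simp
qed (use e in \<open>auto simp: extensional_def\<close>)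

text \<open>Away from ties and endpoints a point of the cube lies in exactly one cone, and a point
  outside the cube lies in none.\<close>

lemma AE_sum_indicator_cone:
  "AE \<theta> in (\<Pi>\<^sub>M j\<in>{2..Suc m}. lborel).
     (\<Sum>q | q permutes {0..<m}. indicat_real (cone m q) \<theta>) = indicat_real ({2..Suc m} \<rightarrow>\<^sub>E {0..2 * pi}) \<theta>"
proof -
  let ?M = "\<Pi>\<^sub>M j\<in>{2..Suc m}. lborel :: real measure"
  have ne: "AE \<theta> in ?M. \<theta> i \<noteq> \<theta> j" if "i \<in> {2..Suc m}" "j \<in> {2..Suc m}" "i \<noteq> j" for i j
  proof -
    have ins: "insert i ({2..Suc m} - {i}) = {2..Suc m}" and j: "j \<in> {2..Suc m} - {i}" using that by auto
    have "(\<lambda>x. x j) \<in> borel_measurable (\<Pi>\<^sub>M j\<in>{2..Suc m} - {i}. lborel :: real measure)"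
      using measurable_component_singleton[OF j, of "\<lambda>_. lborel :: real measure"] by simp
    from AE_PiM_coord_neq[OF _ _ this, of i] show ?thesis
      unfolding ins using j by simp
  qed
  have "AE \<theta> in ?M. \<forall>i\<in>{2..Suc m}. \<forall>j\<in>{2..Suc m}. i \<noteq> j \<longrightarrow> \<theta> i \<noteq> \<theta> j"
    using ne by (intro AE_finite_allI) auto
  moreover have "AE \<theta> in ?M. \<forall>j\<in>{2..Suc m}. \<theta> j \<noteq> 0"
    by (intro AE_finite_allI AE_PiM_coord_neq_const) auto
  moreover have "AE \<theta> in ?M. \<forall>j\<in>{2..Suc m}. \<theta> j \<noteq> 2 * pi"
    by (intro AE_finite_allI AE_PiM_coord_neq_const) auto
  moreover have "AE \<theta> in ?M. \<theta> \<in> space ?M" by (rule AE_space)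
  ultimately show ?thesis
  proof eventually_elim
    case (elim \<theta>)
    show ?case
    proof (cases "\<theta> \<in> {2..Suc m} \<rightarrow>\<^sub>E {0..2 * pi}")
      case True
      have box: "0 < \<theta> (b + 2) \<and> \<theta> (b + 2) < 2 * pi" if "b < m" for b
      proof -
        have j: "b + 2 \<in> {2..Suc m}" using that by auto
        then have "\<theta> (b + 2) \<in> {0..2 * pi}" using True by (rule PiE_mem[rotated])
        moreover have "\<theta> (b + 2) \<noteq> 0" "\<theta> (b + 2) \<noteq> 2 * pi" using elim j by blast+
        ultimately show ?thesis by simp
      qed
      have "inj_on (\<lambda>b. \<theta> (b + 2)) {0..<m}"
      proof (rule inj_onI)
        fix b b' assume "b \<in> {0..<m}" "b' \<in> {0..<m}" and eq: "\<theta> (b + 2) = \<theta> (b' + 2)"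
        then have "b + 2 \<in> {2..Suc m}" "b' + 2 \<in> {2..Suc m}" by auto
        with elim(1) eq have "b + 2 = b' + 2" by blast
        then show "b = b'" by simp
      qed
      from unique_cone[OF box this, unfolded Ex1_def] obtain q where
        "(q permutes {0..<m} \<and> \<theta> \<in> cone m q) \<and> (\<forall>q'. q' permutes {0..<m} \<and> \<theta> \<in> cone m q' \<longrightarrow> q' = q)"
        by (rule exE)
      then have q: "q permutes {0..<m}" "\<theta> \<in> cone m q"
        and uniq: "\<And>q'. q' permutes {0..<m} \<Longrightarrow> \<theta> \<in> cone m q' \<Longrightarrow> q' = q" by simp_all
      have "(\<Sum>q' | q' permutes {0..<m}. indicat_real (cone m q') \<theta>) = (\<Sum>q' | q' permutes {0..<m}. if q' = q then 1 else 0)"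
      proof (intro sum.cong refl)
        fix q' assume "q' \<in> {q'. q' permutes {0..<m}}"
        then have p: "q' permutes {0..<m}" by simp
        show "indicat_real (cone m q') \<theta> = (if q' = q then 1 else 0)"
        proof (cases "q' = q")
          case False
          then have "\<theta> \<notin> cone m q'" using uniq[OF p] by blast
          then show ?thesis using False by simp
        qed (use q in simp)
      qed
      also have "\<dots> = 1" using q by (simp add: sum.delta finite_permutations)
      finally show ?thesis using True by simp
    next
      case False
      have "\<theta> \<notin> cone m q" for q
      proof
        assume c: "\<theta> \<in> cone m q"
        with cone_subset_box[OF c] elim(4) False show False by (simp add: space_PiM PiE_def)
      qed
      then show ?thesis using False by simp
    qed
  qed
qed

lemma cone_measurable:
  "cone m q \<inter> space (\<Pi>\<^sub>M j\<in>{2..Suc m}. lborel) \<in> sets (\<Pi>\<^sub>M j\<in>{2..Suc m}. lborel)"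
proof -
  let ?M = "\<Pi>\<^sub>M j\<in>{2..Suc m}. lborel :: real measure"
  have c: "(\<lambda>\<theta>. \<theta> (b + 2)) \<in> borel_measurable ?M" if "b \<in> {0..<m}" for b
    using measurable_component_singleton[of "b + 2" "{2..Suc m}" "\<lambda>_. lborel :: real measure"] that by simp
  have "{\<theta> \<in> space ?M. (\<forall>b\<in>{0..<m}. 0 < \<theta> (b + 2) \<and> \<theta> (b + 2) < 2 * pi) \<and>
     (\<forall>b\<in>{0..<m}. \<forall>b'\<in>{0..<m}. q b < q b' \<longrightarrow> \<theta> (b' + 2) < \<theta> (b + 2))} \<in> sets ?M"
    by (intro sets.sets_Collect_conj sets.sets_Collect_finite_All sets.sets_Collect_imp borel_measurable_less borel_measurable_const c sets.sets_Collect_const) auto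
  also have "{\<theta> \<in> space ?M. (\<forall>b\<in>{0..<m}. 0 < \<theta> (b + 2) \<and> \<theta> (b + 2) < 2 * pi) \<and>
     (\<forall>b\<in>{0..<m}. \<forall>b'\<in>{0..<m}. q b < q b' \<longrightarrow> \<theta> (b' + 2) < \<theta> (b + 2))} = cone m q \<inter> space ?M"
    unfolding cone_def by blast
  finally show ?thesis .
qed

text \<open>Each open simplex corresponds to its cone under \<open>simplex_angles\<close>, with
  constant density (2 pi)^m, and the cones tile the cube up to a null set.\<close>

lemma integral_box_eq_sum_simplices:
  fixes G :: "(nat \<Rightarrow> real) \<Rightarrow> complex"
  assumes G: "G \<in> borel_measurable (\<Pi>\<^sub>M j\<in>{2..Suc m}. lborel)"
    and int: "set_integrable (\<Pi>\<^sub>M j\<in>{2..Suc m}. lborel) ({2..Suc m} \<rightarrow>\<^sub>E {0..2 * pi}) G"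
  shows "(\<Sum>q | q permutes {0..<m}. (2 * of_real pi) ^ m * (LINT s:open_simplex m|(\<Pi>\<^sub>M i\<in>{1..m}. lborel). G (simplex_angles m q s)))
     = (LINT \<theta>:({2..Suc m} \<rightarrow>\<^sub>E {0..2 * pi})|(\<Pi>\<^sub>M j\<in>{2..Suc m}. lborel). G \<theta>)"
proof -
  let ?M = "\<Pi>\<^sub>M j\<in>{2..Suc m}. lborel :: real measure" and ?B = "{2..Suc m} \<rightarrow>\<^sub>E {0..2 * pi}"
  have cm: "(\<lambda>\<theta>. indicat_real (cone m q) \<theta> *\<^sub>R G \<theta>) \<in> borel_measurable ?M" for q
  proof -
    have "(\<lambda>\<theta>. indicat_real (cone m q \<inter> space ?M) \<theta> *\<^sub>R G \<theta>) \<in> borel_measurable ?M"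
      using cone_measurable[of m q] G by (intro borel_measurable_scaleR borel_measurable_indicator)
    then show ?thesis
      by (rule measurable_cong[THEN iffD1, rotated]) (simp add: indicator_def)
  qed
  have ci: "integrable ?M (\<lambda>\<theta>. indicat_real (cone m q) \<theta> *\<^sub>R G \<theta>)" for q
  proof (rule Bochner_Integration.integrable_bound[OF int[unfolded set_integrable_def] cm AE_I2])
    fix \<theta> assume th: "\<theta> \<in> space ?M"
    have "\<theta> \<in> ?B" if c: "\<theta> \<in> cone m q"
      using cone_subset_box[OF c] th by (simp add: space_PiM PiE_def)
    then show "norm (indicat_real (cone m q) \<theta> *\<^sub>R G \<theta>) \<le> norm (indicat_real ?B \<theta> *\<^sub>R G \<theta>)"
      by (auto simp: indicator_def)
  qed
  have term_eq: "(2 * of_real pi) ^ m * (LINT s:open_simplex m|(\<Pi>\<^sub>M i\<in>{1..m}. lborel). G (simplex_angles m q s))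
     = (\<integral>\<theta>. indicat_real (cone m q) \<theta> *\<^sub>R G \<theta> \<partial>?M)" if q: "q permutes {0..<m}" for q
  proof -
    have "(LINT s:open_simplex m|(\<Pi>\<^sub>M i\<in>{1..m}. lborel). G (simplex_angles m q s))
       = (\<integral>s. indicat_real (cone m q) (simplex_angles m q s) *\<^sub>R G (simplex_angles m q s) \<partial>(\<Pi>\<^sub>M i\<in>{1..m}. lborel))"
      unfolding set_lebesgue_integral_def
    proof (intro Bochner_Integration.integral_cong refl)
      fix s assume "s \<in> space (\<Pi>\<^sub>M i\<in>{1..m}. lborel :: real measure)"
      then have "s \<in> {1..m} \<rightarrow>\<^sub>E UNIV" by (simp add: space_PiM)
      from simplex_angles_in_cone_iff[OF q this]
      show "indicat_real (open_simplex m) s *\<^sub>R G (simplex_angles m q s)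
         = indicat_real (cone m q) (simplex_angles m q s) *\<^sub>R G (simplex_angles m q s)"
        by (simp add: indicator_def)
    qed
    then show ?thesis
      using integral_simplex_angles[OF q cm] by simp
  qed
  have "(\<Sum>q | q permutes {0..<m}. (2 * of_real pi) ^ m * (LINT s:open_simplex m|(\<Pi>\<^sub>M i\<in>{1..m}. lborel). G (simplex_angles m q s)))
     = (\<Sum>q | q permutes {0..<m}. \<integral>\<theta>. indicat_real (cone m q) \<theta> *\<^sub>R G \<theta> \<partial>?M)"
    using term_eq by (intro sum.cong) auto
  also have "\<dots> = (\<integral>\<theta>. (\<Sum>q | q permutes {0..<m}. indicat_real (cone m q) \<theta> *\<^sub>R G \<theta>) \<partial>?M)"
    using ci by (intro Bochner_Integration.integral_sum[symmetric]) auto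
  also have "\<dots> = (\<integral>\<theta>. indicat_real ?B \<theta> *\<^sub>R G \<theta> \<partial>?M)"
  proof (rule integral_cong_AE)
    show "(\<lambda>\<theta>. \<Sum>q | q permutes {0..<m}. indicat_real (cone m q) \<theta> *\<^sub>R G \<theta>) \<in> borel_measurable ?M"
      using cm by (intro borel_measurable_sum) auto
    show "(\<lambda>\<theta>. indicat_real ?B \<theta> *\<^sub>R G \<theta>) \<in> borel_measurable ?M"
      using int unfolding set_integrable_def by (rule borel_measurable_integrable)
    show "AE \<theta> in ?M. (\<Sum>q | q permutes {0..<m}. indicat_real (cone m q) \<theta> *\<^sub>R G \<theta>) = indicat_real ?B \<theta> *\<^sub>R G \<theta>"
      using AE_sum_indicator_cone[of m] by eventually_elim (simp add: scaleR_left.sum[symmetric])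
  qed
  finally show ?thesis by (simp add: set_lebesgue_integral_def)
qed

section \<open>The cycle and its period\<close>

definition cycle_point :: "nat \<Rightarrow> complex \<Rightarrow> (nat \<Rightarrow> real) \<Rightarrow> nat \<Rightarrow> complex" where
  "cycle_point n t \<theta> = lift n t (torus_point {2..n} (torus_radius n) (\<lambda>j. \<theta> (j - 2)))"

lemma cycle_point_periodic:
  assumes "\<And>b. b < n - 1 \<Longrightarrow> \<exists>k::int. \<theta> b = \<theta>' b + 2 * pi * k"
  shows "cycle_point n t \<theta> = cycle_point n t \<theta>'"
proof -
  have "cis (\<theta> (j - 2)) = cis (\<theta>' (j - 2))" if j: "j \<in> {2..n}" for j
  proof -
    have "j - 2 < n - 1" using j by auto
    from assms[OF this] obtain k :: int where k: "\<theta> (j - 2) = \<theta>' (j - 2) + 2 * pi * k" by blast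
    show ?thesis unfolding k cis_mult[symmetric] by (simp add: cis_multiple_2pi)
  qed
  then have "torus_point {2..n} (torus_radius n) (\<lambda>j. \<theta> (j - 2)) = torus_point {2..n} (torus_radius n) (\<lambda>j. \<theta>' (j - 2))"
    by (auto simp: torus_point_def fun_eq_iff)
  then show ?thesis by (simp add: cycle_point_def)
qed

text \<open>Tail sums start at index 1 or later, so the barycentric coordinate 0 may be ignored and
  s 1, ..., s m serve as free coordinates.\<close>

lemma cycle_point_tail_angle:
  assumes "\<And>k. k \<in> {1..m} \<Longrightarrow> y k = s k"
  shows "cycle_point (Suc m) t (tail_angle m q y)
    = lift (Suc m) t (torus_point {2..Suc m} (torus_radius (Suc m)) (simplex_angles m q s))"
proof -
  have "tail_angle m q y b = tail_angle m q s b" for b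
    unfolding tail_angle_def using assms by (intro arg_cong[where f = "\<lambda>x. 2 * pi * x"] sum.cong) auto
  then have "torus_point {2..Suc m} r (\<lambda>j. tail_angle m q y (j - 2)) = torus_point {2..Suc m} r (simplex_angles m q s)" for r
    by (auto simp: torus_point_def simplex_angles_def fun_eq_iff)
  then show ?thesis by (simp add: cycle_point_def)
qed

lemma cycle_point_simplex:
  assumes "simplex_point m s \<in> standard_simplex m"
  shows "torus_simplex m (cycle_point (Suc m) t) q (simplex_point m s)
    = lift (Suc m) t (torus_point {2..Suc m} (torus_radius (Suc m)) (simplex_angles m q s))"
  using assms cycle_point_tail_angle[of m "simplex_point m s" s t q]
  by (simp add: torus_simplex_def simplex_point_def)

lemma torus_radius_pos: "torus_radius n > 0"
  by (simp add: torus_radius_eq)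

lemma simplex_coord:
  assumes "j \<in> {2..Suc m}"
  shows "torus_point {2..Suc m} r (simplex_angles m q s) j = of_real r * cis (2 * pi * (\<Sum>k\<in>{q (j - 2) + 1..m}. s k))"
  using assms by (simp add: torus_point_def simplex_angles_def tail_angle_def)

lemma C1_map_cycle_coord:
  assumes t: "t \<in> params" and j: "j \<in> {1..Suc m}"
  shows "C1_map m (\<lambda>s. lift (Suc m) t (torus_point {2..Suc m} (torus_radius (Suc m)) (simplex_angles m q s)) j)"
proof -
  have c: "C1_map m (\<lambda>s. torus_point {2..Suc m} (torus_radius (Suc m)) (simplex_angles m q s) j)" if "j \<in> {2..Suc m}" for j
    unfolding simplex_coord[OF that] by (intro C1_map_cis_sum) auto
  show ?thesis
  proof (cases "j = 1")
    case True
    have "C1_map m (\<lambda>s. inner_root (Suc m) t (torus_point {2..Suc m} (torus_radius (Suc m)) (simplex_angles m q s)))"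
      by (rule C1_map_inner_root[OF _ t]) (auto intro: torus_point_in_torus torus_radius_pos c)
    then show ?thesis using True by (simp add: lift_def)
  next
    case False
    then show ?thesis using j c[of j] by (simp add: lift_def)
  qed
qed

text \<open>The formula for each coordinate makes sense for all real s, because arbitrary real
  angles give points of the torus; this is the required extension to the affine hull.\<close>

lemma smooth_simplex_torus_simplex:
  assumes t: "t \<in> params"
  shows "smooth_simplex (Suc m) (torus_simplex m (cycle_point (Suc m) t) q)"
  unfolding smooth_simplex_def diff_Suc_1
proof
  fix j assume "j \<in> {1..Suc m}"
  from C1_map_cycle_coord[OF t this, of q] cycle_point_simplex[of m _ t q]
  show "\<exists>h. C1_fun m h \<and> (\<forall>s\<in>{1..m} \<rightarrow>\<^sub>E UNIV. simplex_point m s \<in> standard_simplex m \<longrightarrow>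
      torus_simplex m (cycle_point (Suc m) t) q (simplex_point m s) j = h s)"
    by (intro exI[of _ "\<lambda>s. lift (Suc m) t (torus_point {2..Suc m} (torus_radius (Suc m)) (simplex_angles m q s)) j"])
       (simp add: C1_map_def)
qed

lemma torus_simplex_image:
  assumes t: "t \<in> params"
  shows "torus_simplex m (cycle_point (Suc m) t) q ` standard_simplex m \<subseteq>
     {x \<in> Y (Suc m) t. norm (x 1) < torus_radius (Suc m) \<and> restrict x {2..Suc m} \<in> torus {2..Suc m} (torus_radius (Suc m))}"
  using lift_in_Y[OF _ t torus_point_in_torus[OF torus_radius_pos], of "Suc m"]
  by (auto simp: torus_simplex_def cycle_point_def)

lemma singular_simplex_torus_simplex:
  assumes t: "t \<in> params"
  shows "singular_simplex m (subtopology (cspace (Suc m)) (Y (Suc m) t)) (torus_simplex m (cycle_point (Suc m) t) q)"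
  unfolding singular_simplex_def
proof
  let ?\<sigma> = "torus_simplex m (cycle_point (Suc m) t) q"
  let ?X = "subtopology (powertop_real UNIV) (standard_simplex m)"
  let ?L = "\<lambda>s. lift (Suc m) t (torus_point {2..Suc m} (torus_radius (Suc m)) (simplex_angles m q s))"
  show "?\<sigma> \<in> extensional (standard_simplex m)" by (simp add: torus_simplex_def)
  have eq: "?\<sigma> y = ?L (restrict y {1..m})" if "y \<in> standard_simplex m" for y
    using that cycle_point_tail_angle[of m y "restrict y {1..m}" t q] by (simp add: torus_simplex_def)
  have inY: "?\<sigma> y \<in> Y (Suc m) t" if "y \<in> standard_simplex m" for y
    using torus_simplex_image[OF t, of m q] that by blast
  have "continuous_map ?X (cspace (Suc m)) ?\<sigma>"
    unfolding cspace_def continuous_map_componentwise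
  proof (intro conjI ballI)
    show "?\<sigma> ` topspace ?X \<subseteq> extensional {1..Suc m}"
      using inY by (auto simp: Y_def PiE_def)
    fix j assume j: "j \<in> {1..Suc m}"
    have r: "continuous_map ?X (product_topology (\<lambda>_. euclideanreal) {1..m}) (\<lambda>y. restrict y {1..m})"
      by (intro continuous_map_from_subtopology) (auto simp: continuous_map_componentwise intro: continuous_map_product_projection)
    have "continuous_map (product_topology (\<lambda>_. euclideanreal) {1..m}) euclidean (\<lambda>s. ?L s j)"
      using C1_map_cycle_coord[OF t j] by (simp add: C1_map_def)
    from continuous_map_compose[OF r this]
    show "continuous_map ?X euclidean (\<lambda>y. ?\<sigma> y j)"
      by (rule continuous_map_eq) (use eq in \<open>simp add: comp_def\<close>)
  qed
  then show "continuous_map ?X (subtopology (cspace (Suc m)) (Y (Suc m) t)) ?\<sigma>"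
    using inY by (auto simp: continuous_map_in_subtopology)
qed

lemma smooth_cycle_torus_chain:
  assumes t: "t \<in> params"
  shows "smooth_cycle (Suc m) t (torus_chain m (cycle_point (Suc m) t))"
proof -
  have "chain_boundary m (torus_chain m (cycle_point (Suc m) t)) = 0"
    by (rule chain_boundary_torus_chain) (rule cycle_point_periodic, simp)
  moreover have "singular_chain m (subtopology (cspace (Suc m)) (Y (Suc m) t)) (torus_chain m (cycle_point (Suc m) t))"
    using keys_torus_chain[of m "cycle_point (Suc m) t"] singular_simplex_torus_simplex[OF t, of m]
    unfolding singular_chain_def by blast
  ultimately show ?thesis
    using keys_torus_chain[of m "cycle_point (Suc m) t"] smooth_simplex_torus_simplex[OF t]
    unfolding smooth_cycle_def singular_cycle diff_Suc_1 by blast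
qed

lemma simplex_point_in_standard_simplex:
  assumes "s \<in> open_simplex m"
  shows "simplex_point m s \<in> standard_simplex m"
proof -
  have pos: "s k > 0" if "k \<in> {1..m}" for k using assms that by (auto simp: open_simplex_def)
  have lt: "(\<Sum>k=1..m. s k) < 1" using assms by (simp add: open_simplex_def)
  have le: "s i \<le> (\<Sum>k=1..m. s k)" if "i \<in> {1..m}" for i
    using that pos by (intro member_le_sum) (auto intro: less_imp_le)
  have nn: "(\<Sum>k=1..m. s k) \<ge> 0" using pos by (intro sum_nonneg) (auto intro: less_imp_le)
  have "{..m} = insert 0 {1..m}" by auto
  then have "(\<Sum>i\<le>m. simplex_point m s i) = simplex_point m s 0 + (\<Sum>i=1..m. simplex_point m s i)" by simp
  also have "(\<Sum>i=1..m. simplex_point m s i) = (\<Sum>i=1..m. s i)" by (intro sum.cong) (auto simp: simplex_point_def)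
  finally have "(\<Sum>i\<le>m. simplex_point m s i) = 1" by (simp add: simplex_point_def)
  moreover have "0 \<le> simplex_point m s i \<and> simplex_point m s i \<le> 1" for i
    using pos[of i] le[of i] lt nn by (auto simp: simplex_point_def intro: less_imp_le)
  ultimately show ?thesis by (simp add: standard_simplex_def simplex_point_def)
qed

text \<open>For the coordinates beyond the first, \<open>lift\<close> changes nothing, so only the
  rotation by a tail sum is differentiated. The simplex agrees with its smooth formula on the
  standard simplex, hence near an interior point.\<close>

lemma vector_derivative_cycle_coord:
  assumes s: "s \<in> open_simplex m" and a: "a < m" and b: "b < m"
  shows "vector_derivative (\<lambda>y. torus_simplex m (cycle_point (Suc m) t) q (simplex_point m (s(a + 1 := y))) (b + 2)) (at (s (a + 1)))
    = (if q b \<le> a then 1 else 0) * (2 * of_real pi * \<i> * torus_point {2..Suc m} (torus_radius (Suc m)) (simplex_angles m q s) (b + 2))"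
proof (rule vector_derivative_at)
  let ?r = "torus_radius (Suc m)"
  define K where "K = (\<Sum>k\<in>{1..m} - {a + 1}. s k)"
  have a1: "a + 1 \<in> {1..m}" using a by simp
  have K: "(\<Sum>k=1..m. (s(a + 1 := y)) k) = y + K" for y
    unfolding K_def using a1 by (subst sum.remove[of _ "a + 1"]) (auto intro!: sum.cong)
  \<comment> \<open>The interval consists of the values of this coordinate that keep the point in
    the open simplex; K is the sum of the others.\<close>
  have up: "s(a + 1 := y) \<in> open_simplex m" if "y \<in> {0<..<1 - K}" for y
    using s a1 that K[of y] by (auto simp: open_simplex_def PiE_iff extensional_def)
  have j: "b + 2 \<in> {2..Suc m}" using b by simp
  have "((\<lambda>y. of_real ?r * cis (2 * pi * (\<Sum>k\<in>{q b + 1..m}. (s(a + 1 := y)) k))) has_vector_derivative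
     (if a + 1 \<in> {q b + 1..m} then of_real (2 * pi) * \<i> else 0) * (of_real ?r * cis (2 * pi * (\<Sum>k\<in>{q b + 1..m}. s k)))) (at (s (a + 1)))"
    by (rule has_vector_derivative_cis_sum) simp
  then have d: "((\<lambda>y. of_real ?r * cis (2 * pi * (\<Sum>k\<in>{q b + 1..m}. (s(a + 1 := y)) k))) has_vector_derivative
     (if q b \<le> a then 1 else 0) * (2 * of_real pi * \<i> * torus_point {2..Suc m} ?r (simplex_angles m q s) (b + 2))) (at (s (a + 1)))"
    unfolding simplex_coord[OF j] using a by (cases "q b \<le> a") (simp_all add: mult.assoc)
  show "((\<lambda>y. torus_simplex m (cycle_point (Suc m) t) q (simplex_point m (s(a + 1 := y))) (b + 2)) has_vector_derivative
     (if q b \<le> a then 1 else 0) * (2 * of_real pi * \<i> * torus_point {2..Suc m} ?r (simplex_angles m q s) (b + 2))) (at (s (a + 1)))"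
  proof (rule has_vector_derivative_transform_within_open[OF d open_greaterThanLessThan[of 0 "1 - K"]])
    show "s (a + 1) \<in> {0<..<1 - K}"
      using s a1 K[of "s (a + 1)"] unfolding fun_upd_triv by (auto simp: open_simplex_def PiE_iff)
    fix y assume "y \<in> {0<..<1 - K}"
    from cycle_point_simplex[OF simplex_point_in_standard_simplex[OF up[OF this]], of t q]
    show "of_real ?r * cis (2 * pi * (\<Sum>k\<in>{q b + 1..m}. (s(a + 1 := y)) k))
       = torus_simplex m (cycle_point (Suc m) t) q (simplex_point m (s(a + 1 := y))) (b + 2)"
      using simplex_coord[OF j, of ?r q "s(a + 1 := y)"] by (simp add: lift_def)
  qed
qed

text \<open>After composing with q, the Leibniz sum runs over permutations p with p a \<le> a for
  all a, and only the identity is of this kind.\<close>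

lemma det_permuted_triangular:
  fixes d :: "nat \<Rightarrow> 'a :: comm_ring_1"
  assumes q: "q permutes {0..<m}"
  shows "Determinant.det (Matrix.mat m m (\<lambda>(a, b). (if q b \<le> a then 1 else 0) * d b)) = of_int (sign q) * (\<Prod>b=0..<m. d b)"
proof -
  let ?P = "{p. p permutes {0..<m}}"
  define g where "g = (\<lambda>p. of_int (sign p) * (\<Prod>a=0..<m. if p a \<le> a then 1 else 0) :: 'a)"
  have "Determinant.det (Matrix.mat m m (\<lambda>(a, b). (if q b \<le> a then 1 else 0) * d b))
     = (\<Sum>p\<in>?P. of_int (sign p) * (\<Prod>a=0..<m. (if q (p a) \<le> a then 1 else 0) * d (p a)))"
    by (subst det_def'[of _ m]) (auto intro!: sum.cong prod.cong dest: permutes_in_image[where x = "_ :: nat", THEN iffD2])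
  also have "\<dots> = (\<Sum>p\<in>?P. of_int (sign q) * (\<Prod>b=0..<m. d b) * g (q \<circ> p))"
  proof (intro sum.cong refl)
    fix p assume "p \<in> ?P"
    then have p: "p permutes {0..<m}" by simp
    have pd: "(\<Prod>a=0..<m. d (p a)) = (\<Prod>b=0..<m. d b)"
      using prod.permute[OF p, of d] by (simp add: comp_def)
    have sg: "sign (q \<circ> p) = sign q * sign p"
      using p q by (intro sign_compose) (auto intro: permutation_permutes[THEN iffD2])
    have sq: "of_int (sign q) * of_int (sign q) = (1 :: 'a)"
      by (simp add: sign_def)
    have "of_int (sign q) * (\<Prod>b=0..<m. d b) * g (q \<circ> p)
      = (of_int (sign q) * of_int (sign q)) * (of_int (sign p) * ((\<Prod>a=0..<m. if q (p a) \<le> a then 1 else 0) * (\<Prod>b=0..<m. d b)))"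
      by (simp only: g_def sg of_int_mult comp_apply mult_ac)
    then show "of_int (sign p) * (\<Prod>a=0..<m. (if q (p a) \<le> a then 1 else 0) * d (p a))
       = of_int (sign q) * (\<Prod>b=0..<m. d b) * g (q \<circ> p)"
      by (simp only: sq mult_1_left prod.distrib pd)
  qed
  also have "\<dots> = of_int (sign q) * (\<Prod>b=0..<m. d b) * (\<Sum>p\<in>?P. g (q \<circ> p))"
    by (simp add: sum_distrib_left)
  also have "(\<Sum>p\<in>?P. g (q \<circ> p)) = (\<Sum>p\<in>?P. g p)"
    by (rule setum_permutations_compose_left[OF q, symmetric])
  also have "\<dots> = (\<Sum>p\<in>{id}. g p)"
  proof (intro sum.mono_neutral_right ballI)
    fix p assume "p \<in> ?P - {id}"
    then have p: "p permutes {0..<m}" "p \<noteq> id" by auto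
    then obtain a where a: "a \<in> {0..<m}" "\<not> p a \<le> a"
      using permutes_natset_le[OF p(1)] by blast
    then have "(\<Prod>a=0..<m. if p a \<le> a then 1 else 0 :: 'a) = 0"
      by (intro prod_zero) auto
    then show "g p = 0" by (simp add: g_def)
  qed (auto simp: permutes_id finite_permutations)
  also have "\<dots> = 1" by (simp add: g_def)
  finally show ?thesis by simp
qed

text \<open>Column b of the Jacobian is 2 pi i times \<open>x (b + 2)\<close> times the 0-1 pattern
  of the tail sums, so the determinant is the torus integrand's product of the dx up to (2 pi)^m and
  the sign of q.\<close>

lemma simplex_integral_torus_simplex:
  assumes q: "q permutes {0..<m}"
  shows "simplex_integral (Suc m) g (torus_simplex m (cycle_point (Suc m) t) q)
    = of_int (sign q) * ((2 * of_real pi) ^ m * (LINT s:open_simplex m|(\<Pi>\<^sub>M i\<in>{1..m}. lborel).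
        g (lift (Suc m) t (torus_point {2..Suc m} (torus_radius (Suc m)) (simplex_angles m q s))) *
        (\<Prod>j\<in>{2..Suc m}. \<i> * of_real (torus_radius (Suc m)) * cis (simplex_angles m q s j))))"
proof -
  let ?r = "torus_radius (Suc m)" and ?\<sigma> = "torus_simplex m (cycle_point (Suc m) t) q"
  let ?x = "\<lambda>s. torus_point {2..Suc m} ?r (simplex_angles m q s)"
  have det: "Determinant.det (simplex_jacobian (Suc m) ?\<sigma> s)
      = of_int (sign q) * ((2 * of_real pi) ^ m * (\<Prod>j\<in>{2..Suc m}. \<i> * of_real ?r * cis (simplex_angles m q s j)))"
    if s: "s \<in> open_simplex m" for s
  proof -
    have "simplex_jacobian (Suc m) ?\<sigma> s = Matrix.mat m m (\<lambda>(a, b). (if q b \<le> a then 1 else 0) * (2 * of_real pi * \<i> * ?x s (b + 2)))"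
      unfolding simplex_jacobian_def diff_Suc_1
      by (intro cong_mat refl) (simp only: prod.case vector_derivative_cycle_coord[OF s])
    then have "Determinant.det (simplex_jacobian (Suc m) ?\<sigma> s) = of_int (sign q) * (\<Prod>b=0..<m. 2 * of_real pi * \<i> * ?x s (b + 2))"
      by (simp only: det_permuted_triangular[OF q])
    also have "(\<Prod>b=0..<m. 2 * of_real pi * \<i> * ?x s (b + 2)) = (2 * of_real pi) ^ m * (\<Prod>b=0..<m. \<i> * ?x s (b + 2))"
      by (simp only: mult.assoc[of _ \<i>] prod.distrib prod_constant) simp
    also have "(\<Prod>b=0..<m. \<i> * ?x s (b + 2)) = (\<Prod>j\<in>{2..Suc m}. \<i> * ?x s j)"
      by (rule prod.reindex_bij_witness[of _ "\<lambda>j. j - 2" "\<lambda>b. b + 2"]) auto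
    also have "\<dots> = (\<Prod>j\<in>{2..Suc m}. \<i> * of_real ?r * cis (simplex_angles m q s j))"
      by (intro prod.cong refl) (simp add: torus_point_def)
    finally show ?thesis .
  qed
  have "simplex_integral (Suc m) g ?\<sigma> = (LINT s:open_simplex m|(\<Pi>\<^sub>M i\<in>{1..m}. lborel).
     of_int (sign q) * ((2 * of_real pi) ^ m * (g (lift (Suc m) t (?x s)) * (\<Prod>j\<in>{2..Suc m}. \<i> * of_real ?r * cis (simplex_angles m q s j)))))"
    unfolding simplex_integral_def diff_Suc_1 set_lebesgue_integral_def
  proof (intro Bochner_Integration.integral_cong refl)
    fix s :: "nat \<Rightarrow> real"
    show "indicat_real (open_simplex m) s *\<^sub>R (g (?\<sigma> (simplex_point m s)) * Determinant.det (simplex_jacobian (Suc m) ?\<sigma> s))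
      = indicat_real (open_simplex m) s *\<^sub>R (of_int (sign q) * ((2 * of_real pi) ^ m * (g (lift (Suc m) t (?x s)) * (\<Prod>j\<in>{2..Suc m}. \<i> * of_real ?r * cis (simplex_angles m q s j)))))"
    proof (cases "s \<in> open_simplex m")
      case True
      show ?thesis
        unfolding det[OF True] cycle_point_simplex[OF simplex_point_in_standard_simplex[OF True]]
        by (simp only: mult.left_commute)
    qed simp
  qed
  then show ?thesis by (simp only: set_integral_mult_right)
qed

lemma period_torus_chain:
  assumes t: "t \<in> params"
  shows "period (Suc m) t (torus_chain m (cycle_point (Suc m) t))
    = torus_integral {2..Suc m} (torus_radius (Suc m)) (\<lambda>x. eta_coeff (Suc m) t (lift (Suc m) t x))"
proof -
  let ?n = "Suc m"
  let ?r = "torus_radius ?n"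
  \<comment> \<open>The closed form of the coefficient on the graph; continuity in the angles is
    known for it, and it agrees with \<open>eta_coeff\<close> on the torus.\<close>
  let ?E = "\<lambda>x. 1 / (base_prod ?n x * (inner_root ?n t x - outer_root ?n t x))"
  define G where "G = (\<lambda>\<theta>. ?E (torus_point {2..?n} ?r \<theta>) * (\<Prod>j\<in>{2..?n}. \<i> * of_real ?r * cis (\<theta> j)))"
  have n: "?n \<ge> 1" by simp
  have E: "eta_coeff ?n t (lift ?n t x) = ?E x" if "x \<in> torus {2..?n} ?r" for x
    by (rule lift_eta_coeff[OF n t that])
  have cont: "continuous_map (product_topology (\<lambda>_. euclideanreal) {2..?n}) euclidean G"
    unfolding G_def mult.assoc using torus_cont_eta[OF n t]
    by (intro continuous_map_mult' continuous_map_prod' continuous_map_cis_coord) (auto simp: torus_cont_def)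
  have G: "G \<in> borel_measurable (\<Pi>\<^sub>M j\<in>{2..?n}. lborel)"
    by (rule borel_measurable_continuous_map_PiM[OF cont])
  have int: "set_integrable (\<Pi>\<^sub>M j\<in>{2..?n}. lborel) ({2..?n} \<rightarrow>\<^sub>E {0..2 * pi}) G"
    using torus_integrable[OF _ torus_cont_eta[OF n t]] unfolding G_def torus_point_def by simp
  have sq: "of_int (sign q) * (of_int (sign q) * z) = (z :: complex)" for q :: "nat \<Rightarrow> nat" and z
    by (simp add: sign_def)
  have "period ?n t (torus_chain m (cycle_point ?n t))
     = (\<Sum>q | q permutes {0..<m}. of_int (sign q) * simplex_integral ?n (eta_coeff ?n t) (torus_simplex m (cycle_point ?n t) q))"
    unfolding period_def by (rule chain_integral_torus_chain)
  also have "\<dots> = (\<Sum>q | q permutes {0..<m}. (2 * of_real pi) ^ m * (LINT s:open_simplex m|(\<Pi>\<^sub>M i\<in>{1..m}. lborel). G (simplex_angles m q s)))"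
  proof (intro sum.cong refl)
    fix q assume "q \<in> {q. q permutes {0..<m}}"
    then have q: "q permutes {0..<m}" by simp
    show "of_int (sign q) * simplex_integral ?n (eta_coeff ?n t) (torus_simplex m (cycle_point ?n t) q)
      = (2 * of_real pi) ^ m * (LINT s:open_simplex m|(\<Pi>\<^sub>M i\<in>{1..m}. lborel). G (simplex_angles m q s))"
      unfolding simplex_integral_torus_simplex[OF q] sq G_def E[OF torus_point_in_torus[OF torus_radius_pos]] ..
  qed
  also have "\<dots> = (LINT \<theta>:({2..?n} \<rightarrow>\<^sub>E {0..2 * pi})|(\<Pi>\<^sub>M j\<in>{2..?n}. lborel). G \<theta>)"
    by (rule integral_box_eq_sum_simplices[OF G int])
  also have "\<dots> = torus_integral {2..?n} ?r ?E"
    by (simp only: torus_integral_def G_def torus_point_def)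
  also have "\<dots> = torus_integral {2..?n} ?r (\<lambda>x. eta_coeff ?n t (lift ?n t x))"
    by (intro torus_integral_cong torus_radius_pos E[symmetric])
  finally show ?thesis .
qed

lemma period_eq_hypergeo:
  assumes t: "t \<in> params"
  shows "period (Suc m) t (torus_chain m (cycle_point (Suc m) t))
    = (2 * of_real pi * \<i>) ^ m * eval_fps (fps_hypergeo (fractions (Suc m + 1)) (replicate m 1) 1) t"
proof -
  have "2 * of_real pi * \<i> * period (Suc m) t (torus_chain m (cycle_point (Suc m) t))
      = torus_integral {1..Suc m} (torus_radius (Suc m)) (\<lambda>x. 1 / f_poly (Suc m) x t)"
    unfolding period_torus_chain[OF t] by (rule torus_integral_fibre[OF _ t, symmetric]) simp
  also have "\<dots> = 2 * of_real pi * \<i> * ((2 * of_real pi * \<i>) ^ m * eval_fps (fps_hypergeo (fractions (Suc m + 1)) (replicate m 1) 1) t)"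
    using hypergeo_sums(3)[OF _ t, of "Suc m"] by (simp only: diff_Suc_1 power_Suc mult.assoc)
  finally show ?thesis unfolding mult_cancel_left by simp
qed

lemma determined_by_torus_chain:
  assumes t: "t \<in> params"
  shows "determined_by_torus (Suc m) (torus_radius (Suc m)) t (torus_chain m (cycle_point (Suc m) t))"
  unfolding determined_by_torus_def diff_Suc_1
proof (intro conjI ballI)
  let ?n = "Suc m"
  have n: "?n \<ge> 1" by simp
  show "f_poly ?n x t \<noteq> 0" if "x \<in> torus {1..?n} (torus_radius ?n)" for x
    by (rule f_poly_on_torus(4)[OF n t that])
  show "\<sigma> ` standard_simplex m \<subseteq> {x \<in> Y ?n t. norm (x 1) < torus_radius ?n \<and> restrict x {2..?n} \<in> torus {2..?n} (torus_radius ?n)}"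
    if "\<sigma> \<in> Poly_Mapping.keys (torus_chain m (cycle_point ?n t))" for \<sigma>
    using that keys_torus_chain[of m "cycle_point ?n t"] torus_simplex_image[OF t, of m] by blast
  show "period ?n t (torus_chain m (cycle_point ?n t)) = torus_integral {2..?n} (torus_radius ?n)
     (\<lambda>x. \<Sum>a | norm a < torus_radius ?n \<and> f_poly ?n (x(1 := a)) t = 0. residue (\<lambda>z. 1 / f_poly ?n (x(1 := z)) t) a)"
    unfolding period_torus_chain[OF t]
    by (intro torus_integral_cong torus_radius_pos inner_circle(1)[OF n t, symmetric])
  show "torus_integral {1..?n} (torus_radius ?n) (\<lambda>x. 1 / f_poly ?n x t) = 2 * of_real pi * \<i> * period ?n t (torus_chain m (cycle_point ?n t))"
    unfolding period_torus_chain[OF t] by (rule torus_integral_fibre[OF n t])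
qed

theorem proposition7p2:
  shows "\<exists>(\<Sigma> :: nat \<Rightarrow> complex \<Rightarrow> (nat \<Rightarrow> complex) chain) (\<omega> :: nat \<Rightarrow> complex \<Rightarrow> complex).
    (\<forall>n\<ge>1. \<forall>t\<in>params.
       transcendental_cycle n t (\<Sigma> (n - 1) t) \<and>
       determined_by_torus n (torus_radius n) t (\<Sigma> (n - 1) t) \<and>
       \<omega> (n - 1) t = period n t (\<Sigma> (n - 1) t) \<and>
       \<omega> (n - 1) t = (2 * of_real pi * \<i>) ^ (n - 1) *
         eval_fps (fps_hypergeo (fractions (n + 1)) (replicate (n - 1) 1) 1) t) \<and>
    (\<forall>n\<ge>2.
       torus {1..n} (torus_radius n) =
         (\<lambda>x. \<lambda>i\<in>{1..n}. of_nat n / of_nat (n + 1) * x i) `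
           {x \<in> {1..n} \<rightarrow>\<^sub>E UNIV. restrict x {1..n - 1} \<in> torus {1..n - 1} (torus_radius (n - 1)) \<and>
                                norm (x n) = torus_radius (n - 1)} \<and>
       (\<forall>t u. t \<notin> {0, 1} \<and> u \<notin> {0, -1} \<longrightarrow>
          homeomorphic_map (subtopology (cspace n) (fibre n t u))
            (subtopology (cspace (n - 1)) (Y (n - 1) (t_tilde n t u))) (fibre_coords n)) \<and>
       (\<forall>t\<in>params.
          \<omega> (n - 1) t = contour_integral (circlepath 0 (torus_radius n))
            (\<lambda>u. \<omega> (n - 2) (t_tilde n t u) / (u * (u + 1)))) \<and>
       (\<exists>W. represents params W (\<omega> (n - 2)) \<and>
            represents params
              (fps_const (2 * of_real pi * \<i>) *
                 hadamard (fps_hypergeo (fractions (n + 1)) (fractions n) 1) W)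
              (\<omega> (n - 1))))"
proof -
  define F where "F = (\<lambda>m. fps_hypergeo (fractions (m + 2)) (replicate m 1) 1)"
  \<comment> \<open>Defined by the series, so that its coefficients are at hand; \<open>per\<close>
    identifies it with the period on \<open>params\<close>.\<close>
  define \<omega> where "\<omega> = (\<lambda>m t. (2 * of_real pi * \<i>) ^ m * eval_fps (F m) t)"
  define \<Sigma> where "\<Sigma> = (\<lambda>m t. torus_chain m (cycle_point (Suc m) t))"
  have sums: "(\<lambda>k. of_real (hcoeff (Suc m) k) * t ^ k) sums eval_fps (F m) t" and nz: "eval_fps (F m) t \<noteq> 0"
    if "t \<in> params" for m t
    using hypergeo_sums(1,2)[OF _ that, of "Suc m"] by (simp_all add: F_def)
  have coeff: "fps_nth (F m) k = of_real (hcoeff (Suc m) k)" for m k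
    using fps_nth_hypergeo_ones[of "Suc m" k] by (simp only: F_def) simp
  have per: "period (Suc m) t (\<Sigma> m t) = \<omega> m t" if "t \<in> params" for m t
    using period_eq_hypergeo[OF that, of m] by (simp add: \<Sigma>_def \<omega>_def F_def)
  have cycle: "transcendental_cycle n t (\<Sigma> (n - 1) t) \<and>
       determined_by_torus n (torus_radius n) t (\<Sigma> (n - 1) t) \<and>
       \<omega> (n - 1) t = period n t (\<Sigma> (n - 1) t) \<and>
       \<omega> (n - 1) t = (2 * of_real pi * \<i>) ^ (n - 1) *
         eval_fps (fps_hypergeo (fractions (n + 1)) (replicate (n - 1) 1) 1) t"
    if n: "n \<ge> 1" and t: "t \<in> params" for n t
  proof -
    obtain m where m: "n = Suc m" using n by (cases n) auto
    have "\<omega> m t \<noteq> 0" using nz[OF t] by (simp add: \<omega>_def)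
    moreover have "smooth_cycle (Suc m) t (\<Sigma> m t)"
      unfolding \<Sigma>_def by (rule smooth_cycle_torus_chain[OF t])
    moreover have "determined_by_torus (Suc m) (torus_radius (Suc m)) t (\<Sigma> m t)"
      unfolding \<Sigma>_def by (rule determined_by_torus_chain[OF t])
    ultimately show ?thesis
      unfolding m transcendental_cycle_def diff_Suc_1 per[OF t] by (simp add: \<omega>_def F_def)
  qed
  have fibration: "\<omega> (n - 1) t = contour_integral (circlepath 0 (torus_radius n)) (\<lambda>u. \<omega> (n - 2) (t_tilde n t u) / (u * (u + 1)))"
    if n: "n \<ge> 2" and t: "t \<in> params" for n t
  proof -
    have "n = Suc (Suc (n - 2))" using n by simp
    then obtain l where l: "n = Suc (Suc l)" by blast
    have r: "torus_radius n > 0" by (rule torus_radius_pos)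
    let ?h = "\<lambda>u. eval_fps (F l) (t_tilde n t u) / (u * (u + 1))"
    have eq: "2 * of_real pi * \<i> * eval_fps (F (Suc l)) t = contour_integral (circlepath 0 (torus_radius n)) ?h"
      using fibration_contour_integral[OF n t] by (simp add: l F_def)
    \<comment> \<open>A contour integral that does not exist has the default value 0. Here the value
      is a nonzero multiple of a nonvanishing series, so integrability follows from it.\<close>
    have nz2: "contour_integral (circlepath 0 (torus_radius n)) ?h \<noteq> 0"
      using nz[OF t, of "Suc l"] by (simp flip: eq)
    then have ci: "?h contour_integrable_on circlepath 0 (torus_radius n)"
      using not_integrable_contour_integral by blast
    have "contour_integral (circlepath 0 (torus_radius n)) (\<lambda>u. \<omega> l (t_tilde n t u) / (u * (u + 1)))
       = contour_integral (circlepath 0 (torus_radius n)) (\<lambda>u. (2 * of_real pi * \<i>) ^ l * ?h u)"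
      by (simp add: \<omega>_def)
    also have "\<dots> = (2 * of_real pi * \<i>) ^ l * contour_integral (circlepath 0 (torus_radius n)) ?h"
      by (rule contour_integral_lmul[OF ci])
    also have "\<dots> = \<omega> (Suc l) t"
      unfolding eq[symmetric] by (simp add: \<omega>_def)
    finally show ?thesis by (simp add: l)
  qed
  have product: "\<exists>W. represents params W (\<omega> (n - 2)) \<and>
            represents params
              (fps_const (2 * of_real pi * \<i>) *
                 hadamard (fps_hypergeo (fractions (n + 1)) (fractions n) 1) W)
              (\<omega> (n - 1))"
    if n: "n \<ge> 2" for n
  proof -
    have "n = Suc (Suc (n - 2))" using n by simp
    then obtain l where l: "n = Suc (Suc l)" by blast
    \<comment> \<open>The expansion of the lower period with its factor 2 pi i to the power l = n -
      2; the missing factor is the one in front of the Hadamard product.\<close>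
    define W where "W = fps_const ((2 * of_real pi * \<i>) ^ l) * F l"
    have "represents params W (\<omega> (n - 2))"
      unfolding represents_def W_def \<omega>_def l
      using sums_mult[OF sums[of _ l], of _ "(2 * of_real pi * \<i>) ^ l"] by (simp add: coeff mult.assoc)
    moreover have "fps_nth (fps_const (2 * of_real pi * \<i>) * hadamard (fps_hypergeo (fractions (n + 1)) (fractions n) 1) W) k
       = (2 * of_real pi * \<i>) ^ Suc l * of_real (hcoeff n k)" for k
    proof -
      have "fps_nth (hadamard (fps_hypergeo (fractions (n + 1)) (fractions n) 1) W) k
         = fps_nth (fps_hypergeo (fractions (n + 1)) (fractions n) 1) k * ((2 * of_real pi * \<i>) ^ l * of_real (hcoeff (n - 1) k))"
        by (simp only: hadamard_def W_def fps_nth_Abs_fps fps_mult_left_const_nth coeff l diff_Suc_1)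
      also have "\<dots> = (2 * of_real pi * \<i>) ^ l * of_real (hcoeff n k)"
      proof -
        have n1: "n \<ge> 1" using n by simp
        have "fps_nth (fps_hypergeo (fractions (n + 1)) (fractions n) 1) k * of_real (hcoeff (n - 1) k) = of_real (hcoeff n k)"
          using arg_cong[OF hcoeff_rec[OF n1, of k], of complex_of_real] unfolding fps_nth_hypergeo_fractions[OF n1]
          by (simp only: of_real_mult of_real_divide of_real_power of_real_of_nat_eq)
        then show ?thesis by (metis mult.left_commute)
      qed
      finally show ?thesis by (simp only: fps_mult_left_const_nth power_Suc mult.assoc)
    qed
    then have "represents params (fps_const (2 * of_real pi * \<i>) * hadamard (fps_hypergeo (fractions (n + 1)) (fractions n) 1) W) (\<omega> (n - 1))"
      unfolding represents_def \<omega>_def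
      using sums_mult[OF sums[of _ "Suc l"], of _ "(2 * of_real pi * \<i>) ^ Suc l"] by (simp only: l diff_Suc_1 mult.assoc) simp
    ultimately show ?thesis by blast
  qed
  show ?thesis
  proof (intro exI[of _ \<Sigma>] exI[of _ \<omega>] conjI, goal_cases)
    case 1
    show ?case using cycle by blast
  next
    case 2
    show ?case
    proof (intro allI impI conjI ballI, goal_cases)
      case (1 n)
      then show ?case by (rule torus_rescaling)
    next
      case (2 n t u)
      then show ?case by (intro fibre_coords_homeomorphic) auto
    next
      case (3 n t)
      then show ?case by (rule fibration)
    next
      case (4 n)
      then show ?case by (rule product)
    qed
  qed
qed

end
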